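(* Every Cappell–Shaneson matrix of trace $n$ is Gompf equivalent to $A_0=X_{1,1,2}$ (equivalently, every $(c,d,n)\in\mathcal{CS}$ is Gompf equivalent to $(1,1,2)$), whenever $-64\le n\le 69$ or $n\in\{-73,-69,-67,-66,71,72,74,78\}$.
   Context: $f_n(x)=x^3-nx^2+(n-1)x-1$. A Cappell–Shaneson (CS) matrix is $A\in SL(3;\mathbb{Z})$ with $\det(A-I)=1$; its trace is $\operatorname{tr}A$. Let $\mathcal{CS}=\{(c,d,n)\in\mathbb{Z}^3 : d\neq 0,\ f_n(c)\equiv 0 \pmod d\}$. For $(c,d,n)\in\mathcal{CS}$ let $X_{c,d,n}=\begin{bmatrix}0&a&b\\0&c&d\\1&0&n-c\end{bmatrix}$ with $b=(c-1)(n-c-1)$ and $a=-f_n(c)/d$ (so $ad-bc=1$); this is the unique CS matrix of this shape, and $(c,d,n)\mapsto X_{c,d,n}$ is a bijection from $\mathcal{CS}$ to such "standard" CS matrices. Two matrices $A,B\in SL(3;\mathbb{Z})$ are similar if $B=PAP^{-1}$ for some $P\in SL(3;\mathbb{Z})$. Gompf equivalence $\sim$ on $\mathcal{CS}$ is the equivalence relation generated by: (i) $(c,d,n)\sim(c',d',n')$ whenever $X_{c,d,n}$ and $X_{c',d',n'}$ are similar; (ii) $(c,d,n)\sim(c,d,n+kd)$ for all $k\in\mathbb{Z}$. Two standard CS matrices are Gompf equivalent if their triples are, and a general CS matrix is Gompf equivalent to $A_0$ if it is similar to a standard CS matrix Gompf equivalent to $X_{1,1,2}$ (every CS matrix is similar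 to a standard one). *)

theory Defs
  imports "HOL-Analysis.Analysis"
begin

type_synonym mat3 = "int^3^3"

definition fpoly :: "int \<Rightarrow> int \<Rightarrow> int" where
  "fpoly n x = x^3 - n * x^2 + (n - 1) * x - 1"

definition CS_matrix :: "mat3 \<Rightarrow> bool" where
  "CS_matrix A \<longleftrightarrow> det A = 1 \<and> det (A - mat 1) = 1"

definition CS_triples :: "(int \<times> int \<times> int) set" where
  "CS_triples = {(c, d, n). d \<noteq> 0 \<and> d dvd fpoly n c}"

text \<open>The standard CS matrix X_{c,d,n}; on CS_triples the division is exact.\<close>
definition Xmat :: "int \<Rightarrow> int \<Rightarrow> int \<Rightarrow> mat3" where
  "Xmat c d n = vector [ vector [0, - (fpoly n c div d), (c - 1) * (n - c - 1)],
                         vector [0, c, d],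
                         vector [1, 0, n - c] ]"

definition similar_SL3 :: "mat3 \<Rightarrow> mat3 \<Rightarrow> bool" where
  "similar_SL3 A B \<longleftrightarrow> (\<exists>P Q :: mat3. det P = 1 \<and> P ** Q = mat 1 \<and> Q ** P = mat 1
                                   \<and> B = P ** A ** Q)"

definition gompf_step :: "int \<times> int \<times> int \<Rightarrow> int \<times> int \<times> int \<Rightarrow> bool" where
  "gompf_step t t' \<longleftrightarrow> t \<in> CS_triples \<and> t' \<in> CS_triples \<and>
     ((case t of (c, d, n) \<Rightarrow> case t' of (c', d', n') \<Rightarrow>
         similar_SL3 (Xmat c d n) (Xmat c' d' n')) \<or>
      (case t of (c, d, n) \<Rightarrow> \<exists>k::int. t' = (c, d, n + k * d)))"

definition gompf_equiv :: "int \<times> int \<times> int \<Rightarrow> int \<times> int \<times> int \<Rightarrow> bool" where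
  "gompf_equiv = (sup gompf_step gompf_step\<inverse>\<inverse>)\<^sup>*\<^sup>*"

definition gompf_equiv_A0 :: "mat3 \<Rightarrow> bool" where
  "gompf_equiv_A0 A \<longleftrightarrow> (\<exists>c d n. (c, d, n) \<in> CS_triples \<and>
       similar_SL3 A (Xmat c d n) \<and> gompf_equiv (c, d, n) (1, 1, 2))"

end

theory Submission
  imports Defs
begin

text \<open>
  Let \<open>F\<^sub>A v = det (v, A v, A\<^sup>2 v)\<close>. If \<open>v\<close> and \<open>A v\<close> span a primitive sublattice then \<open>v\<close> extends to a
  basis in which \<open>A\<close> is \<open>X\<^sub>c\<^sub>,\<^sub>d\<^sub>,\<^sub>n\<close> with \<open>\<bar>d\<bar> = \<bar>F\<^sub>A v\<bar>\<close>. On the plane of covectors vanishing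
  on \<open>v\<close>, the index form of the transpose of \<open>A\<close> is a binary cubic form of discriminant
  \<open>D(n) (F\<^sub>A v)\<^sup>2\<close>, where \<open>D(n) = n(n-2)(n-3)(n-5) - 23\<close>. Hermite reduction of its Hessian gives a
  covector whose index is at most \<open>sqrt ((4/27) sqrt (D n) \<bar>F\<^sub>A v\<bar>)\<close>; hence the smallest index occurring for
  \<open>A\<close> or its transpose is at most \<open>(4/27) sqrt (D n)\<close>, and each trace leaves finitely many triples.

  Let \<open>\<theta>\<close> be a root of \<open>f\<^sub>n\<close>. If the norm of \<open>k - x \<theta>\<close> factors as \<open>\<plusminus> d e\<close>, with \<open>c = k/x\<close> modulo \<open>d\<close>
  and \<open>c' = k/x\<close> modulo \<open>e\<close>, then the ideals \<open>(\<theta> - c, d)\<close> and \<open>(\<theta> - c', e)\<close> have principal product, and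
  correspondingly the transpose of \<open>X\<^sub>c\<^sub>,\<^sub>d\<^sub>,\<^sub>n\<close> is similar to \<open>X\<^sub>c\<^sub>'\<^sub>,\<^sub>e\<^sub>,\<^sub>n\<close>. Chains of such turns and of
  shifts \<open>n \<mapsto> n + k d\<close> lead from each of the finitely many triples, and from its transpose, to a
  triple with smaller \<open>d\<close> or to a trace already settled. Since \<open>A \<mapsto> A (A - 1)\<^sup>-\<^sup>1\<close> exchanges the traces
  \<open>n\<close> and \<open>5 - n\<close> and respects Gompf equivalence, only \<open>n \<ge> 3\<close> has to be treated.
\<close>

section \<open>Integer matrices and their standard forms\<close>

text \<open>Transposition has no evident compatibility with Gompf equivalence: a shift acts on
  \<open>Xmat c d n\<close> but not on its transpose. The reduction nevertheless mixes the two,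
  because the dual plane of a vector belongs to the transposed matrix and every turn transposes.
  Therefore statements about triples carry a flag, and a matrix and its transpose are settled
  together; a chain for a transposed goal can shift only after an odd number of turns.

  A second obstacle is that a vector of least index need not extend to a standard basis. In
  Hessenberg form with subdiagonal entries g and s its index is g^2 s up to sign, and for |g| > 1
  the vector and its image span a sublattice that is not primitive. It is then traded for a covector
  of index g e with e prime to g. Its root is known only modulo e, so all lifts modulo g e have to
  be treated.

  Two inductions are nested: one on the trace, and for a fixed trace one on d. Oddness of the norms
  keeps every index nonzero and halves the list of d.\<close>

definition mk3 :: "int \<Rightarrow> int \<Rightarrow> int \<Rightarrow> int \<Rightarrow> int \<Rightarrow> int \<Rightarrow> int \<Rightarrow> int \<Rightarrow> int \<Rightarrow> mat3" where
  "mk3 a b c d e f g h i = vector [vector [a, b, c], vector [d, e, f], vector [g, h, i]]"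

lemma mk3_nth [simp]:
  "mk3 a b c d e f g h i $ 1 $ 1 = a" "mk3 a b c d e f g h i $ 1 $ 2 = b" "mk3 a b c d e f g h i $ 1 $ 3 = c"
  "mk3 a b c d e f g h i $ 2 $ 1 = d" "mk3 a b c d e f g h i $ 2 $ 2 = e" "mk3 a b c d e f g h i $ 2 $ 3 = f"
  "mk3 a b c d e f g h i $ 3 $ 1 = g" "mk3 a b c d e f g h i $ 3 $ 2 = h" "mk3 a b c d e f g h i $ 3 $ 3 = i"
  by (simp_all add: mk3_def)

lemma mk3_eta: "A = mk3 (A$1$1) (A$1$2) (A$1$3) (A$2$1) (A$2$2) (A$2$3) (A$3$1) (A$3$2) (A$3$3)"
  by (simp add: vec_eq_iff forall_3)

lemma mk3_cases:
  obtains a b c d e f g h i where "A = mk3 a b c d e f g h i"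
  using mk3_eta by blast

lemma mk3_inject [simp]:
  "mk3 a b c d e f g h i = mk3 a' b' c' d' e' f' g' h' i' \<longleftrightarrow>
   a = a' \<and> b = b' \<and> c = c' \<and> d = d' \<and> e = e' \<and> f = f' \<and> g = g' \<and> h = h' \<and> i = i'"
  by (auto simp: vec_eq_iff forall_3)

lemma mk3_mult [simp]:
  "mk3 a b c d e f g h i ** mk3 a' b' c' d' e' f' g' h' i' =
   mk3 (a*a' + b*d' + c*g') (a*b' + b*e' + c*h') (a*c' + b*f' + c*i')
       (d*a' + e*d' + f*g') (d*b' + e*e' + f*h') (d*c' + e*f' + f*i')
       (g*a' + h*d' + i*g') (g*b' + h*e' + i*h') (g*c' + h*f' + i*i')"
  by (simp add: vec_eq_iff forall_3 matrix_matrix_mult_def sum_3)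

lemma det_mk3 [simp]:
  "det (mk3 a b c d e f g h i) = a*e*i + b*f*g + c*d*h - a*f*h - b*d*i - c*e*g"
  by (simp add: det_3)

lemma trace_mk3 [simp]: "trace (mk3 a b c d e f g h i) = a + e + i"
  by (simp add: trace_def sum_3)

lemma transpose_mk3 [simp]: "transpose (mk3 a b c d e f g h i) = mk3 a d g b e h c f i"
  by (simp add: vec_eq_iff forall_3 transpose_def)

lemma mat1_mk3: "mat 1 = mk3 1 0 0 0 1 0 0 0 1"
  by (simp add: vec_eq_iff forall_3 mat_def)

lemma add_mk3 [simp]: "mk3 a b c d e f g h i + mk3 a' b' c' d' e' f' g' h' i' =
   mk3 (a+a') (b+b') (c+c') (d+d') (e+e') (f+f') (g+g') (h+h') (i+i')"
  by (simp add: vec_eq_iff forall_3)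

lemma diff_mk3 [simp]: "mk3 a b c d e f g h i - mk3 a' b' c' d' e' f' g' h' i' =
   mk3 (a-a') (b-b') (c-c') (d-d') (e-e') (f-f') (g-g') (h-h') (i-i')"
  by (simp add: vec_eq_iff forall_3)

section \<open>Adjugates, similarity and standard forms\<close>

definition adj3 :: "mat3 \<Rightarrow> mat3" where
  "adj3 A = mk3
     (A$2$2 * A$3$3 - A$2$3 * A$3$2) (A$1$3 * A$3$2 - A$1$2 * A$3$3) (A$1$2 * A$2$3 - A$1$3 * A$2$2)
     (A$2$3 * A$3$1 - A$2$1 * A$3$3) (A$1$1 * A$3$3 - A$1$3 * A$3$1) (A$1$3 * A$2$1 - A$1$1 * A$2$3)
     (A$2$1 * A$3$2 - A$2$2 * A$3$1) (A$1$2 * A$3$1 - A$1$1 * A$3$2) (A$1$1 * A$2$2 - A$1$2 * A$2$1)"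

lemma adj3_mult:
  assumes "det A = 1" shows "adj3 A ** A = mat 1" "A ** adj3 A = mat 1"
  using assms by (cases A rule: mk3_cases; simp add: adj3_def mat1_mk3 algebra_simps)+

lemma det_adj3: "det A = 1 \<Longrightarrow> det (adj3 A) = 1"
  using adj3_mult(1)[of A] det_mul[of "adj3 A" A] by (simp add: det_I)

lemma adj3_unique: "det A = 1 \<Longrightarrow> A ** B = mat 1 \<Longrightarrow> B = adj3 A"
  by (metis adj3_mult(1) matrix_mul_assoc matrix_mul_lid matrix_mul_rid)

text \<open>The intertwining form has a single unknown matrix and no inverse, so a similarity can be
  verified by comparing the entries of two products.\<close>

lemma similar_iff: "similar_SL3 A B \<longleftrightarrow> (\<exists>Q. det Q = 1 \<and> A ** Q = Q ** B)"
proof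
  assume "similar_SL3 A B"
  then obtain P Q where P: "det P = 1" "P ** Q = mat 1" "Q ** P = mat 1" "B = P ** A ** Q"
    unfolding similar_SL3_def by blast
  have "det Q = 1" using det_mul[of P Q] P by (simp add: det_I)
  moreover have "Q ** B = A ** Q" using P by (metis matrix_mul_assoc matrix_mul_lid)
  ultimately show "\<exists>Q. det Q = 1 \<and> A ** Q = Q ** B" by metis
next
  assume "\<exists>Q. det Q = 1 \<and> A ** Q = Q ** B"
  then obtain Q where Q: "det Q = 1" "A ** Q = Q ** B" by blast
  have "B = adj3 Q ** A ** Q"
    by (metis Q adj3_mult(1) matrix_mul_assoc matrix_mul_lid)
  then show "similar_SL3 A B" unfolding similar_SL3_def
    using Q adj3_mult[OF Q(1)] det_adj3[OF Q(1)] by metis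
qed

lemma similarI: "det Q = 1 \<Longrightarrow> A ** Q = Q ** B \<Longrightarrow> similar_SL3 A B"
  using similar_iff by blast

lemma similar_refl: "similar_SL3 A A"
  by (rule similarI[of "mat 1"]) (simp_all add: det_I)

lemma similar_sym: "similar_SL3 A B \<Longrightarrow> similar_SL3 B A"
  unfolding similar_iff by (metis adj3_mult det_adj3 matrix_mul_assoc matrix_mul_lid matrix_mul_rid)

lemma similar_trans:
  assumes "similar_SL3 A B" "similar_SL3 B C" shows "similar_SL3 A C"
proof -
  obtain Q R where Q: "det Q = 1" "A ** Q = Q ** B" and R: "det R = 1" "B ** R = R ** C"
    using assms unfolding similar_iff by blast
  have "A ** (Q ** R) = (Q ** R) ** C"
    by (metis Q(2) R(2) matrix_mul_assoc)
  then show ?thesis by (intro similarI[of "Q ** R"]) (simp_all add: det_mul Q R)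
qed

lemma similar_transpose: "similar_SL3 A B \<Longrightarrow> similar_SL3 (transpose A) (transpose B)"
proof -
  assume "similar_SL3 A B"
  then obtain Q where Q: "det Q = 1" "A ** Q = Q ** B" using similar_iff by blast
  have "similar_SL3 (transpose B) (transpose A)"
    by (rule similarI[of "transpose Q"]) (simp_all add: Q det_transpose flip: matrix_transpose_mul)
  then show ?thesis by (rule similar_sym)
qed

lemma mat3_add_rdistrib: "(A + B) ** C = A ** C + B ** (C :: mat3)"
  by (simp add: matrix_matrix_mult_def vec_eq_iff sum.distrib distrib_right)

lemma similar_CS:
  assumes "similar_SL3 A B"
  shows "CS_matrix A \<Longrightarrow> CS_matrix B" "trace B = trace A"
proof -
  obtain P Q where P: "det P = 1" "P ** Q = mat 1" "Q ** P = mat 1" "B = P ** A ** Q"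
    using assms unfolding similar_SL3_def by blast
  have "det Q = 1" using det_mul[of P Q] P by (simp add: det_I)
  have "P ** ((A - mat 1) + mat 1) ** Q = P ** (A - mat 1) ** Q + mat 1"
    by (simp only: P matrix_add_ldistrib mat3_add_rdistrib matrix_mul_rid)
  then have B1: "B - mat 1 = P ** (A - mat 1) ** Q" unfolding P(4) diff_add_cancel by (simp only: add_diff_cancel_right')
  then show "CS_matrix A \<Longrightarrow> CS_matrix B"
    unfolding CS_matrix_def B1 unfolding P(4) by (simp only: det_mul P(1) \<open>det Q = 1\<close> mult_1 mult_1_right)
  show "trace B = trace A"
    using P by (metis matrix_mul_assoc matrix_mul_rid trace_mul_sym)
qed

lemma CS_transpose: "CS_matrix A \<Longrightarrow> CS_matrix (transpose A)"
  by (cases A rule: mk3_cases) (auto simp: CS_matrix_def mat1_mk3 algebra_simps)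

lemma trace_transpose3: "trace (transpose A) = trace (A :: mat3)"
  by (simp add: trace_def transpose_def)

text \<open>For determinant 1, \<open>det (A - mat 1)\<close> is the trace minus the sum of the
  principal 2-by-2 minors. The CS condition thus says that the characteristic polynomial is
  \<open>fpoly n\<close>.\<close>

lemma CS_mk3:
  "CS_matrix (mk3 a b c d e f g h i) \<longleftrightarrow>
   a*e*i + b*f*g + c*d*h - a*f*h - b*d*i - c*e*g = 1 \<and>
   a*e - b*d + a*i - c*g + e*i - f*h = a + e + i - 1"
  by (auto simp: CS_matrix_def mat1_mk3 algebra_simps)

lemma Xmat_mk3: "Xmat c d n = mk3 0 (- (fpoly n c div d)) ((c - 1) * (n - c - 1)) 0 c d 1 0 (n - c)"
  by (simp add: Xmat_def mk3_def)

lemma fpoly_ad: assumes "(c, d, n) \<in> CS_triples" shows "(- (fpoly n c div d)) * d = - fpoly n c" "d \<noteq> 0"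
  using assms by (auto simp: CS_triples_def)

lemma fpoly_eq: "fpoly n c = c * (c - 1) * (c - n + 1) - 1"
  by (simp add: fpoly_def algebra_simps power3_eq_cube power2_eq_square)

text \<open>The factor \<open>c * (c - 1)\<close> is even. This makes every d in a triple odd, and
  it is the source of all nonvanishing of indices and norms.\<close>

lemma fpoly_odd: "odd (fpoly n c)"
  by (simp add: fpoly_eq)

lemma CS_Xmat:
  assumes "(c, d, n) \<in> CS_triples" shows "CS_matrix (Xmat c d n)" "trace (Xmat c d n) = n"
proof -
  have "(- (fpoly n c div d)) * d = - fpoly n c" by (rule fpoly_ad[OF assms])
  then show "CS_matrix (Xmat c d n)" unfolding Xmat_mk3 CS_mk3 fpoly_eq
    by (simp add: algebra_simps)
qed (simp add: Xmat_mk3)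

text \<open>A unipotent change of basis clears \<open>r1\<close>; the CS condition then leaves no
  freedom in the first row, which becomes that of \<open>Xmat\<close>.\<close>

lemma std_form:
  assumes CS: "CS_matrix M" and tr: "trace M = n" and M: "M = mk3 0 p1 p2 0 q1 q2 1 r1 r2"
  shows "(q1, q2, n) \<in> CS_triples" "similar_SL3 M (Xmat q1 q2 n)"
proof -
  have n: "n = q1 + r2" using tr by (simp add: M)
  have E: "p1*q2 - p2*q1 = 1" "-p2 + q1*r2 - q2*r1 = q1 + r2 - 1"
    using CS unfolding M CS_mk3 by (simp_all add: algebra_simps)
  define a where "a = p1 + q1 * r1"
  define b where "b = p2 + q2 * r1"
  have b: "b = (q1 - 1) * (n - q1 - 1)" using E(2) n by (simp add: b_def algebra_simps)
  have ad: "a * q2 - b * q1 = 1" using E(1) by (simp add: a_def b_def algebra_simps)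
  have f: "fpoly n q1 = q2 * (- a)" using ad unfolding b fpoly_eq by (simp add: algebra_simps)
  have "q2 \<noteq> 0" using f fpoly_odd[of n q1] by auto
  then show tri: "(q1, q2, n) \<in> CS_triples" using f by (simp add: CS_triples_def)
  have a: "- (fpoly n q1 div q2) = a" 
    by (simp only: f nonzero_mult_div_cancel_left[OF \<open>q2 \<noteq> 0\<close>] minus_minus)
  have X: "Xmat q1 q2 n = mk3 0 a b 0 q1 q2 1 0 r2" unfolding Xmat_mk3 a b using n by simp
  show "similar_SL3 M (Xmat q1 q2 n)"
    by (rule similarI[of "mk3 1 (-r1) 0 0 1 0 0 0 1"]) (simp_all add: X M a_def b_def algebra_simps)
qed

text \<open>The hypothesis \<open>col\<close> says that the third basis vector is the image of the
  first. The intertwining relation and the zero in the second row are kept among the conclusions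
  because comparing second rows later identifies the root modulo d.\<close>

lemma std_of_basis:
  assumes CS: "CS_matrix A" and tr: "trace A = n" and Q: "det Q = 1"
    and col: "\<And>i. (A ** Q) $ i $ 1 = Q $ i $ 3"
  defines "M \<equiv> adj3 Q ** A ** Q"
  shows "(M$2$2, M$2$3, n) \<in> CS_triples" "similar_SL3 A (Xmat (M$2$2) (M$2$3) n)"
    "adj3 Q ** A = M ** adj3 Q" "M$2$1 = 0"
proof -
  have sim: "similar_SL3 A M" 
    by (rule similarI[OF Q]) (simp add: M_def matrix_mul_assoc adj3_mult Q)
  have "(adj3 Q ** (A ** Q)) $ i $ 1 = (adj3 Q ** Q) $ i $ 3" for i
    by (simp add: matrix_matrix_mult_def[of "adj3 Q"] col)
  then have M1: "M $ i $ 1 = (mat 1 :: mat3) $ i $ 3" for i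
    by (simp add: M_def adj3_mult Q matrix_mul_assoc)
  have M: "M = mk3 0 (M$1$2) (M$1$3) 0 (M$2$2) (M$2$3) 1 (M$3$2) (M$3$3)"
    by (simp add: vec_eq_iff forall_3 M1 mat1_mk3)
  have CSM: "CS_matrix M" "trace M = n" using similar_CS[OF sim] CS tr by auto
  show "(M$2$2, M$2$3, n) \<in> CS_triples" by (rule std_form(1)[OF CSM M])
  show "similar_SL3 A (Xmat (M$2$2) (M$2$3) n)"
    by (rule similar_trans[OF sim std_form(2)[OF CSM M]])
  show "adj3 Q ** A = M ** adj3 Q"
    by (metis M_def Q adj3_mult(2) matrix_mul_assoc matrix_mul_rid)
  show "M$2$1 = 0" using M1[of 2] by (simp add: mat1_mk3)
qed

text \<open>\<open>gval n k x\<close> is the norm of \<open>k - x \<theta>\<close>, that is \<open>x\<^sup>3 f\<^sub>n(k/x)\<close>.\<close>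

definition gval :: "int \<Rightarrow> int \<Rightarrow> int \<Rightarrow> int" where
  "gval n k x = k * (k * (k - n * x) + (n - 1) * (x * x)) - x * (x * x)"

section \<open>The norm form and primitive covectors\<close>

lemma bezout3:
  fixes a b c :: int
  assumes "\<And>p. prime p \<Longrightarrow> p dvd a \<Longrightarrow> p dvd b \<Longrightarrow> p dvd c \<Longrightarrow> False"
  obtains x y z where "a * x + b * y + c * z = 1"
proof -
  have "is_unit (gcd a (gcd b c))"
  proof (rule ccontr)
    assume nu: "\<not> is_unit (gcd a (gcd b c))"
    have "\<exists>p. prime p \<and> p dvd gcd a (gcd b c)"
    proof (cases "gcd a (gcd b c) = 0")
      case True
      then show ?thesis by (intro exI[of _ 2]) simp
    next
      case False
      then show ?thesis using nu prime_divisor_exists by blast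
    qed
    then show False using assms by auto
  qed
  then have 1: "gcd a (gcd b c) = 1" by auto
  obtain u v where uv: "u * a + v * gcd b c = gcd a (gcd b c)" using bezout_int by blast
  obtain y z where yz: "y * b + z * c = gcd b c" using bezout_int by blast
  have "a * u + b * (v * y) + c * (v * z) = u * a + v * (y * b + z * c)" by (simp add: algebra_simps)
  also have "\<dots> = 1" unfolding yz uv 1 ..
  finally have "a * u + b * (v * y) + c * (v * z) = 1" .
  then show ?thesis by (rule that)
qed

lemma gval_1: "gval n c 1 = fpoly n c"
  by (simp add: gval_def fpoly_eq algebra_simps)

text \<open>Modulo x the norm is k^3.\<close>

lemma coprime_gval:
  assumes "coprime k x" "e dvd gval n k x" shows "coprime e x"
proof (rule coprimeI)
  fix p assume "p dvd e" "p dvd x"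
  have "p dvd gval n k x" using \<open>p dvd e\<close> assms(2) by (rule dvd_trans)
  moreover have "gval n k x = k ^ 3 + x * (- n * k * k + (n - 1) * k * x - x * x)"
    by (simp add: gval_def algebra_simps power3_eq_cube)
  ultimately have "p dvd k ^ 3" using \<open>p dvd x\<close> by (metis dvd_add_left_iff dvd_mult2)
  moreover have "coprime (k ^ 3) x" using assms(1) by simp
  ultimately show "is_unit p" using \<open>p dvd x\<close> coprime_common_divisor by blast
qed

text \<open>The norm form is the homogenised characteristic polynomial det (k - x M). Written in the
  entries of a Hessenberg matrix, it turns the index computations below into polynomial
  identities.\<close>

lemma hess_gval:
  assumes "CS_matrix M" "trace M = n" "M = mk3 l al mu g be nu 0 s ta"
  shows "gval n k x = k*k*k - (l + be + ta) * (k*k*x) + (l * be - al * g + l * ta + be * ta - nu * s) * (k*x*x)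
      - (l * be * ta + mu * g * s - l * nu * s - al * g * ta) * (x*x*x)"
proof -
  have n: "n = l + be + ta" using assms(2) by (simp add: assms(3))
  have D: "l * be * ta + mu * g * s - l * nu * s - al * g * ta = 1"
    and E2: "n - 1 = l * be - al * g + l * ta + be * ta - nu * s"
    using assms(1) unfolding assms(3) CS_mk3 n by (simp_all add: algebra_simps)
  have "gval n k x = k*k*k - n*(k*k*x) + (n - 1)*(k*x*x) - 1 * (x*x*x)"
    by (simp add: gval_def algebra_simps)
  then show ?thesis unfolding D E2 by (simp only: n)
qed

text \<open>
  The standard basis is built from the covector \<open>X e\<^sub>2\<^sup>* + Y e\<^sub>3\<^sup>*\<close>, which is primitive together with
  its image exactly when the two coprimality conditions hold; its index is \<open>\<plusminus> g e\<close>.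
\<close>

lemma hessenberg_transpose_std:
  assumes CS: "CS_matrix M" and tr: "trace M = n" and M: "M = mk3 l al mu g be nu 0 s ta"
    and g: "g \<noteq> 0" and s: "s \<noteq> 0" and k: "k = ta * X - s * Y"
    and e: "s * e = gval n k X" and cop: "coprime k X" "coprime e g"
  obtains c d where "(c, d, n) \<in> CS_triples" "similar_SL3 (transpose M) (Xmat c d n)"
    "d = - (g * e)" "e dvd X * c - k"
proof -
  define t2 where "t2 = be * X + s * Y"
  define t3 where "t3 = nu * X + ta * Y"
  define r where "r = Y * t2 - X * t3"
  define A2 where "A2 = al * (g * X) + be * t2 + s * t3"
  define A3 where "A3 = mu * (g * X) + nu * t2 + ta * t3"
  \<comment> \<open>The numbers \<open>r\<close>, \<open>- (Y * (g * X))\<close>,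
    \<open>X * (g * X)\<close> form the cross product of the image with the covector, which is the
    second row of the inverse basis matrix; \<open>F\<close> pairs it with the second image.\<close>
  define F where "F = r * (l * (g * X) + g * t2) - Y * (g * X) * A2 + X * (g * X) * A3"
  have "g * gval n k X = - (s * F)"
    unfolding hess_gval[OF CS tr M] k F_def r_def A2_def A3_def t2_def t3_def by (simp add: algebra_simps)
  then have "g * (s * e) = - (s * F)" unfolding e .
  then have "s * F = s * (- (g * e))" by (simp add: algebra_simps)
  then have F: "F = - (g * e)" using s by (simp only: mult_cancel_left) simp
  \<comment> \<open>After the factor g has been split off from \<open>F\<close>, the number
    \<open>- e\<close> is a multiple of \<open>r\<close> modulo g: a prime dividing both
    \<open>r\<close> and g must divide e.\<close>
  have "g * (- e) = F" by (simp add: F)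
  also have "F = g * (r * (l * X + t2) + X * (X * A3 - Y * A2))"
    unfolding F_def by (simp add: algebra_simps)
  finally have "- e = r * (l * X + t2) + X * (X * A3 - Y * A2)"
    using g unfolding mult_cancel_left by blast
  also have "X * A3 - Y * A2 = - (be + ta) * r + g * (X * (mu * X) - Y * (al * X))"
    unfolding A2_def A3_def r_def t2_def t3_def by (simp add: algebra_simps)
  finally have er: "- e = r * (l * X + t2 - (be + ta) * X) + g * (X * (X * (mu * X) - Y * (al * X)))"
    by (simp add: algebra_simps)
  obtain w1 w2 w3 where w: "r * w1 + (- (Y * (g * X))) * w2 + (X * (g * X)) * w3 = 1"
  proof (rule bezout3[of r "- (Y * (g * X))" "X * (g * X)"])
    fix p :: int assume p: "prime p" and d: "p dvd r" "p dvd - (Y * (g * X))" "p dvd X * (g * X)"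
    show False
    proof (cases "p dvd X")
      case True
      \<comment> \<open>Modulo X only \<open>s * Y * Y\<close> is left of \<open>r\<close>, while k
        is congruent to \<open>- s * Y\<close>; so p would divide both k and X.\<close>
      have "r = s * Y * Y + X * (Y * be - t3)" by (simp add: r_def t2_def algebra_simps)
      then have "p dvd s * Y * Y" using d(1) True by (metis dvd_add_left_iff dvd_mult2)
      then have "p dvd s * Y" using p by (auto simp: prime_dvd_mult_iff)
      then have "p dvd k" using True by (simp add: k)
      then show False using True cop(1) p by (meson coprime_common_divisor not_prime_unit)
    next
      case False
      then have "p dvd g" using d(3) p by (auto simp: prime_dvd_mult_iff)
      moreover have "p dvd - e" unfolding er using d(1) \<open>p dvd g\<close> by simp
      ultimately show False using cop(2) p by (metis coprime_common_divisor dvd_minus_iff not_prime_unit)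
    qed
  qed
  define Q where "Q = mk3 0 w1 (g * X) X w2 t2 Y w3 t3"
  have Q: "det Q = 1" using w by (simp add: Q_def r_def algebra_simps)
  have A: "transpose M = mk3 l g 0 al be s mu nu ta" by (simp add: M)
  have col: "(transpose M ** Q) $ i $ 1 = Q $ i $ 3" for i
    using exhaust_3[of i] by (auto simp: A Q_def t2_def t3_def algebra_simps)
  define N where "N = adj3 Q ** transpose M ** Q"
  note std = std_of_basis[OF CS_transpose[OF CS] _ Q col, folded N_def]
  have tr': "trace (transpose M) = n" by (simp add: tr trace_transpose3)
  have adjQ: "adj3 Q $ 2 $ 1 = r" "adj3 Q $ 2 $ 2 = - (Y * (g * X))" "adj3 Q $ 2 $ 3 = X * (g * X)"
    by (simp_all add: adj3_def Q_def r_def algebra_simps)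
  have N23: "N $ 2 $ 3 = - (g * e)"
    unfolding N_def A F[symmetric]
    apply (subst mk3_eta[of "adj3 Q"], simp only: adjQ)
    by (simp add: Q_def F_def A2_def A3_def algebra_simps)
  \<comment> \<open>This entry of the intertwining relation contains the new root
    \<open>N $ 2 $ 2\<close>. Cancelling g and then, as e is prime to X, one factor X leaves the
    congruence modulo e.\<close>
  have "(adj3 Q ** transpose M) $ 2 $ 3 = (N ** adj3 Q) $ 2 $ 3" using std(3)[OF tr'] by simp
  then have "X * (g * X) * ta - Y * (g * X) * s = N $ 2 $ 2 * (X * (g * X)) + N $ 2 $ 3 * adj3 Q $ 3 $ 3"
    using std(4)[OF tr'] by (simp add: matrix_matrix_mult_def sum_3 adjQ A)
  then have "g * (X * k) = g * (N $ 2 $ 2 * X * X - (e * adj3 Q $ 3 $ 3))"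
    by (simp add: N23 k algebra_simps)
  then have "X * k = N $ 2 $ 2 * X * X - e * adj3 Q $ 3 $ 3" using g by simp
  then have "X * (X * N $ 2 $ 2 - k) = e * (adj3 Q $ 3 $ 3)" by (simp add: algebra_simps)
  then have "e dvd X * (X * N $ 2 $ 2 - k)" by simp
  moreover have "coprime e X" by (rule coprime_gval[OF cop(1), where n = n]) (metis e dvd_triv_right)
  ultimately have "e dvd X * N $ 2 $ 2 - k" by (simp add: coprime_dvd_mult_right_iff)
  then show ?thesis using that std(1,2)[OF tr'] N23 by metis
qed

section \<open>Elementary changes of a standard triple\<close>

lemma Xmat_shift:
  assumes "(c, d, n) \<in> CS_triples" "d dvd c' - c"
  shows "(c', d, n) \<in> CS_triples" "similar_SL3 (Xmat c d n) (Xmat c' d n)"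
proof -
  obtain q where q: "c' = c + d * q" using assms(2) by (metis dvdE add.commute diff_add_cancel)
  define a where "a = - (fpoly n c div d)"
  have ad: "a * d = - fpoly n c" "d \<noteq> 0" using fpoly_ad[OF assms(1)] by (simp_all add: a_def)
  \<comment> \<open>The bracket is the divided difference of \<open>fpoly n\<close> between c and c
    + d q.\<close>
  define a' where "a' = a - q * (3*c*c + 3*c*d*q + d*d*q*q - n*(2*c + d*q) + (n - 1))"
  have a'd: "fpoly n c' = d * (- a')" 
  proof -
    have "fpoly n c' = fpoly n c + d * (q * (3*c*c + 3*c*d*q + d*d*q*q - n*(2*c + d*q) + (n - 1)))"
      unfolding q fpoly_eq by (simp add: algebra_simps)
    then show ?thesis using ad by (simp add: a'_def algebra_simps)
  qed
  then show "(c', d, n) \<in> CS_triples" using ad by (simp add: CS_triples_def)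
  have X': "Xmat c' d n = mk3 0 a' ((c' - 1) * (n - c' - 1)) 0 c' d 1 0 (n - c')"
    unfolding Xmat_mk3 by (simp only: a'd nonzero_mult_div_cancel_left[OF ad(2)] minus_minus)
  have X: "Xmat c d n = mk3 0 a ((c - 1) * (n - c - 1)) 0 c d 1 0 (n - c)"
    unfolding Xmat_mk3 a_def ..
  show "similar_SL3 (Xmat c d n) (Xmat c' d n)"
    \<comment> \<open>The second basis vector receives q times the third; the multiple of the first
      is chosen so that the (3,2) entry stays zero.\<close>
    by (rule similarI[of "mk3 1 (q * (c' - n + c)) 0 0 1 0 0 q 1"])
      (simp, simp only: X X' mk3_mult mk3_inject, simp add: a'_def q algebra_simps)
qed

lemma Xmat_uminus:
  assumes "(c, d, n) \<in> CS_triples"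
  shows "(c, - d, n) \<in> CS_triples" "similar_SL3 (Xmat c d n) (Xmat c (- d) n)"
proof -
  show "(c, - d, n) \<in> CS_triples" using assms by (simp add: CS_triples_def)
  obtain k where k: "fpoly n c = d * k" and d: "d \<noteq> 0" using assms by (auto simp: CS_triples_def)
  have "fpoly n c div d = k" using k d by simp
  moreover have "fpoly n c = (- d) * (- k)" using k by simp
  then have "fpoly n c div (- d) = - k" using d by (metis neg_equal_0_iff_equal nonzero_mult_div_cancel_left)
  ultimately have "fpoly n c div (- d) = - (fpoly n c div d)" by simp
  then show "similar_SL3 (Xmat c d n) (Xmat c (- d) n)"
    by (intro similarI[of "mk3 (-1) 0 0 0 1 0 0 0 (-1)"]) (simp_all add: Xmat_mk3)
qed

text \<open>Exchanging the last two basis vectors, one with a sign, yields g = 1, so that the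
  coprimality of e and g in the covector construction is automatic for turns.\<close>

lemma Xmat_hessenberg:
  assumes "(c, d, n) \<in> CS_triples"
  obtains l al mu be nu where "similar_SL3 (Xmat c d n) (mk3 l al mu 1 be nu 0 (- d) c)"
proof 
  show "similar_SL3 (Xmat c d n) (mk3 0 ((c - 1) * (n - c - 1)) (fpoly n c div d) 1 (n - c) 0 0 (- d) c)"
    by (rule similarI[of "mk3 1 0 0 0 0 (-1) 0 1 0"]) (simp_all add: Xmat_mk3)
qed

section \<open>Vectors of small index\<close>

text \<open>Hermite's bound for a positive definite binary form. A translation makes the middle
  coefficient at most P in absolute value. If then P \<le> S', the discriminant gives 3 P^2 \<le>
  \<Delta>; otherwise the outer coefficients are exchanged and the leading one has dropped.\<close>

lemma hermite_min:
  fixes P R S :: int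
  assumes "P > 0" "4 * P * S - R * R = \<Delta>" "\<Delta> > 0"
  shows "\<exists>X Y. coprime X Y \<and> 3 * (P*X*X + R*X*Y + S*Y*Y)^2 \<le> \<Delta>"
  using assms
proof (induction "nat P" arbitrary: P R S rule: less_induct)
  case less
  \<comment> \<open>A nearest integer to - R / (2 P).\<close>
  define t where "t = - ((R + P) div (2 * P))"
  define R' where "R' = R + 2 * P * t"
  define S' where "S' = P * t * t + R * t + S"
  have R': "\<bar>R'\<bar> \<le> P"
  proof -
    have "R + P = 2 * P * ((R + P) div (2 * P)) + (R + P) mod (2 * P)" by simp
    moreover have "R' = R - 2 * P * ((R + P) div (2 * P))" by (simp add: R'_def t_def)
    ultimately have "R' = (R + P) mod (2 * P) - P" by linarith
    moreover have "0 \<le> (R + P) mod (2 * P)" "(R + P) mod (2 * P) < 2 * P" using less.prems(1) by simp_all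
    ultimately show ?thesis by linarith
  qed
  have disc: "4 * P * S' - R' * R' = \<Delta>"
    using less.prems(2) by (simp add: R'_def S'_def algebra_simps)
  have R2: "R' * R' \<le> P * P" using R' by (metis abs_le_square_iff abs_of_pos less.prems(1) power2_eq_square)
  show ?case
  proof (cases "P \<le> S'")
    case True
    then have "P * P \<le> P * S'" using less.prems(1) by simp
    then have "3 * (P * P) \<le> 4 * P * S' - R' * R'" using R2 by simp
    then have "3 * (P*1*1 + R*1*0 + S*0*0)^2 \<le> \<Delta>"
      unfolding disc by (simp add: power2_eq_square)
    then show ?thesis by (intro exI[of _ 1] exI[of _ 0]) simp
  next
    case False
    have "4 * (P * S') = \<Delta> + R' * R'" using disc by simp
    then have "0 < P * S'" using less.prems(3) zero_le_square[of R'] by linarith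
    then have S'0: "S' > 0" using less.prems(1) by (simp add: zero_less_mult_iff)
    have disc': "4 * S' * P - R' * R' = \<Delta>" using disc by (simp add: mult.commute mult.left_commute)
    have "\<exists>X Y. coprime X Y \<and> 3 * (S'*X*X + R'*X*Y + P*Y*Y)^2 \<le> \<Delta>"
      using less.hyps[OF _ S'0 disc' less.prems(3)] False S'0 by simp
    then obtain X Y where XY: "coprime X Y" "3 * (S'*X*X + R'*X*Y + P*Y*Y)^2 \<le> \<Delta>" by blast
    have "P*(Y + t*X)*(Y + t*X) + R*(Y + t*X)*X + S*X*X = S'*X*X + R'*X*Y + P*Y*Y"
      by (simp add: R'_def S'_def algebra_simps)
    moreover have "coprime (Y + t * X) X" using XY(1)
      by (metis coprime_commute coprime_iff_gcd_eq_1 gcd_add_mult mult.commute add.commute)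
    ultimately show ?thesis using XY(2) by metis
  qed
qed

text \<open>
  In Hessenberg form the first basis vector \<open>e\<^sub>1\<close> has index \<open>hw M = det (e\<^sub>1, M e\<^sub>1, M\<^sup>2 e\<^sub>1)\<close>.
\<close>

definition hess :: "mat3 \<Rightarrow> bool" where "hess M \<longleftrightarrow> M $ 3 $ 1 = 0"

definition hw :: "mat3 \<Rightarrow> int" where "hw M = M$2$1 * M$2$1 * M$3$2"

text \<open>The Euclidean algorithm on the two lower entries of the first column changes only the
  second and third basis vectors. The first is kept, and with it its index.\<close>

lemma hess_of_column:
  obtains M where "similar_SL3 A M" "hess M"
    "hw M = A$2$1 * (A ** A)$3$1 - A$3$1 * (A ** A)$2$1"
proof -
  obtain l a12 a13 b a22 a23 c a32 a33 where A: "A = mk3 l a12 a13 b a22 a23 c a32 a33"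
    by (rule mk3_cases)
  obtain g b' c' p q where g: "b = g * b'" "c = g * c'" and pq: "p * b' + q * c' = 1"
  proof (cases "gcd b c = 0")
    case True
    \<comment> \<open>Both entries vanish: content 0 and the primitive direction (1, 0).\<close>
    then show ?thesis using that[of 0 1 0 1 0] by simp
  next
    case False
    obtain p q where "p * b + q * c = gcd b c" using bezout_int by blast
    moreover obtain b' c' where bc: "b = gcd b c * b'" "c = gcd b c * c'" by (meson dvdE gcd_dvd1 gcd_dvd2)
    ultimately have "gcd b c * (p * b' + q * c') = gcd b c * 1"
      by (metis distrib_left mult.left_commute mult.right_neutral)
    then have "p * b' + q * c' = 1" using False by auto
    then show ?thesis using that bc by blast
  qed
  define Q where "Q = mk3 1 0 0 0 b' (-q) 0 c' p"
  define M where "M = adj3 Q ** A ** Q"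
  have Q: "det Q = 1" using pq by (simp add: Q_def algebra_simps)
  have "similar_SL3 A M" by (rule similarI[OF Q]) (simp add: M_def matrix_mul_assoc adj3_mult Q)
  have adj: "adj3 Q = mk3 1 0 0 0 p q 0 (-c') b'" using pq by (simp add: adj3_def Q_def algebra_simps)
  have "hess M" unfolding hess_def M_def adj by (simp add: A Q_def g)
  have M21: "M $ 2 $ 1 = g" 
  proof -
    have "M $ 2 $ 1 = g * (p * b' + q * c')" unfolding M_def adj by (simp add: A Q_def g algebra_simps)
    then show ?thesis by (simp add: pq)
  qed
  have "hw M = A$2$1 * (A ** A)$3$1 - A$3$1 * (A ** A)$2$1"
    unfolding hw_def M21 unfolding M_def adj by (simp add: A Q_def g algebra_simps)
  then show ?thesis using that \<open>hess M\<close> \<open>similar_SL3 A M\<close> by blast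
qed

text \<open>At the diagonal entries \<open>l\<close> and \<open>ta\<close> the characteristic
  polynomial loses all terms without a factor g, respectively s, and values of \<open>fpoly\<close>
  are odd.\<close>

lemma hess_nonzero:
  assumes "CS_matrix M" "trace M = n" "M = mk3 l al mu g be nu 0 s ta"
  shows "odd g" "odd s" "s dvd fpoly n ta"
proof -
  have f: "fpoly n x = x*x*x - (l + be + ta) * (x*x) + (l * be - al * g + l * ta + be * ta - nu * s) * x
     - (l * be * ta + mu * g * s - l * nu * s - al * g * ta)" for x
    using hess_gval[OF assms, of x 1] by (simp add: gval_1)
  have "fpoly n l = g * (- (al * (l - ta) + mu * s))" unfolding f by (simp add: algebra_simps)
  then show "odd g" using fpoly_odd[of n l] by auto
  have "fpoly n ta = s * (- (ta - l) * nu - mu * g)" unfolding f by (simp add: algebra_simps)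
  then show "odd s" "s dvd fpoly n ta" using fpoly_odd[of n ta] by auto
qed

text \<open>On the covectors (0, X, Y), which vanish on the first basis vector, the index is g/s
  times the norm form taken at k = ta X - s Y and x = X. Primitivity of covector and image is not
  asked for, hence the Hessenberg form in the result.\<close>

lemma hess_step:
  assumes CS: "CS_matrix M" and tr: "trace M = n" and M: "M = mk3 l al mu g be nu 0 s ta"
    and cop: "coprime X Y"
  obtains M' where "similar_SL3 (transpose M) M'" "hess M'" "s * hw M' = g * gval n (ta * X - s * Y) X"
proof -
  define t2 where "t2 = be * X + s * Y"
  define t3 where "t3 = nu * X + ta * Y"
  define A1 where "A1 = l * (g * X) + g * t2"
  define A2 where "A2 = al * (g * X) + be * t2 + s * t3"
  define A3 where "A3 = mu * (g * X) + nu * t2 + ta * t3"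
  obtain p q where "p * X + q * Y = gcd X Y" using bezout_int by blast
  then have pq: "p * X + q * Y = 1" using cop by simp
  define Q where "Q = mk3 0 0 1 X (-q) 0 Y p 0"
  have Q: "det Q = 1" using pq by (simp add: Q_def algebra_simps)
  define N where "N = adj3 Q ** transpose M ** Q"
  have sim: "similar_SL3 (transpose M) N" by (rule similarI[OF Q]) (simp add: N_def matrix_mul_assoc adj3_mult Q)
  have adj: "adj3 Q = mk3 0 p q 0 (-Y) X 1 0 0" using pq by (simp add: adj3_def Q_def algebra_simps)
  have A: "transpose M = mk3 l g 0 al be s mu nu ta" by (simp add: M)
  have N2: "N ** N = adj3 Q ** (transpose M ** transpose M ** Q)"
    by (metis (no_types) N_def Q adj3_mult(2) matrix_mul_assoc matrix_mul_lid)
  have "N$2$1 = X * t3 - Y * t2" "N$3$1 = g * X"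
    unfolding N_def adj A by (simp_all add: Q_def t2_def t3_def algebra_simps)
  moreover have "(N ** N)$2$1 = X * A3 - Y * A2" "(N ** N)$3$1 = A1"
    unfolding N2 adj A by (simp_all add: Q_def A1_def A2_def A3_def t2_def t3_def algebra_simps)
  ultimately obtain M' where M': "similar_SL3 N M'" "hess M'"
    "hw M' = (X * t3 - Y * t2) * A1 - g * X * (X * A3 - Y * A2)"
    using hess_of_column[of N] by metis
  define k where "k = ta * X - s * Y"
  have "g * gval n k X = s * hw M'"
    unfolding hess_gval[OF CS tr M] k_def M'(3) A1_def A2_def A3_def t2_def t3_def by (simp add: algebra_simps)
  then show ?thesis using that M'(1,2) similar_trans[OF sim] unfolding k_def by metis
qed

text \<open>A Hessenberg form of least index is compared with the one obtained from a short covector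
  in its dual plane. That one belongs to the transpose, so the minimum is taken over A and its
  transpose together. \<open>K\<close> and \<open>L\<close> bound the square of the cubic norm form
  by the cube of a definite quadratic form, and squaring once more avoids roots.\<close>

lemma hess_bound:
  fixes P R S K L \<Delta> :: int
  assumes CS: "CS_matrix A" and tr: "trace A = n"
    and Q: "P > 0" "4 * P * S - R * R = \<Delta>" "\<Delta> > 0"
    and K: "\<And>k x. K * (gval n k x)^2 \<le> L * (P*k*k + R*k*x + S*x*x)^3" "K \<ge> 0"
  obtains M where "similar_SL3 A M \<or> similar_SL3 (transpose A) M" "hess M"
    "27 * K^2 * (hw M)^2 \<le> L^2 * \<Delta>^3"
proof -
  define W where "W M \<longleftrightarrow> hess M \<and> (similar_SL3 A M \<or> similar_SL3 (transpose A) M)" for M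
  obtain M0 where "W M0" using hess_of_column[of A] W_def by metis
  then obtain M where WM: "W M" and min: "\<And>M'. W M' \<Longrightarrow> nat \<bar>hw M\<bar> \<le> nat \<bar>hw M'\<bar>"
    using ex_has_least_nat[of W M0 "\<lambda>M. nat \<bar>hw M\<bar>"] by blast
  obtain l al mu g be nu z s ta where M: "M = mk3 l al mu g be nu z s ta" by (rule mk3_cases)
  have z: "z = 0" using WM by (simp add: W_def hess_def M)
  have CSM: "CS_matrix M" "trace M = n"
    using WM similar_CS CS tr CS_transpose trace_transpose3 unfolding W_def by metis+
  note odd = hess_nonzero[OF CSM M[unfolded z]]
  have s0: "s \<noteq> 0" "g \<noteq> 0" using odd by auto
  have s6: "s ^ 6 > 0" using s0(1) by (simp add: zero_less_power_eq)
  \<comment> \<open>The quadratic form pulled back along k = ta X - s Y, x = X. This substitution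
    has determinant s up to sign, so \<Delta> is multiplied by s^2.\<close>
  define P' where "P' = P*ta*ta + R*ta + S"
  define R' where "R' = - (2*P*ta + R) * s"
  define S' where "S' = P * s * s"
  have "4 * P * P' = (2 * P * ta + R)^2 + \<Delta>"
    using Q(2) by (simp add: P'_def power2_eq_square algebra_simps)
  then have "4 * P * P' > 0" using Q(3) zero_le_power2[of "2 * P * ta + R"] by linarith
  then have P'0: "P' > 0" using Q(1) by (simp add: zero_less_mult_iff)
  have d': "4 * P' * S' - R' * R' = \<Delta> * (s * s)"
    unfolding Q(2)[symmetric] P'_def R'_def S'_def by (simp add: algebra_simps)
  have "\<Delta> * (s * s) > 0" using Q(3) s0 by (auto simp: zero_less_mult_iff)
  from hermite_min[OF P'0 d' this] obtain X Y where XY: "coprime X Y"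
    "3 * (P'*X*X + R'*X*Y + S'*Y*Y)^2 \<le> \<Delta> * (s * s)" by blast
  define k where "k = ta * X - s * Y"
  define q where "q = P*k*k + R*k*X + S*X*X"
  define G where "G = gval n k X"
  have "q = P'*X*X + R'*X*Y + S'*Y*Y"
    by (simp add: q_def k_def P'_def R'_def S'_def algebra_simps)
  then have q: "3 * q^2 \<le> \<Delta> * s^2" using XY(2) by (simp add: power2_eq_square)
  obtain M' where M': "similar_SL3 (transpose M) M'" "hess M'" "s * hw M' = g * G"
    using hess_step[OF CSM M[unfolded z] XY(1)] unfolding G_def k_def by metis
  have "W M'" using WM M'(1,2) unfolding W_def
    by (metis similar_trans similar_transpose transpose_transpose)
  then have "\<bar>hw M\<bar> \<le> \<bar>hw M'\<bar>" using min by fastforce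
  \<comment> \<open>With hw M = g^2 s and hw M' = g G / s, minimality amounts to |g s^2| \<le>
    |G|.\<close>
  then have "\<bar>s * hw M\<bar> \<le> \<bar>g * G\<bar>" unfolding M'(3)[symmetric] by (simp add: abs_mult mult_left_mono)
  moreover have "s * hw M = g * (g * s * s)" by (simp add: hw_def M algebra_simps)
  ultimately have "\<bar>g * s * s\<bar> \<le> \<bar>G\<bar>" using s0 by (simp add: abs_mult)
  then have gG: "(g * s * s)^2 \<le> G^2" by (simp add: abs_le_square_iff)
  have KG: "K * G^2 \<le> L * q^3" using K(1)[of k X] by (simp add: q_def G_def)
  have "K * (g * s * s)^2 \<le> L * q^3" using gG K(2) KG by (meson mult_left_mono order_trans)
  moreover have "0 \<le> K * (g * s * s)^2" using K(2) by simp
  ultimately have "(K * (g * s * s)^2)^2 \<le> (L * q^3)^2" by (rule power_mono)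
  then have "27 * (K * (g * s * s)^2)^2 \<le> 27 * (L * q^3)^2" by simp
  also have "\<dots> = L^2 * (3 * q^2)^3"
    by (simp add: power_mult_distrib flip: power_mult)
  also have "\<dots> \<le> L^2 * (\<Delta> * s^2)^3"
    using q by (intro mult_left_mono power_mono) auto
  finally have le: "27 * (K * (g * s * s)^2)^2 \<le> L^2 * (\<Delta> * s^2)^3" .
  \<comment> \<open>Both sides contain s^6, and (g s^2)^4 / s^6 is exactly the square of
    \<open>hw M\<close>.\<close>
  have e1: "27 * (K * (g * s * s)^2)^2 = (27 * K^2 * (hw M)^2) * s^6"
    by (simp add: hw_def M eval_nat_numeral algebra_simps)
  have e2: "L^2 * (\<Delta> * s^2)^3 = (L^2 * \<Delta>^3) * s^6"
    by (simp add: eval_nat_numeral algebra_simps)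
  have "(27 * K^2 * (hw M)^2) * s^6 \<le> (L^2 * \<Delta>^3) * s^6"
    using le unfolding e1 e2 .
  then have "27 * K^2 * (hw M)^2 \<le> L^2 * \<Delta>^3"
    using mult_right_le_imp_le[OF _ s6] by blast
  then show ?thesis using that WM unfolding W_def by blast
qed

section \<open>Index bounds in terms of the trace\<close>

lemma hess_bound_disc:
  assumes CS: "CS_matrix A" and tr: "trace A = n" and n: "n \<ge> 6"
  obtains M where "similar_SL3 A M \<or> similar_SL3 (transpose A) M" "hess M"
    "729 * (hw M)^2 \<le> 16 * (n * (n - 5) * (n * (n - 5) + 6) - 23)"
proof -
  define D where "D = n * (n - 5) * (n * (n - 5) + 6) - 23"
  have "n * 1 \<le> n * (n - 5)" using n by (intro mult_left_mono) auto
  then have 6: "6 \<le> n * (n - 5)" using n by linarith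
  then have "6 * 6 \<le> n * (n - 5) * (n * (n - 5) + 6)" by (intro mult_mono) auto
  then have D: "D > 0" by (simp add: D_def)
  \<comment> \<open>The three coefficients are those of the Hessian of the norm form. With \<Delta>
    = 3 D, K = 27 D and L = 4 the general bound becomes 729 h^2 \<le> 16 D.\<close>
  have P: "n^2 - 3 * (n - 1) > 0" using 6 n by (simp add: power2_eq_square algebra_simps)
  have disc: "4 * (n^2 - 3 * (n - 1)) * ((n - 1)^2 - 3 * n) - (9 - n * (n - 1)) * (9 - n * (n - 1)) = 3 * D"
    by (simp add: D_def power2_eq_square algebra_simps)
  have syz: "27 * D * (gval n k x)^2 \<le> 4 * ((n^2 - 3 * (n - 1))*k*k + (9 - n * (n - 1))*k*x + ((n - 1)^2 - 3 * n)*x*x)^3" 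
    for k x
  proof -
    define J where "J = (3*k*k - 2*n*k*x + (n-1)*x*x) * ((9 - n * (n - 1)) * k + 2 * ((n - 1)^2 - 3 * n) * x)
      - (- n*k*k + 2*(n-1)*k*x - 3*x*x) * (2 * (n^2 - 3 * (n - 1)) * k + (9 - n * (n - 1)) * x)"
    \<comment> \<open>the syzygy between a binary cubic form, its Hessian and its cubic covariant \<open>J\<close>\<close>
    have "4 * ((n^2 - 3 * (n - 1))*k*k + (9 - n * (n - 1))*k*x + ((n - 1)^2 - 3 * n)*x*x)^3
      = J^2 + 27 * D * (gval n k x)^2"
      unfolding J_def D_def gval_def by algebra
    then show ?thesis by simp
  qed
  obtain M where M: "similar_SL3 A M \<or> similar_SL3 (transpose A) M" "hess M"
    "27 * (27 * D)^2 * (hw M)^2 \<le> 4^2 * (3 * D)^3"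
    using hess_bound[OF CS tr P disc _ syz] D by auto
  have "(27 * 27 * D^2) * (729 * (hw M)^2) \<le> (27 * 27 * D^2) * (16 * D)"
    using M(3) by (simp add: power_mult_distrib eval_nat_numeral algebra_simps)
  then have "729 * (hw M)^2 \<le> 16 * D" using D by (subst (asm) mult_le_cancel_left_pos) auto
  then show ?thesis using that M unfolding D_def by blast
qed

text \<open>For these traces the discriminant is negative and the Hessian indefinite. Definite forms
  with 4 P S - R^2 = 4 replace it, the comparison with the cubic being an explicit sum of squares;
  then 27 h^2 \<le> 256.\<close>

lemma hess_bound_small:
  assumes CS: "CS_matrix A" and tr: "trace A = n" and n: "n = 3 \<or> n = 4 \<or> n = 5"
  obtains M where "similar_SL3 A M \<or> similar_SL3 (transpose A) M" "hess M" "\<bar>hw M\<bar> \<le> 3"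
proof -
  have cub1: "(u*u*u - u*x*x - x*x*x)^2 \<le> 2 * (u*u + x*x)^3" for u x :: int
  proof -
    have "2 * (u*u + x*x)^3 - (u*u*u - u*x*x - x*x*x)^2
      = (u*u*u)^2 + 7 * (u*u*x)^2 + 3 * (u*x*x)^2 + (u*u*x + u*x*x)^2 + (u*x*x - x*x*x)^2"
      by algebra
    also have "\<dots> \<ge> 0" by (intro add_nonneg_nonneg) auto
    finally show ?thesis by simp
  qed
  have cub2: "(u*u*u - u*u*x - x*x*x)^2 \<le> 2 * (u*u + x*x)^3" for u x :: int
  proof -
    have "2 * (u*u + x*x)^3 - (u*u*u - u*u*x - x*x*x)^2
      = (x*x*x)^2 + 3 * (u*u*x)^2 + 3 * (u*x*x)^2 + (u*u*u + u*u*x)^2 + (u*u*x + u*x*x)^2"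
      by algebra
    also have "\<dots> \<ge> 0" by (intro add_nonneg_nonneg) auto
    finally show ?thesis by simp
  qed
  obtain P R S :: int where Q: "P > 0" "4 * P * S - R * R = 4"
    and K: "\<And>k x. 1 * (gval n k x)^2 \<le> 2 * (P*k*k + R*k*x + S*x*x)^3"
  proof -
    \<comment> \<open>Substituting k - x for one variable turns the norm form for n = 3 and, up to
      sign, n = 5 into the cubic of \<open>cub1\<close>, and for n = 4, up to sign, into that of
      \<open>cub2\<close>.\<close>
    consider "n = 3" | "n = 4" | "n = 5" using n by blast
    then show ?thesis
    proof cases
      case 1
      have "1 * (gval n k x)^2 \<le> 2 * (1*k*k + (-2)*k*x + 2*x*x)^3" for k x
        using cub1[of "k - x" x] by (simp add: gval_def 1 algebra_simps)
      then show ?thesis using that[of 1 2 "-2"] by simp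
    next
      case 2
      have "1 * (gval n k x)^2 \<le> 2 * (2*k*k + (-2)*k*x + 1*x*x)^3" for k x
      proof -
        have "gval n k x = - (k*k*k - k*k*(k-x) - (k-x)*(k-x)*(k-x))" by (simp add: gval_def 2 algebra_simps)
        then have "(gval n k x)^2 = (k*k*k - k*k*(k-x) - (k-x)*(k-x)*(k-x))^2" by (simp only: power2_minus)
        moreover have "2*k*k + (-2)*k*x + 1*x*x = k*k + (k-x)*(k-x)" by (simp add: algebra_simps)
        ultimately show ?thesis using cub2[of k "k - x"] by (simp only: mult_1)
      qed
      then show ?thesis using that[of 2 1 "-2"] by simp
    next
      case 3
      have "1 * (gval n k x)^2 \<le> 2 * (2*k*k + (-2)*k*x + 1*x*x)^3" for k x
      proof -
        have "gval n k x = - (k*k*k - k*(k-x)*(k-x) - (k-x)*(k-x)*(k-x))" by (simp add: gval_def 3 algebra_simps)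
        then have "(gval n k x)^2 = (k*k*k - k*(k-x)*(k-x) - (k-x)*(k-x)*(k-x))^2" by (simp only: power2_minus)
        moreover have "2*k*k + (-2)*k*x + 1*x*x = k*k + (k-x)*(k-x)" by (simp add: algebra_simps)
        ultimately show ?thesis using cub1[of k "k - x"] by (simp only: mult_1)
      qed
      then show ?thesis using that[of 2 1 "-2"] by simp
    qed
  qed
  obtain M where M: "similar_SL3 A M \<or> similar_SL3 (transpose A) M" "hess M"
    "27 * 1^2 * (hw M)^2 \<le> 2^2 * 4^3"
    using hess_bound[OF CS tr Q _ K] by auto
  have "\<bar>hw M\<bar> \<le> 3"
  proof (rule ccontr)
    assume "\<not> \<bar>hw M\<bar> \<le> 3"
    then have "4^2 \<le> \<bar>hw M\<bar>^2" by (intro power_mono) auto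
    then show False using M(3) by simp
  qed
  then show ?thesis using that M by blast
qed

section \<open>Gompf equivalence and the involution of traces\<close>

lemma triple_shift: "(c, d, n) \<in> CS_triples \<Longrightarrow> d dvd m - n \<Longrightarrow> (c, d, m) \<in> CS_triples"
proof -
  assume t: "(c, d, n) \<in> CS_triples" and "d dvd m - n"
  moreover have "fpoly m c = fpoly n c - (m - n) * (c * (c - 1))"
    unfolding fpoly_eq by (simp add: algebra_simps)
  ultimately show ?thesis by (simp add: CS_triples_def)
qed

lemma gompf_equiv_refl: "gompf_equiv t t"
  by (simp add: gompf_equiv_def)

lemma gompf_equiv_sym: "gompf_equiv t u \<Longrightarrow> gompf_equiv u t"
  unfolding gompf_equiv_def
  by (rule sympD[OF symp_rtranclp]) (auto simp: symp_def)

lemma gompf_equiv_trans: "gompf_equiv t u \<Longrightarrow> gompf_equiv u v \<Longrightarrow> gompf_equiv t v"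
  unfolding gompf_equiv_def by (rule rtranclp_trans)

lemma gompf_equiv_similar:
  assumes "(c, d, n) \<in> CS_triples" "(c', d', n') \<in> CS_triples" "similar_SL3 (Xmat c d n) (Xmat c' d' n')"
  shows "gompf_equiv (c, d, n) (c', d', n')"
  unfolding gompf_equiv_def using assms by (intro r_into_rtranclp) (simp add: gompf_step_def)

lemma gompf_equiv_shift:
  assumes "(c, d, n) \<in> CS_triples" "d dvd m - n"
  shows "gompf_equiv (c, d, n) (c, d, m)"
proof -
  obtain k where "m = n + k * d" using assms(2) by (metis add.commute diff_add_cancel dvdE mult.commute)
  then show ?thesis
    unfolding gompf_equiv_def using assms triple_shift[OF assms]
    by (intro r_into_rtranclp) (auto simp: gompf_step_def)
qed

lemma good_similar: "similar_SL3 A B \<Longrightarrow> gompf_equiv_A0 A \<longleftrightarrow> gompf_equiv_A0 B"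
  unfolding gompf_equiv_A0_def by (meson similar_sym similar_trans)

lemma good_Xmat:
  assumes "(c, d, n) \<in> CS_triples"
  shows "gompf_equiv_A0 (Xmat c d n) \<longleftrightarrow> gompf_equiv (c, d, n) (1, 1, 2)"
  unfolding gompf_equiv_A0_def
  using assms gompf_equiv_similar gompf_equiv_trans similar_refl by blast

lemma good_shift:
  assumes "(c, d, n) \<in> CS_triples" "d dvd m - n" "gompf_equiv_A0 (Xmat c d m)"
  shows "gompf_equiv_A0 (Xmat c d n)"
  using assms good_Xmat gompf_equiv_shift gompf_equiv_trans triple_shift by blast

text \<open>Modulo 1 all traces and all roots agree.\<close>

lemma gompf_equiv_unit:
  assumes "(c, d, n) \<in> CS_triples" "\<bar>d\<bar> = 1"
  shows "gompf_equiv (c, d, n) (1, 1, 2)"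
proof -
  have t: "(x, 1, m) \<in> CS_triples" for x m by (simp add: CS_triples_def)
  have "gompf_equiv (c, d, n) (c, 1, n)"
  proof (cases "d = 1")
    case False
    then have "d = -1" using assms(2) by linarith
    then show ?thesis using Xmat_uminus[OF assms(1)] assms(1) by (simp add: gompf_equiv_similar)
  qed (simp add: gompf_equiv_refl)
  moreover have "gompf_equiv (c, 1, n) (c, 1, 2)" by (rule gompf_equiv_shift[OF t]) simp
  moreover have "gompf_equiv (c, 1, 2) (1, 1, 2)"
    using Xmat_shift[OF t, of 1 c 2] t by (intro gompf_equiv_similar) auto
  ultimately show ?thesis using gompf_equiv_trans by blast
qed

text \<open>This is \<open>A (A - 1)\<^sup>-\<^sup>1\<close>, written without inverses.\<close>

definition Phi :: "mat3 \<Rightarrow> mat3" where "Phi A = mat 1 + adj3 (A - mat 1)"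

text \<open>Since \<open>Phi A - mat 1\<close> is the inverse of \<open>A - mat 1\<close>, the map
  is an involution. An eigenvalue \<theta> becomes 1 + 1/(\<theta> - 1), and f_n(x + 1) = x^3 + (3 -
  n) x^2 + (2 - n) x - 1 shows that the new trace is 3 + (2 - n).\<close>

lemma CS_Phi:
  assumes "CS_matrix A"
  shows "CS_matrix (Phi A)" "trace (Phi A) = 5 - trace A" "Phi (Phi A) = A"
proof -
  have d: "det A = 1" "det (A - mat 1) = 1" using assms by (simp_all add: CS_matrix_def)
  have "Phi A = ((A - mat 1) + mat 1) ** adj3 (A - mat 1)"
    unfolding mat3_add_rdistrib by (simp add: adj3_mult(2)[OF d(2)] Phi_def)
  then have "det (Phi A) = 1" by (simp add: det_mul d det_adj3)
  moreover have "Phi A - mat 1 = adj3 (A - mat 1)" by (simp add: Phi_def)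
  ultimately show "CS_matrix (Phi A)" by (simp add: CS_matrix_def det_adj3 d)
  have "A - mat 1 = adj3 (Phi A - mat 1)"
    by (rule adj3_unique) (simp_all add: Phi_def det_adj3 adj3_mult d)
  then show "Phi (Phi A) = A" unfolding Phi_def[of "Phi A"] by (metis add.commute diff_add_cancel)
  show "trace (Phi A) = 5 - trace A"
    using assms by (cases A rule: mk3_cases) (simp add: CS_mk3 Phi_def adj3_def mat1_mk3 algebra_simps)
qed

lemma similar_Phi:
  assumes "similar_SL3 A B" "CS_matrix A"
  shows "similar_SL3 (Phi A) (Phi B)"
proof -
  obtain Q where Q: "det Q = 1" "A ** Q = Q ** B" using assms(1) similar_iff by blast
  have dA: "det (A - mat 1) = 1" and dB: "det (B - mat 1) = 1"
    using assms similar_CS(1)[OF assms(1)] by (simp_all add: CS_matrix_def)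
  have "((A - mat 1) + mat 1) ** Q = Q ** ((B - mat 1) + mat 1)" using Q by simp
  then have AQ: "(A - mat 1) ** Q = Q ** (B - mat 1)"
    unfolding matrix_add_ldistrib mat3_add_rdistrib by simp
  have "adj3 (A - mat 1) ** Q = adj3 (A - mat 1) ** (Q ** (B - mat 1)) ** adj3 (B - mat 1)"
    by (simp add: adj3_mult(2)[OF dB] flip: matrix_mul_assoc)
  also have "\<dots> = Q ** adj3 (B - mat 1)"
    by (simp add: AQ[symmetric] matrix_mul_assoc adj3_mult(1)[OF dA])
  finally have "Phi A ** Q = Q ** Phi B"
    by (simp add: Phi_def matrix_add_ldistrib mat3_add_rdistrib)
  then show ?thesis using Q similarI by blast
qed

text \<open>The modulus d survives up to a sign, and the root undergoes the same fractional map c/(c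
  - 1) as \<theta>. The point of the last conclusion is that this residue does not involve the
  trace.\<close>

lemma Phi_Xmat:
  assumes t: "(c, d, n) \<in> CS_triples"
  obtains c' where "(c', d, 5 - n) \<in> CS_triples" "similar_SL3 (Phi (Xmat c d n)) (Xmat c' d (5 - n))"
    "d dvd c' * (c - 1) - c"
proof -
  define a where "a = - (fpoly n c div d)"
  define r where "r = n - c - 1"
  have n: "n = c + 1 + r" by (simp add: r_def)
  have "a * d = - fpoly n c" using fpoly_ad(1)[OF t] unfolding a_def .
  then have ad: "a * d = 1 + c * (c - 1) * r" unfolding fpoly_eq by (simp add: n algebra_simps)
  have X: "Xmat c d n = mk3 0 a ((c - 1) * r) 0 c d 1 0 (r + 1)"
    unfolding Xmat_mk3 a_def r_def by simp
  have P: "Phi (Xmat c d n) = mk3 (1 + (c - 1) * r) (- (a * r)) (1 + (c - 1) * r)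
      d (1 - c * r) d (- (c - 1)) a (2 - c)"
    using ad unfolding Phi_def X by (simp add: adj3_def mat1_mk3 algebra_simps)
  \<comment> \<open>The third column is the image of the first; the middle one is chosen so that a d
    = 1 + c (c - 1) r gives determinant 1.\<close>
  define Q where "Q = mk3 1 0 (1 + (c - 1) * r) 0 (c * r) d 0 (-a) (- (c - 1))"
  have Q: "det Q = 1" using ad by (simp add: Q_def algebra_simps)
  note CSX = CS_Xmat[OF t]
  note CSP = CS_Phi[OF CSX(1)]
  have tr: "trace (Phi (Xmat c d n)) = 5 - n" using CSP(2) CSX(2) by simp
  have col: "(Phi (Xmat c d n) ** Q) $ i $ 1 = Q $ i $ 3" for i
    using exhaust_3[of i] by (auto simp: P Q_def)
  define N where "N = adj3 Q ** Phi (Xmat c d n) ** Q"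
  note std = std_of_basis[OF CSP(1) tr Q col, folded N_def]
  have adj: "adj3 Q $ 2 $ 1 = 0" "adj3 Q $ 2 $ 2 = - (c - 1)" "adj3 Q $ 2 $ 3 = - d"
    by (simp_all add: adj3_def Q_def)
  \<comment> \<open>The summand with \<open>ad_rest\<close> is identically zero, so the value is -
    d; its sign is removed by \<open>Xmat_uminus\<close> at the end.\<close>
  have "N $ 2 $ 3 = - d + d * (ad_rest - ad_rest)" for ad_rest :: int
  proof -
    have "N $ 2 $ 3 = - (c - 1) * (d * (1 + (c - 1) * r) + (1 - c * r) * d - d * (c - 1))
       - d * (- (c - 1) * (1 + (c - 1) * r) + a * d - (2 - c) * (c - 1))"
      unfolding N_def P
      apply (subst mk3_eta[of "adj3 Q"], simp only: adj)
      by (simp add: Q_def algebra_simps)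
    also have "\<dots> = - d" unfolding ad by (simp add: algebra_simps)
    finally show ?thesis by simp
  qed
  then have N23: "N $ 2 $ 3 = - d" by simp
  have "(adj3 Q ** Phi (Xmat c d n)) $ 2 $ 2 = (N ** adj3 Q) $ 2 $ 2" using std(3) by simp
  then have "- (c - 1) * (1 - c * r) - a * d = N $ 2 $ 2 * (- (c - 1)) + (- d) * adj3 Q $ 3 $ 2"
    using std(4) by (simp add: matrix_matrix_mult_def sum_3 adj P N23 algebra_simps)
  then have "N $ 2 $ 2 * (c - 1) - c = d * (- adj3 Q $ 3 $ 2)"
    unfolding ad by (simp add: algebra_simps)
  then have dv: "d dvd N $ 2 $ 2 * (c - 1) - c" by (metis dvd_triv_left)
  have "(N $ 2 $ 2, d, 5 - n) \<in> CS_triples" "similar_SL3 (Phi (Xmat c d n)) (Xmat (N $ 2 $ 2) d (5 - n))"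
    using std(1,2) Xmat_uminus[of "N $ 2 $ 2" "- d" "5 - n"] similar_trans unfolding N23 by auto
  then show ?thesis using that dv by blast
qed

section \<open>Transport of Gompf equivalence along the involution\<close>

definition Phi_rel :: "int \<times> int \<times> int \<Rightarrow> int \<times> int \<times> int \<Rightarrow> bool" where
  "Phi_rel t u \<longleftrightarrow> t \<in> CS_triples \<and> u \<in> CS_triples \<and>
     (case t of (c, d, n) \<Rightarrow> case u of (c', d', n') \<Rightarrow> similar_SL3 (Phi (Xmat c d n)) (Xmat c' d' n'))"

text \<open>Similarities are preserved by \<open>Phi\<close>. For a shift by k d, the new root
  modulo d depends on c alone, so both images have the same root and their traces differ by a
  multiple of d: again a shift.\<close>

lemma Phi_rel_step:
  assumes "gompf_step t t'" "Phi_rel t u" "Phi_rel t' u'"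
  shows "gompf_equiv u u'"
proof -
  obtain c d n c' d' n' e f m e' f' m' where
    t: "t = (c, d, n)" "t' = (c', d', n')" "u = (e, f, m)" "u' = (e', f', m')"
    by (metis surj_pair)
  have T: "(c, d, n) \<in> CS_triples" "(c', d', n') \<in> CS_triples" "(e, f, m) \<in> CS_triples" "(e', f', m') \<in> CS_triples"
    and S: "similar_SL3 (Phi (Xmat c d n)) (Xmat e f m)" "similar_SL3 (Phi (Xmat c' d' n')) (Xmat e' f' m')"
    using assms(2,3) by (auto simp: Phi_rel_def t)
  from assms(1) consider "similar_SL3 (Xmat c d n) (Xmat c' d' n')" | k where "(c', d', n') = (c, d, n + k * d)"
    by (auto simp: gompf_step_def t)
  then show ?thesis
  proof cases
    case 1
    then have "similar_SL3 (Xmat e f m) (Xmat e' f' m')"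
      using S similar_Phi[OF _ CS_Xmat(1)[OF T(1)]] similar_sym similar_trans by blast
    then show ?thesis unfolding t using T by (intro gompf_equiv_similar)
  next
    case (2 k)
    then have t': "c' = c" "d' = d" "n' = n + k * d" by auto
    obtain x where x: "(x, d, 5 - n) \<in> CS_triples" "similar_SL3 (Phi (Xmat c d n)) (Xmat x d (5 - n))"
      "d dvd x * (c - 1) - c" using Phi_Xmat[OF T(1)] .
    obtain y where y: "(y, d, 5 - n') \<in> CS_triples" "similar_SL3 (Phi (Xmat c d n')) (Xmat y d (5 - n'))"
      "d dvd y * (c - 1) - c" using Phi_Xmat[of c d n'] T(2) t' by blast
    have "d dvd (c - 1) * (y - x)"
      using dvd_diff[OF y(3) x(3)] by (simp add: algebra_simps)
    \<comment> \<open>A common divisor of d and c - 1 divides \<open>fpoly n c\<close> = c (c - 1)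
      (c - n + 1) - 1, hence 1.\<close>
    moreover have "coprime d (c - 1)"
    proof (rule coprimeI)
      fix p assume p: "p dvd d" "p dvd c - 1"
      have 1: "p dvd c * (c - 1) * (c - n + 1) - 1" using T(1) p(1) by (auto simp: CS_triples_def fpoly_eq)
      have "p dvd c * (c - 1) * (c - n + 1)" using p(2) by simp
      from dvd_diff[OF this 1] show "is_unit p" by simp
    qed
    ultimately have "d dvd y - x" by (simp add: coprime_dvd_mult_right_iff)
    then have dv: "d dvd x - y" by (simp add: dvd_diff_commute)
    have "gompf_equiv (e, f, m) (x, d, 5 - n)"
      using S(1) x T similar_sym similar_trans by (intro gompf_equiv_similar) blast+
    moreover have "gompf_equiv (x, d, 5 - n) (x, d, 5 - n')"
      by (rule gompf_equiv_shift[OF x(1)]) (simp add: t')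
    moreover have "gompf_equiv (x, d, 5 - n') (y, d, 5 - n')"
      using Xmat_shift[OF y(1) dv] y(1) similar_sym by (intro gompf_equiv_similar) auto
    moreover have "gompf_equiv (y, d, 5 - n') (e', f', m')"
      using S(2) y T similar_sym similar_trans unfolding t' by (intro gompf_equiv_similar) blast+
    ultimately show ?thesis unfolding t using gompf_equiv_trans by blast
  qed
qed

lemma Phi_rel_exists:
  assumes "t \<in> CS_triples" obtains u where "Phi_rel t u"
proof -
  obtain c d n where t: "t = (c, d, n)" by (metis surj_pair)
  obtain c' where "(c', d, 5 - n) \<in> CS_triples" "similar_SL3 (Phi (Xmat c d n)) (Xmat c' d (5 - n))"
    using Phi_Xmat assms unfolding t by blast
  then show ?thesis using that[of "(c', d, 5 - n)"] assms by (simp add: Phi_rel_def t)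
qed

lemma Phi_rel_equiv:
  assumes "gompf_equiv t t'" "Phi_rel t u" "Phi_rel t' u'"
  shows "gompf_equiv u u'"
  using assms(1)[unfolded gompf_equiv_def] assms(3)
proof (induction arbitrary: u' rule: rtranclp_induct)
  case base
  have "gompf_step t t" using assms(2) by (auto simp: gompf_step_def Phi_rel_def similar_refl)
  then show ?case using Phi_rel_step assms(2) base by blast
next
  case (step y z)
  then have y: "gompf_step y z \<or> gompf_step z y" by auto
  then have "y \<in> CS_triples" by (auto simp: gompf_step_def)
  then obtain w where w: "Phi_rel y w" by (rule Phi_rel_exists)
  have "gompf_equiv u w" using step.IH w by blast
  moreover have "gompf_equiv w u'" using y Phi_rel_step w step.prems gompf_equiv_sym by blast
  ultimately show ?case by (rule gompf_equiv_trans)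
qed

definition all_good :: "int \<Rightarrow> bool" where
  "all_good n \<longleftrightarrow> (\<forall>A. CS_matrix A \<longrightarrow> trace A = n \<longrightarrow> gompf_equiv_A0 A)"

lemma all_good_Phi:
  assumes "all_good n" shows "all_good (5 - n)"
  unfolding all_good_def
proof (intro allI impI)
  fix A :: mat3 assume A: "CS_matrix A" "trace A = 5 - n"
  note P = CS_Phi[OF A(1)]
  have "gompf_equiv_A0 (Phi A)" using assms P A(2) by (simp add: all_good_def)
  then obtain c d m where t: "(c, d, m) \<in> CS_triples" "similar_SL3 (Phi A) (Xmat c d m)"
    "gompf_equiv (c, d, m) (1, 1, 2)" by (auto simp: gompf_equiv_A0_def)
  obtain c' where c': "(c', d, 5 - m) \<in> CS_triples" "similar_SL3 (Phi (Xmat c d m)) (Xmat c' d (5 - m))"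
    using Phi_Xmat[OF t(1)] by blast
  have t1: "(1, 1, 2) \<in> CS_triples" by (simp add: CS_triples_def)
  \<comment> \<open>The base triple is mapped to one with d = 1, which is equivalent to the base
    triple again.\<close>
  obtain x where x: "(x, 1, 5 - 2) \<in> CS_triples" "similar_SL3 (Phi (Xmat 1 1 2)) (Xmat x 1 (5 - 2))"
    using Phi_Xmat[OF t1] by blast
  have "gompf_equiv (c', d, 5 - m) (x, 1, 5 - 2)"
    using Phi_rel_equiv[OF t(3)] c' x t(1) t1 by (simp add: Phi_rel_def)
  moreover have "gompf_equiv (x, 1, 5 - 2) (1, 1, 2)" using x(1) by (intro gompf_equiv_unit) auto
  ultimately have "gompf_equiv (c', d, 5 - m) (1, 1, 2)" by (rule gompf_equiv_trans)
  moreover have "similar_SL3 A (Xmat c' d (5 - m))"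
    using similar_Phi[OF t(2) P(1)] c'(2) similar_trans unfolding P(3) by blast
  ultimately show "gompf_equiv_A0 A" using c'(1) by (auto simp: gompf_equiv_A0_def)
qed

section \<open>Turning a standard form\<close>

text \<open>The traces of the theorem that are at least 3; 5 - n maps them onto the remaining
  ones.\<close>

definition admissible :: "int \<Rightarrow> bool" where
  "admissible n = (if n \<le> 69 then 3 \<le> n else if n = 71 then True else if n = 72 then True
            else if n = 74 then True else n = 78)"

definition disc :: "int \<Rightarrow> int" where
  "disc n = n * (n - 5) * (n * (n - 5) + 6) - 23"

text \<open>
  The first case takes care of the traces 3, 4 and 5, where \<open>disc\<close> is negative.
\<close>

definition norm_bound :: "int \<Rightarrow> int \<Rightarrow> bool" where
  "norm_bound n d = (if d \<le> 3 then True else 729 * (d * d) \<le> 16 * disc n)"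

text \<open>
  The traces are settled in increasing order of \<open>max n (5 - n)\<close>.
\<close>

definition known_trace :: "int \<Rightarrow> int \<Rightarrow> bool" where
  "known_trace n m = (if m < 3 then (if 5 - m < n then admissible (5 - m) else False)
                else if m < n then admissible m else False)"

lemma admissible_bounds: "admissible n \<Longrightarrow> 3 \<le> n \<and> n \<le> 78"
  by (auto simp: admissible_def split: if_splits)

lemma norm_bound_mono: "norm_bound n d \<Longrightarrow> e \<le> d \<Longrightarrow> norm_bound n e"
proof -
  assume "norm_bound n d" "e \<le> d"
  then show "norm_bound n e"
  proof (cases "e \<le> 3")
    case False
    then have "e * e \<le> d * d" using \<open>e \<le> d\<close> by (intro mult_mono) auto
    then show ?thesis using \<open>norm_bound n d\<close> False \<open>e \<le> d\<close> by (auto simp: norm_bound_def)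
  qed (simp add: norm_bound_def)
qed

lemma disc_mono:
  assumes "6 \<le> n" "n \<le> m" shows "disc n \<le> disc m"
proof -
  have "n * (n - 5) \<le> m * (m - 5)" using assms by (intro mult_mono) auto
  moreover have "0 \<le> n * (n - 5)" using assms by simp
  ultimately have "n * (n - 5) * (n * (n - 5) + 6) \<le> m * (m - 5) * (m * (m - 5) + 6)"
    by (intro mult_mono[of "n * (n - 5)" "m * (m - 5)"]) linarith+
  then show ?thesis by (simp add: disc_def)
qed

lemma norm_bound_trace_ge6:
  assumes "norm_bound n d" "3 < d" "3 \<le> n" shows "6 \<le> n"
proof (rule ccontr)
  assume "\<not> 6 \<le> n"
  then have "n = 3 \<or> n = 4 \<or> n = 5" using assms(3) by linarith
  then have "disc n < 0" by (auto simp: disc_def)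
  then show False using assms(1,2) by (simp add: norm_bound_def) (smt (verit) zero_le_square)
qed

lemma norm_bound_mono_trace:
  assumes "norm_bound n d" "3 \<le> n" "n \<le> m" shows "norm_bound m d"
proof (cases "d \<le> 3")
  case False
  then show ?thesis using assms disc_mono[of n m] norm_bound_trace_ge6[OF assms(1)] by (auto simp: norm_bound_def)
qed (simp add: norm_bound_def)

text \<open>The integer part of (4/27) sqrt (D 78), where 78 is the largest admissible
  trace.\<close>

lemma norm_bound_le_843:
  assumes "norm_bound n d" "3 \<le> n" "n \<le> 78" shows "d \<le> 843"
proof (rule ccontr)
  assume d: "\<not> d \<le> 843"
  have "norm_bound 78 d" by (rule norm_bound_mono_trace[OF assms])
  then have "norm_bound 78 844" by (rule norm_bound_mono) (use d in simp)
  then show False by (simp add: norm_bound_def disc_def)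
qed

text \<open>The flag is needed since a turn exchanges a matrix with a transposed one, and goodness
  is not known to be invariant under transposition.\<close>

definition std_good :: "bool \<Rightarrow> int \<Rightarrow> int \<Rightarrow> int \<Rightarrow> bool" where
  "std_good p c d n \<longleftrightarrow> gompf_equiv_A0 (if p then Xmat c d n else transpose (Xmat c d n))"

lemma std_good_similar:
  "similar_SL3 (Xmat c d n) (Xmat c' d' n) \<Longrightarrow> std_good p c d n \<longleftrightarrow> std_good p c' d' n"
  by (cases p) (auto simp: std_good_def good_similar dest: similar_transpose)

lemma std_good_abs: "(c, d, n) \<in> CS_triples \<Longrightarrow> (c, \<bar>d\<bar>, n) \<in> CS_triples \<and> (std_good p c \<bar>d\<bar> n \<longleftrightarrow> std_good p c d n)"
  using Xmat_uminus[of c d n] std_good_similar[of c d n c "- d" p] by (auto simp: abs_if)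

lemma gval_odd: "coprime k x \<Longrightarrow> odd (gval n k x)"
  by (auto simp: gval_def) 

text \<open>The covector construction for a Hessenberg form with g = 1 and s = - d. It determines
  the new root modulo e only, which suffices as now e is the whole modulus. Absolute values spare
  the certificates all signs.\<close>

lemma turn:
  assumes t: "(c, d, n) \<in> CS_triples" and cop: "coprime k x" and d: "d dvd x * c - k"
    and e: "\<bar>gval n k x\<bar> = \<bar>e * d\<bar>" and c': "e dvd x * c' - k"
  shows "(c', e, n) \<in> CS_triples" "std_good p c d n \<longleftrightarrow> std_good (\<not> p) c' e n"
proof -
  obtain y where y: "x * c - k = d * y" using d by blast
  \<comment> \<open>The cofactor with the sign that belongs to s = - d.\<close>
  obtain e0 where e0: "(- d) * e0 = gval n k x" "\<bar>e0\<bar> = \<bar>e\<bar>"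
  proof -
    have "gval n k x = e * d \<or> gval n k x = - (e * d)" using e by (simp add: abs_eq_iff)
    then show ?thesis using that[of e] that[of "- e"] by (auto simp: mult.commute)
  qed
  obtain l al mu be nu where H: "similar_SL3 (Xmat c d n) (mk3 l al mu 1 be nu 0 (- d) c)"
    using Xmat_hessenberg[OF t] .
  define M where "M = mk3 l al mu 1 be nu 0 (- d) c"
  have CS: "CS_matrix M" "trace M = n"
    using similar_CS[OF H] CS_Xmat[OF t] unfolding M_def by auto
  have d0: "- d \<noteq> 0" using t by (simp add: CS_triples_def)
  have k: "k = c * x - (- d) * (- y)" using y by (simp add: algebra_simps)
  obtain c1 d1 where 1: "(c1, d1, n) \<in> CS_triples" "similar_SL3 (transpose M) (Xmat c1 d1 n)"
    "d1 = - (1 * e0)" "e0 dvd x * c1 - k"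
    using hessenberg_transpose_std[OF CS M_def _ d0 k e0(1) cop] by auto
  have ed: "e dvd e0" "e0 dvd e" using e0(2) by (metis abs_dvd_iff dvd_abs_iff dvd_refl)+
  have d1: "\<bar>d1\<bar> = \<bar>e\<bar>" using 1(3) e0(2) by simp
  have "e dvd x * c1 - k" using 1(4) ed by (metis dvd_trans)
  then have "e dvd x * (c' - c1)" using c' by (metis dvd_diff right_diff_distrib diff_diff_eq2 diff_add_cancel add.commute)
  moreover have "e dvd gval n k x" using ed(1) e0(1) by (metis dvd_mult)
  then have "coprime e x" by (rule coprime_gval[OF cop])
  ultimately have "e dvd c' - c1" by (simp add: coprime_dvd_mult_right_iff)
  then have "d1 dvd c' - c1" using d1 by (metis abs_dvd_iff)
  note s = Xmat_shift[OF 1(1) this]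
  have 2: "(c', \<bar>e\<bar>, n) \<in> CS_triples" using std_good_abs[OF s(1)] d1 by simp
  then show tr: "(c', e, n) \<in> CS_triples" by (simp add: CS_triples_def)
  have "std_good (\<not> p) c' e n \<longleftrightarrow> std_good (\<not> p) c' d1 n" using std_good_abs[OF s(1), of "\<not> p"] std_good_abs[OF tr, of "\<not> p"] d1 by simp
  also have "\<dots> \<longleftrightarrow> std_good (\<not> p) c1 d1 n" using std_good_similar[OF s(2)] by simp
  also have "\<dots> \<longleftrightarrow> std_good p c d n"
  proof -
    have sim: "similar_SL3 (transpose (Xmat c d n)) (Xmat c1 d1 n)"
      using similar_transpose[OF H] 1(2) similar_trans unfolding M_def by blast
    then have "similar_SL3 (Xmat c d n) (transpose (Xmat c1 d1 n))"
      using similar_transpose[OF sim] by simp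
    then show ?thesis using good_similar sim by (cases p) (simp_all add: std_good_def)
  qed
  finally show "std_good p c d n \<longleftrightarrow> std_good (\<not> p) c' e n" by blast
qed

lemma turn_exists:
  assumes t: "(c, d, n) \<in> CS_triples" and cop: "coprime k x" and d: "d dvd x * c - k"
    and e: "\<bar>gval n k x\<bar> = \<bar>e * d\<bar>"
  obtains c' where "(c', e, n) \<in> CS_triples" "\<And>p. std_good p c d n \<longleftrightarrow> std_good (\<not> p) c' e n"
proof -
  have "e dvd gval n k x" using e by (metis abs_dvd_iff dvd_abs_iff dvd_triv_left)
  then have "coprime x e" using coprime_gval[OF cop] by (simp add: coprime_commute)
  then obtain u v where "u * x + v * e = 1" using bezout_int[of x e] by auto
  then have "x * (u * k) - k = e * (- v * k)"
    by (metis (no_types, opaque_lifting) add_diff_cancel_left' left_diff_distrib minus_diff_eq mult.assoc mult.commute mult_1 mult_minus_left mult_minus_right)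
  then have "e dvd x * (u * k) - k" by simp
  then show ?thesis using that turn[OF assms] by blast
qed

section \<open>Certificates\<close>

text \<open>
  The functions below are evaluated by rewriting, which is strict in the arguments of all functions
  and connectives except for the branches of \<open>if\<close>; hence nested conditionals instead of conjunctions.
  Roots of \<open>f\<^sub>n\<close> modulo \<open>d\<close> are found for all traces \<open>n\<close> of a window at once, with the values of
  \<open>f\<^sub>n(c)\<close> and \<open>c (c - 1)\<close> updated by finite differences, because division is slow.
\<close>

definition add_if_neg :: "int \<Rightarrow> int \<Rightarrow> int" where
  "add_if_neg d a = (if a < 0 then a + d else a)"

definition sub_if_ge :: "int \<Rightarrow> int \<Rightarrow> int" where
  "sub_if_ge d a = (if a < d then a else a - d)"

text \<open>Raising the trace by p lowers the value at c by h = p c (c - 1), so one subtraction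
  modulo d leads to the next trace. The index j counts the steps that remain in the window.\<close>

function trace_hits :: "int \<Rightarrow> int \<Rightarrow> int \<Rightarrow> int \<Rightarrow> int list" where
  "trace_hits d h j u = (if j < 0 then [] else
     if u = 0 then j # trace_hits d h (j - 1) (add_if_neg d (u - h)) else trace_hits d h (j - 1) (add_if_neg d (u - h)))"
  by pat_completeness auto
termination by (relation "Wellfounded.measure (\<lambda>(d, h, j, u). nat (j + 1))") auto

primrec emit :: "int \<Rightarrow> int \<Rightarrow> int \<Rightarrow> int list \<Rightarrow> (int \<times> int) list \<Rightarrow> (int \<times> int) list" where
  "emit p m c [] acc = acc"
| "emit p m c (j # js) acc = (c, m - p * j) # emit p m c js acc"

text \<open>\<open>u1\<close>, \<open>u2\<close>, \<open>u3\<close> are forward differences with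
  step p of the cubic value \<open>u\<close>, the third being constant; \<open>h1\<close>,
  \<open>h2\<close> are those of the quadratic \<open>h\<close>. The last trace of the window is
  \<open>m\<close>, from which a hit j gives back its trace m - p j.\<close>

function root_loop :: "int \<Rightarrow> int \<Rightarrow> int \<Rightarrow> int \<Rightarrow> int \<Rightarrow> int \<Rightarrow> int \<Rightarrow> int \<Rightarrow> int \<Rightarrow> int \<Rightarrow> int \<Rightarrow> int \<Rightarrow>
    (int \<times> int) list \<Rightarrow> (int \<times> int) list" where
  "root_loop p d m j c u u1 u2 u3 h h1 h2 acc =
     (if d \<le> c then acc else if p \<le> 0 then acc else
      root_loop p d m j (c + p) (sub_if_ge d (u + u1)) (sub_if_ge d (u1 + u2)) (sub_if_ge d (u2 + u3)) u3
        (sub_if_ge d (h + h1)) (sub_if_ge d (h1 + h2)) h2 (emit p m c (trace_hits d h j u) acc))"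
  by pat_completeness auto
termination by (relation "Wellfounded.measure (\<lambda>(p, d, m, j, c, _). nat (d - c))") auto

declare trace_hits.simps [simp del] root_loop.simps [simp del]

definition roots_from :: "int \<Rightarrow> int \<Rightarrow> int \<Rightarrow> int \<Rightarrow> int \<Rightarrow> (int \<times> int) list \<Rightarrow> (int \<times> int) list" where
  "roots_from p d n j c acc =
     root_loop p d (n + p * j) j c (gval n c 1 mod d) ((gval n (c + p) 1 - gval n c 1) mod d)
       ((gval n (c + 2 * p) 1 - 2 * gval n (c + p) 1 + gval n c 1) mod d) (6 * p * (p * p) mod d)
       (p * c * (c - 1) mod d) (p * p * (2 * c + p - 1) mod d) (2 * p * (p * p) mod d) acc"

definition roots_window :: "int \<Rightarrow> int \<Rightarrow> int \<Rightarrow> int \<Rightarrow> (int \<times> int) list \<Rightarrow> (int \<times> int) list" where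
  "roots_window p d n c acc = roots_from p d n ((78 - n) div p) c acc"

primrec roots_classes :: "int \<Rightarrow> int \<Rightarrow> int \<Rightarrow> (int \<times> int) list \<Rightarrow> (int \<times> int) list \<Rightarrow> (int \<times> int) list" where
  "roots_classes p d lo [] acc = acc"
| "roots_classes p d lo (q # qs) acc =
     roots_classes p d lo qs (roots_window p d (lo + (snd q - lo) mod p) (fst q) acc)"

text \<open>A sieve: the pairs (c, n) are first solved modulo the divisor p of d, and only their
  residue classes are searched modulo d, with step p both in c and in n.\<close>

definition root_candidates :: "int \<Rightarrow> int \<Rightarrow> int \<Rightarrow> (int \<times> int) list" where
  "root_candidates p d lo = roots_classes p d lo (if p = 1 then [(0, 0)] else roots_from 1 p 0 (p - 1) 0 []) []"

section \<open>Descent by a single turn\<close>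

definition try_desc :: "int \<Rightarrow> int \<Rightarrow> int \<Rightarrow> int \<Rightarrow> bool" where
  "try_desc dd n x k = (if \<bar>gval n k x\<bar> < dd then (if x = 1 then True else gcd k x = 1) else False)"

text \<open>Here \<open>dd\<close> is d^2: a norm e d below d^2 means a turn to some e < d. The
  residue of x c modulo d is kept in \<open>r\<close>, and k runs over its representatives next to 0
  on either side.\<close>

function descends :: "int \<Rightarrow> int \<Rightarrow> int \<Rightarrow> int \<Rightarrow> int \<Rightarrow> int \<Rightarrow> bool" where
  "descends d dd n c x r = (if 8 < x then False else if try_desc dd n x r then True
      else if try_desc dd n x (r - d) then True else descends d dd n c (x + 1) (sub_if_ge d (r + c)))"
  by pat_completeness auto
termination by (relation "Wellfounded.measure (\<lambda>(d, dd, n, c, x, r). nat (9 - x))") auto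

declare descends.simps [simp del]

text \<open>
  \<open>Turn k x c'\<close> passes to the root \<open>c'\<close> modulo \<open>gval n k x / d\<close> and to the transposed matrix, \<open>Shift m\<close>
  replaces the trace by \<open>m\<close>. The flag of \<open>chain\<close> tells whether the current goal concerns \<open>X\<^sub>c\<^sub>,\<^sub>d\<^sub>,\<^sub>n\<close> itself
  or its transpose; shifts are available only for the former.
\<close>

datatype move = Turn int int int | Shift int

primrec chain :: "int \<Rightarrow> int \<Rightarrow> move list \<Rightarrow> int \<Rightarrow> int \<Rightarrow> int \<Rightarrow> bool \<Rightarrow> bool" where
  "chain m b [] n c d p = (if n = m then d < b else if p then known_trace m n else False)"
| "chain m b (v # vs) n c d p = (case v of
     Shift n' \<Rightarrow> if p then (if (n' - n) mod d = 0 then chain m b vs n' c d p else False) else False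
   | Turn k x c' \<Rightarrow> if gcd k x = 1 then (if (x * c - k) mod d = 0 then
       (let e = \<bar>gval n k x\<bar> div d in
         if e * d = \<bar>gval n k x\<bar> then (if (x * c' - k) mod e = 0 then chain m b vs n c' e (\<not> p) else False)
         else False) else False) else False)"

primrec lookup_chains :: "int \<Rightarrow> int \<Rightarrow> int \<Rightarrow> (int \<times> int \<times> move list \<times> move list) list \<Rightarrow> int \<Rightarrow> int \<Rightarrow> bool" where
  "lookup_chains m b d [] n c = False"
| "lookup_chains m b d (t # ts) n c = (case t of (n', c', ps, qs) \<Rightarrow>
     if n = n' then (if c = c' then (if chain n b ps n c d True then chain n b qs n c d False else False)
       else lookup_chains m b d ts n c) else lookup_chains m b d ts n c)"

text \<open>
  Hessenberg forms whose entry \<open>g\<close> below the diagonal is at least 3 come from vectors that do not extend to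
  a standard basis. A covector with index \<open>g e\<close> does, and \<open>nc_search\<close> looks for one such that
  \<open>g e\<close> satisfies the norm bound; \<open>nc_lookup\<close> handles the few cases where there is none.
\<close>

definition nc_check :: "int \<Rightarrow> int \<Rightarrow> int \<Rightarrow> int \<Rightarrow> int \<Rightarrow> int \<Rightarrow> bool" where
  "nc_check n s g x k e = (if norm_bound n (g * e) then if gcd e g = 1 then if gcd k x = 1 then e * s = \<bar>gval n k x\<bar>
     else False else False else False)"

definition nc_try :: "int \<Rightarrow> int \<Rightarrow> int \<Rightarrow> int \<Rightarrow> int \<Rightarrow> bool" where
  "nc_try n s g x k = nc_check n s g x k (\<bar>gval n k x\<bar> div s)"

function nc_search :: "int \<Rightarrow> int \<Rightarrow> int \<Rightarrow> int \<Rightarrow> int \<Rightarrow> int \<Rightarrow> bool" where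
  "nc_search n t s g x r = (if 8 < x then False else if nc_try n s g x r then True
      else if nc_try n s g x (r - s) then True else if nc_try n s g x (r + s) then True
      else if nc_try n s g x (r + 2 * s) then True else nc_search n t s g (x + 1) (sub_if_ge s (r + t)))"
  by pat_completeness auto
termination by (relation "Wellfounded.measure (\<lambda>(n, t, s, g, x, r). nat (9 - x))") auto

text \<open>The covector fixes its root only modulo e. This loop visits the g lifts c + e i modulo d
  = g e; each that is a root of f_n must be covered by chains.\<close>

function nc_roots :: "int \<Rightarrow> int \<Rightarrow> int \<Rightarrow> int \<Rightarrow> int \<Rightarrow> (int \<times> int \<times> move list \<times> move list) list \<Rightarrow> int \<Rightarrow> bool" where
  "nc_roots n b d e c w j = (if j \<le> 0 then True else
      if gval n c 1 mod d = 0 then (if lookup_chains n b d w n c then nc_roots n b d e (c + e) w (j - 1) else False)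
      else nc_roots n b d e (c + e) w (j - 1))"
  by pat_completeness auto
termination by (relation "Wellfounded.measure (\<lambda>(n, b, d, e, c, w, j). nat j)") auto

definition nc_entry :: "int \<Rightarrow> int \<Rightarrow> int \<Rightarrow> int \<Rightarrow> int \<Rightarrow> int \<Rightarrow> int \<Rightarrow>
    (int \<times> int \<times> move list \<times> move list) list \<Rightarrow> int \<Rightarrow> bool" where
  "nc_entry n s g k x c b w e = (if e * s = \<bar>gval n k x\<bar> then if gcd k x = 1 then if gcd e g = 1 then
      if (x * c - k) mod e = 0 then if norm_bound n (b - 1) then nc_roots n b (g * e) e c w g
      else False else False else False else False else False)"

type_synonym nc_table = "(int \<times> int \<times> int \<times> int \<times> int \<times> int \<times> int \<times> (int \<times> int \<times> move list \<times> move list) list) list"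

primrec nc_lookup :: "int \<Rightarrow> int \<Rightarrow> int \<Rightarrow> int \<Rightarrow> nc_table \<Rightarrow> bool" where
  "nc_lookup n t s g [] = False"
| "nc_lookup n t s g (q # qs) = (case q of (n', t', g', k, x, c, b, w) \<Rightarrow>
     if n = n' then if t = t' then if g = g' then
       (if (x * t - k) mod s = 0 then nc_entry n s g k x c b w (\<bar>gval n k x\<bar> div s) else False)
     else nc_lookup n t s g qs else nc_lookup n t s g qs else nc_lookup n t s g qs)"

text \<open>All odd contents g for which the index g^2 s is within the norm bound; the cap 99 makes
  the recursion terminate.\<close>

function nc_loop :: "int \<Rightarrow> int \<Rightarrow> int \<Rightarrow> nc_table \<Rightarrow> int \<Rightarrow> bool" where
  "nc_loop n t s tb g = (if norm_bound n (g * g * s) then (if 99 < g then False else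
      if nc_search n t s g 1 t then nc_loop n t s tb (g + 2)
      else if nc_lookup n t s g tb then nc_loop n t s tb (g + 2) else False) else True)"
  by pat_completeness auto
termination by (relation "Wellfounded.measure (\<lambda>(n, t, s, tb, g). nat (100 - g))") auto

declare nc_search.simps [simp del] nc_roots.simps [simp del] nc_loop.simps [simp del]

section \<open>Checking whole ranges of norms\<close>

primrec check_nodes :: "int \<Rightarrow> (int \<times> int \<times> move list \<times> move list) list \<Rightarrow> nc_table \<Rightarrow> (int \<times> int) list \<Rightarrow> bool" where
  "check_nodes d tbl tb [] = True"
| "check_nodes d tbl tb (q # qs) =
     (if admissible (snd q) then (if nc_loop (snd q) (fst q) d tb 3 then
        (if descends d (d * d) (snd q) (fst q) 1 (fst q) then check_nodes d tbl tb qs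
         else if lookup_chains (snd q) d d tbl (snd q) (fst q) then check_nodes d tbl tb qs else False) else False)
      else check_nodes d tbl tb qs)"

text \<open>Testing the bound at \<open>lo - 1\<close> ensures that no smaller trace was left out,
  as the bound is monotone in the trace.\<close>

definition check_norm :: "int \<Rightarrow> int \<Rightarrow> int \<Rightarrow> (int \<times> int \<times> move list \<times> move list) list \<Rightarrow> nc_table \<Rightarrow> bool" where
  "check_norm d p lo tbl tb = (if p \<le> 0 then False else if d mod p = 0 then
     (if (if lo \<le> 3 then False else norm_bound (lo - 1) d) then False
     else check_nodes d tbl tb (root_candidates p d lo)) else False)"

primrec check_norms :: "int \<Rightarrow> int \<Rightarrow> (int \<times> int \<times> (int \<times> int \<times> move list \<times> move list) list \<times> nc_table) list \<Rightarrow> bool" where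
  "check_norms d b [] = (d = b)"
| "check_norms d b (t # ts) = (case t of (p, lo, tbl, tb) \<Rightarrow> if check_norm d p lo tbl tb then check_norms (d + 2) b ts else False)"

section \<open>Completeness of the root enumeration\<close>

lemma trace_hits_mem:
  assumes "0 \<le> h" "h < d" "0 \<le> u" "u < d" "0 \<le> i" "i \<le> j" "d dvd u - (j - i) * h"
  shows "i \<in> set (trace_hits d h j u)"
  using assms
proof (induction d h j u rule: trace_hits.induct)
  case (1 d h j u)
  show ?case
  proof (cases "i = j")
    case True
    then have "d dvd u" using 1 by simp
    then have "u = 0" using 1 by (metis zdvd_not_zless order_le_less)
    then show ?thesis using True 1 by (subst trace_hits.simps) simp
  next
    case False
    have "add_if_neg d (u - h) - (j - 1 - i) * h = u - (j - i) * h + (if u - h < 0 then d else 0)"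
      by (simp add: add_if_neg_def algebra_simps)
    then have dv: "d dvd add_if_neg d (u - h) - (j - 1 - i) * h" using 1 by simp
    have r: "0 \<le> add_if_neg d (u - h)" "add_if_neg d (u - h) < d" using 1 by (auto simp: add_if_neg_def)
    have "i \<in> set (trace_hits d h (j - 1) (add_if_neg d (u - h)))"
      using 1 dv r False by (cases "u = 0") auto
    then show ?thesis using 1 by (subst trace_hits.simps) auto
  qed
qed

lemma set_emit: "set (emit p m c js acc) = (\<lambda>j. (c, m - p * j)) ` set js \<union> set acc"
  by (induction js) auto

lemma sub_if_ge_add_mod: "d > 0 \<Longrightarrow> sub_if_ge d (a mod d + b mod d) = (a + b) mod d"
proof -
  assume d: "d > 0"
  have r: "0 \<le> a mod d" "a mod d < d" "0 \<le> b mod d" "b mod d < d" using d by auto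
  have "(a + b) mod d = (a mod d + b mod d) mod d" by (simp add: mod_add_eq)
  also have "\<dots> = sub_if_ge d (a mod d + b mod d)"
  proof (cases "a mod d + b mod d < d")
    case False
    then have "(a mod d + b mod d) mod d = (a mod d + b mod d - d) mod d" by simp
    also have "\<dots> = a mod d + b mod d - d" by (rule mod_pos_pos_trivial) (use False r in linarith)+
    finally show ?thesis using False by (simp add: sub_if_ge_def)
  qed (use r in \<open>simp add: sub_if_ge_def\<close>)
  finally show ?thesis by simp
qed

lemma gval_trace: "gval (n + t) c 1 = gval n c 1 - t * (c * (c - 1))"
  by (simp add: gval_def algebra_simps)

lemma roots_from_step:
  assumes "d > 0" "p > 0" "c < d"
  shows "roots_from p d n j c acc =
    roots_from p d n j (c + p) (emit p (n + p * j) c (trace_hits d (p * c * (c - 1) mod d) j (gval n c 1 mod d)) acc)"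
proof -
  have u: "sub_if_ge d (gval n c 1 mod d + (gval n (c + p) 1 - gval n c 1) mod d) = gval n (c + p) 1 mod d"
    unfolding sub_if_ge_add_mod[OF assms(1)] by simp
  have u1: "sub_if_ge d ((gval n (c + p) 1 - gval n c 1) mod d + (gval n (c + 2 * p) 1 - 2 * gval n (c + p) 1 + gval n c 1) mod d)
     = (gval n (c + p + p) 1 - gval n (c + p) 1) mod d"
    unfolding sub_if_ge_add_mod[OF assms(1)] by (rule arg_cong[of _ _ "\<lambda>z. z mod d"]) (simp add: gval_def algebra_simps)
  have u2: "sub_if_ge d ((gval n (c + 2 * p) 1 - 2 * gval n (c + p) 1 + gval n c 1) mod d + 6 * p * (p * p) mod d)
     = (gval n (c + p + 2 * p) 1 - 2 * gval n (c + p + p) 1 + gval n (c + p) 1) mod d"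
    unfolding sub_if_ge_add_mod[OF assms(1)] by (rule arg_cong[of _ _ "\<lambda>z. z mod d"]) (simp add: gval_def algebra_simps)
  have h: "sub_if_ge d (p * c * (c - 1) mod d + p * p * (2 * c + p - 1) mod d) = p * (c + p) * (c + p - 1) mod d"
    unfolding sub_if_ge_add_mod[OF assms(1)] by (rule arg_cong[of _ _ "\<lambda>z. z mod d"]) (simp add: algebra_simps)
  have h1: "sub_if_ge d (p * p * (2 * c + p - 1) mod d + 2 * p * (p * p) mod d) = p * p * (2 * (c + p) + p - 1) mod d"
    unfolding sub_if_ge_add_mod[OF assms(1)] by (rule arg_cong[of _ _ "\<lambda>z. z mod d"]) (simp add: algebra_simps)
  show ?thesis
    unfolding roots_from_def
    apply (subst root_loop.simps)
    unfolding u u1 u2 h h1 using assms by simp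
qed

lemma roots_from_done: "d \<le> c \<Longrightarrow> roots_from p d n j c acc = acc"
  unfolding roots_from_def by (subst root_loop.simps) simp

lemma roots_from_acc: "d > 0 \<Longrightarrow> p > 0 \<Longrightarrow> set acc \<subseteq> set (roots_from p d n j c acc)"
proof (induction "nat (d - c)" arbitrary: c acc rule: less_induct)
  case less
  show ?case
  proof (cases "c < d")
    case True
    let ?acc = "emit p (n + p * j) c (trace_hits d (p * c * (c - 1) mod d) j (gval n c 1 mod d)) acc"
    have "set ?acc \<subseteq> set (roots_from p d n j (c + p) ?acc)"
      by (rule less.hyps) (use True less.prems in auto)
    then show ?thesis unfolding roots_from_step[OF less.prems True] by (auto simp: set_emit)
  qed (simp add: roots_from_done)
qed

lemma roots_from_mem:
  assumes "d > 0" "p > 0" "c' < d" "0 \<le> i" "c' = c + p * i" "0 \<le> t" "t \<le> j" "d dvd gval (n + p * t) c' 1"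
  shows "(c', n + p * t) \<in> set (roots_from p d n j c acc)"
  using assms(3-5)
proof (induction "nat i" arbitrary: c i acc rule: less_induct)
  case less
  have "0 \<le> p * i" using less.prems assms(2) by simp
  then have c: "c < d" using less.prems by linarith
  let ?acc = "emit p (n + p * j) c (trace_hits d (p * c * (c - 1) mod d) j (gval n c 1 mod d)) acc"
  show ?case
  proof (cases "i = 0")
    case True
    have "gval (n + p * t) c 1 = gval n c 1 - (j - (j - t)) * (p * c * (c - 1))"
      unfolding gval_trace by (simp add: algebra_simps)
    then have "d dvd gval n c 1 - (j - (j - t)) * (p * c * (c - 1))" using assms(8) less.prems True by simp
    \<comment> \<open>Multiples of d are subtracted to pass to the reduced quantities stored in the
      loop; the trace n + p t is hit at index j - t because the index runs downwards.\<close>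
    then have "d dvd (gval n c 1 - (j - (j - t)) * (p * c * (c - 1)))
        - d * (gval n c 1 div d - (j - (j - t)) * (p * c * (c - 1) div d))" by simp
    also have "\<dots> = gval n c 1 mod d - (j - (j - t)) * (p * c * (c - 1) mod d)"
      by (simp only: minus_mult_div_eq_mod[symmetric] algebra_simps)
    finally have "d dvd gval n c 1 mod d - (j - (j - t)) * (p * c * (c - 1) mod d)" .
    then have "j - t \<in> set (trace_hits d (p * c * (c - 1) mod d) j (gval n c 1 mod d))"
      using assms by (intro trace_hits_mem) auto
    then have "(c, n + p * j - p * (j - t)) \<in> set ?acc" unfolding set_emit by blast
    moreover have "n + p * j - p * (j - t) = n + p * t" by (simp add: algebra_simps)
    ultimately have "(c, n + p * t) \<in> set ?acc" by (simp only:)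
    moreover have "c' = c" using less.prems True by simp
    ultimately show ?thesis
      unfolding roots_from_step[OF assms(1,2) c] using roots_from_acc[OF assms(1,2)] by blast
  next
    case False
    have "(c', n + p * t) \<in> set (roots_from p d n j (c + p) ?acc)"
      by (rule less.hyps[of "i - 1"]) (use less.prems False in \<open>auto simp: algebra_simps\<close>)
    then show ?thesis unfolding roots_from_step[OF assms(1,2) c] .
  qed
qed

lemma roots_classes_acc: "d > 0 \<Longrightarrow> p > 0 \<Longrightarrow> set acc \<subseteq> set (roots_classes p d lo qs acc)"
proof (induction qs arbitrary: acc)
  case (Cons q qs)
  show ?case using Cons.IH[OF Cons.prems] roots_from_acc[OF Cons.prems] unfolding roots_classes.simps roots_window_def by blast
qed simp

lemma roots_classes_mem:
  assumes "d > 0" "p > 0" "(c mod p, n mod p) \<in> set qs" "lo \<le> n" "n \<le> 78" "0 \<le> c" "c < d" "d dvd gval n c 1"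
  shows "(c, n) \<in> set (roots_classes p d lo qs acc)"
  using assms(3)
proof (induction qs arbitrary: acc)
  case (Cons q qs)
  show ?case
  proof (cases "q = (c mod p, n mod p)")
    case True
    \<comment> \<open>The least trace from \<open>lo\<close> on in the residue class of n modulo
      p.\<close>
    define n0 where "n0 = lo + (n mod p - lo) mod p"
    define t where "t = (n - n0) div p"
    have "(n - lo) mod p = (n mod p - lo) mod p" by (simp add: mod_simps)
    then have n0: "n - n0 = (n - lo) div p * p" unfolding n0_def 
      using div_mult_mod_eq[of "n - lo" p] by linarith
    have "t = (n - lo) div p" unfolding t_def n0 using assms(2) by simp
    then have nt: "n = n0 + p * t" using n0 by (simp add: algebra_simps)
    have "0 \<le> (n - lo) div p" using assms by (simp add: pos_imp_zdiv_nonneg_iff)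
    then have "0 \<le> n - n0" using n0 assms(2) by simp
    then have t0: "0 \<le> t" using assms(2) by (simp add: t_def pos_imp_zdiv_nonneg_iff)
    have tj: "t \<le> (78 - n0) div p" unfolding t_def by (rule zdiv_mono1) (use assms in auto)
    have "(c, n0 + p * t) \<in> set (roots_from p d n0 ((78 - n0) div p) (c mod p) acc)"
      by (rule roots_from_mem[of _ _ _ "c div p"]) (use assms t0 tj nt in \<open>auto simp: pos_imp_zdiv_nonneg_iff\<close>)
    then have "(c, n) \<in> set (roots_window p d n0 (c mod p) acc)" using nt by (simp add: roots_window_def)
    then show ?thesis using roots_classes_acc[OF assms(1,2)] True by (simp add: n0_def) blast
  next
    case False
    then show ?thesis using Cons by auto
  qed
qed simp

lemma dvd_gval_mod:
  assumes "p dvd gval n c 1" shows "p dvd gval (n mod p) (c mod p) 1"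
proof -
  define C b where "C = c mod p" and "b = c div p"
  have c: "c = C + p * b" by (simp add: C_def b_def)
  have "gval n c 1 = gval (n mod p + p * (n div p)) c 1" by simp
  also have "\<dots> = gval (n mod p) c 1 - p * ((n div p) * (c * (c - 1)))" unfolding gval_trace by (simp add: mult.assoc)
  also have "gval (n mod p) c 1 = gval (n mod p) C 1
      + p * (b * (3*C*C + 3*C*p*b + p*p*b*b - (n mod p)*(2*C + p*b) + (n mod p - 1)))"
    unfolding c gval_def by (simp add: algebra_simps)
  finally have "gval (n mod p) C 1 = gval n c 1 - p * (b * (3*C*C + 3*C*p*b + p*p*b*b
      - (n mod p)*(2*C + p*b) + (n mod p - 1)) - (n div p) * (c * (c - 1)))"
    by (simp add: algebra_simps)
  then show ?thesis using assms by (simp add: C_def)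
qed

lemma root_candidates_mem:
  assumes "d > 0" "p > 0" "p dvd d" "lo \<le> n" "n \<le> 78" "0 \<le> c" "c < d" "d dvd gval n c 1"
  shows "(c, n) \<in> set (root_candidates p d lo)"
proof -
  have "(c mod p, n mod p) \<in> set (if p = 1 then [(0, 0)] else roots_from 1 p 0 (p - 1) 0 [])"
  proof (cases "p = 1")
    case False
    have "p dvd gval (n mod p) (c mod p) 1" by (rule dvd_gval_mod) (rule dvd_trans[OF assms(3,8)])
    then have "(c mod p, 0 + 1 * (n mod p)) \<in> set (roots_from 1 p 0 (p - 1) 0 [])"
      using assms(2) by (intro roots_from_mem[of _ _ _ "c mod p"]) (auto simp: pos_mod_bound[of p n] zle_diff1_eq)
    then show ?thesis using False by simp
  qed simp
  then show ?thesis unfolding root_candidates_def using roots_classes_mem[OF assms(1,2) _ assms(4-8)] by blast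
qed

section \<open>Soundness of the searches and chains\<close>

lemma try_desc_sound: "try_desc dd n x k \<Longrightarrow> coprime k x \<and> \<bar>gval n k x\<bar> < dd"
  by (auto simp: try_desc_def coprime_iff_gcd_eq_1 split: if_splits)

lemma descends_sound:
  assumes "descends d dd n c x r" "d dvd x * c - r" "1 \<le> x"
  shows "\<exists>k x. coprime k x \<and> d dvd x * c - k \<and> \<bar>gval n k x\<bar> < dd"
  using assms
proof (induction d dd n c x r rule: descends.induct)
  case (1 d dd n c x r)
  consider "try_desc dd n x r" | "try_desc dd n x (r - d)" | "descends d dd n c (x + 1) (sub_if_ge d (r + c))" "\<not> 8 < x"
    "\<not> try_desc dd n x r" "\<not> try_desc dd n x (r - d)"
    using 1(2) by (subst (asm) descends.simps) (auto split: if_splits)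
  then show ?case
  proof cases
    case 1
    then show ?thesis using \<open>d dvd x * c - r\<close> try_desc_sound by blast
  next
    case 2
    have "x * c - (r - d) = (x * c - r) + d" by simp
    moreover have "d dvd (x * c - r) + d" using \<open>d dvd x * c - r\<close> by (rule dvd_add) simp
    ultimately have "d dvd x * c - (r - d)" by (simp only:)
    then show ?thesis using 2 try_desc_sound by blast
  next
    case 3
    have "(x + 1) * c - sub_if_ge d (r + c) = (x * c - r) + (if r + c < d then 0 else d)"
      by (simp add: sub_if_ge_def algebra_simps)
    moreover have "d dvd (x * c - r) + (if r + c < d then 0 else d)"
      using \<open>d dvd x * c - r\<close> by (rule dvd_add) simp
    ultimately have "d dvd (x + 1) * c - sub_if_ge d (r + c)" by (simp only:)
    then show ?thesis using 1(1)[OF 3(2-4) 3(1)] \<open>1 \<le> x\<close> by simp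
  qed
qed

text \<open>Each move transfers goodness backwards along the list. The end of the chain is a smaller
  modulus at the trace m or a trace settled earlier; e stays positive because norms are odd.\<close>

lemma chain_sound:
  assumes "chain m b vs n c d p" "(c, d, n) \<in> CS_triples" "0 < d"
    and low: "\<And>c d p. 0 < d \<Longrightarrow> d < b \<Longrightarrow> (c, d, m) \<in> CS_triples \<Longrightarrow> std_good p c d m"
    and kn: "\<And>n. known_trace m n \<Longrightarrow> all_good n"
  shows "std_good p c d n"
  using assms(1-3)
proof (induction vs arbitrary: n c d p)
  case Nil
  show ?case
  proof (cases "n = m")
    case True
    then show ?thesis using low Nil by simp
  next
    case False
    then have "p" "all_good n" using Nil kn by (auto split: if_splits)
    then show ?thesis using CS_Xmat[OF Nil(2)] by (simp add: std_good_def all_good_def)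
  qed
next
  case (Cons v vs)
  show ?case
  proof (cases v)
    case (Shift n')
    then have p: p and dv: "d dvd n' - n" and pt: "chain m b vs n' c d p"
      using Cons.prems(1) by (auto split: if_splits simp: mod_eq_0_iff_dvd)
    have "std_good True c d n'" using Cons.IH[OF pt triple_shift[OF Cons.prems(2) dv] Cons.prems(3)] p by simp
    then show ?thesis using good_shift[OF Cons.prems(2) dv] p by (simp add: std_good_def)
  next
    case (Turn k x c')
    define e where "e = \<bar>gval n k x\<bar> div d"
    have cop: "coprime k x" and dv: "d dvd x * c - k" and e: "e * d = \<bar>gval n k x\<bar>"
      and dv': "e dvd x * c' - k" and pt: "chain m b vs n c' e (\<not> p)"
      using Cons.prems(1) Turn by (auto split: if_splits simp: mod_eq_0_iff_dvd coprime_iff_gcd_eq_1 Let_def e_def)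
    have "e * d \<noteq> 0" unfolding e using gval_odd[OF cop, of n] by auto
    moreover have "0 \<le> e * d" unfolding e by simp
    ultimately have e0: "0 < e" using Cons.prems(3) by (simp add: zero_le_mult_iff)
    have "\<bar>gval n k x\<bar> = \<bar>e * d\<bar>" using e by simp
    note t = turn[OF Cons.prems(2) cop dv this dv']
    show ?thesis using Cons.IH[OF pt t(1) e0] t(2) by blast
  qed
qed

lemma lookup_chains_sound:
  assumes "lookup_chains n b d ts n c" "(c, d, n) \<in> CS_triples" "0 < d"
    and "\<And>c d p. 0 < d \<Longrightarrow> d < b \<Longrightarrow> (c, d, n) \<in> CS_triples \<Longrightarrow> std_good p c d n"
    and "\<And>m. known_trace n m \<Longrightarrow> all_good m"
  shows "std_good p c d n"
  using assms(1)
proof (induction ts)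
  case (Cons t ts)
  obtain n' c' ps qs where t: "t = (n', c', ps, qs)" by (metis surj_pair)
  show ?case
  proof (cases "n = n' \<and> c = c'")
    case True
    then have "chain n b ps n c d True" "chain n b qs n c d False"
      using Cons.prems by (auto simp: t split: if_splits)
    then have "chain n b (if p then ps else qs) n c d p" by simp
    then show ?thesis by (rule chain_sound[OF _ assms(2-5)])
  next
    case False
    then show ?thesis using Cons by (auto simp: t split: if_splits)
  qed
qed simp

lemma nc_try_sound:
  assumes "nc_try n s g x k"
  obtains e where "norm_bound n (g * e)" "coprime e g" "coprime k x" "e * s = \<bar>gval n k x\<bar>"
  using assms that[of "\<bar>gval n k x\<bar> div s"]
  by (auto simp: nc_try_def nc_check_def coprime_iff_gcd_eq_1 split: if_splits)

lemma nc_search_sound: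
  assumes "nc_search n t s g x r" "s dvd x * t - r"
  shows "\<exists>x k e. norm_bound n (g * e) \<and> coprime e g \<and> coprime k x \<and> e * s = \<bar>gval n k x\<bar> \<and> s dvd x * t - k"
  using assms
proof (induction n t s g x r rule: nc_search.induct)
  case (1 n t s g x r)
  consider k where "nc_try n s g x k" "k = r \<or> k = r - s \<or> k = r + s \<or> k = r + 2 * s"
    | "nc_search n t s g (x + 1) (sub_if_ge s (r + t))" "\<not> 8 < x" "\<not> nc_try n s g x r" "\<not> nc_try n s g x (r - s)"
      "\<not> nc_try n s g x (r + s)" "\<not> nc_try n s g x (r + 2 * s)"
    using 1(2) by (subst (asm) nc_search.simps) (auto split: if_splits)
  then show ?case
  proof cases
    case (1 k)
    have "s dvd r - k" using 1(2) by (elim disjE) simp_all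
    then have "s dvd (x * t - r) + (r - k)" using \<open>s dvd x * t - r\<close> by (intro dvd_add)
    then have "s dvd x * t - k" by simp
    then show ?thesis using nc_try_sound[OF 1(1)] by metis
  next
    case 2
    have "(x + 1) * t - sub_if_ge s (r + t) = (x * t - r) + (if r + t < s then 0 else s)"
      by (simp add: sub_if_ge_def algebra_simps)
    moreover have "s dvd (x * t - r) + (if r + t < s then 0 else s)"
      using \<open>s dvd x * t - r\<close> by (rule dvd_add) simp
    ultimately have "s dvd (x + 1) * t - sub_if_ge s (r + t)" by (simp only:)
    then show ?thesis using 1(1)[OF 2(2-6) 2(1)] by blast
  qed
qed

lemma nc_roots_sound:
  assumes "nc_roots n b d e c w j" "0 \<le> i" "i < j" "d dvd gval n (c + e * i) 1"
  shows "lookup_chains n b d w n (c + e * i)"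
  using assms
proof (induction n b d e c w j arbitrary: i rule: nc_roots.induct)
  case (1 n b d e c w j)
  have j: "\<not> j \<le> 0" using 1 by simp
  show ?case
  proof (cases "i = 0")
    case True
    then show ?thesis using 1(3,6) j by (subst (asm) nc_roots.simps) (auto split: if_splits)
  next
    case False
    have N: "nc_roots n b d e (c + e) w (j - 1)" using 1(3) j by (subst (asm) nc_roots.simps) (auto split: if_splits)
    have eq: "c + e + e * (i - 1) = c + e * i" by (simp add: algebra_simps)
    have "d dvd gval n (c + e + e * (i - 1)) 1" unfolding eq by (rule 1(6))
    then have "lookup_chains n b d w n (c + e + e * (i - 1))"
      using 1(1)[OF j _ _ N, of "i - 1"] 1(2)[OF j _ N, of "i - 1"] 1(3-5) False j
      by (subst (asm) (1) nc_roots.simps) (cases "gval n c 1 mod d = 0"; simp split: if_splits)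
    then show ?thesis unfolding eq .
  qed
qed

text \<open>What a Hessenberg form with content g requires: one covector of index g e whose triple
  is good for both flags. The root is quantified over all c compatible with k/x modulo e, since its
  residue modulo g is not controlled.\<close>

definition nc_ok :: "int \<Rightarrow> int \<Rightarrow> int \<Rightarrow> int \<Rightarrow> bool" where
  "nc_ok n t s g \<longleftrightarrow> (\<exists>x k e. coprime e g \<and> coprime k x \<and> e * s = \<bar>gval n k x\<bar> \<and> s dvd x * t - k \<and>
     (\<forall>c p. (c, g * e, n) \<in> CS_triples \<longrightarrow> e dvd x * c - k \<longrightarrow> std_good p c (g * e) n))"

lemma nc_lookup_sound:
  assumes "nc_lookup n t s g tb" "0 < s" "0 < g"
    and low: "\<And>b c d p. norm_bound n b \<Longrightarrow> 0 < d \<Longrightarrow> d \<le> b \<Longrightarrow> (c, d, n) \<in> CS_triples \<Longrightarrow> std_good p c d n"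
    and kn: "\<And>m. known_trace n m \<Longrightarrow> all_good m"
  shows "nc_ok n t s g"
  using assms(1)
proof (induction tb)
  case (Cons q qs)
  obtain n' t' g' k x c b w where q: "q = (n', t', g', k, x, c, b, w)" by (metis surj_pair)
  show ?case
  proof (cases "n = n' \<and> t = t' \<and> g = g'")
    case True
    define e where "e = \<bar>gval n k x\<bar> div s"
    have st: "s dvd x * t - k" and ce: "nc_entry n s g k x c b w e"
      using Cons.prems True by (auto simp: q e_def mod_eq_0_iff_dvd split: if_splits)
    have e: "e * s = \<bar>gval n k x\<bar>" "coprime k x" "coprime e g" "e dvd x * c - k" "norm_bound n (b - 1)"
      "nc_roots n b (g * e) e c w g"
      using ce by (auto simp: nc_entry_def mod_eq_0_iff_dvd coprime_iff_gcd_eq_1 split: if_splits)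
    have "e * s \<noteq> 0" unfolding e using gval_odd[OF e(2), of n] by auto
    moreover have "0 \<le> e * s" unfolding e by simp
    ultimately have e0: "0 < e" using assms(2) by (simp add: zero_le_mult_iff)
    have "e dvd gval n k x" using e(1) by (metis dvd_abs_iff dvd_triv_left)
    then have cop: "coprime e x" by (rule coprime_gval[OF e(2)])
    have "std_good p c' (g * e) n" if c': "(c', g * e, n) \<in> CS_triples" "e dvd x * c' - k" for c' p
    proof -
      have "e dvd (x * c' - k) - (x * c - k)" using c'(2) e(4) by (rule dvd_diff)
      then have "e dvd x * (c' - c)" by (simp add: algebra_simps)
      then have "e dvd c' - c" using cop by (simp add: coprime_dvd_mult_right_iff)
      then obtain i where i: "c' - c = e * i" by blast
      \<comment> \<open>Among the lifts c + e i only i modulo g matters, because the modulus is g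
        e.\<close>
      define j where "j = i mod g"
      have j: "0 \<le> j" "j < g" using assms(3) by (auto simp: j_def)
      have "c' = (c + e * j) + g * e * (i div g)"
        using i mod_mult_div_eq[of i g] unfolding j_def by (metis (no_types, opaque_lifting) add.assoc add.commute diff_add_cancel distrib_left mult.assoc mult.commute)
      then have dv: "g * e dvd (c + e * j) - c'" by simp
      note sh = Xmat_shift[OF c'(1) dv]
      have "g * e dvd gval n (c + e * j) 1" using sh(1) by (simp add: CS_triples_def gval_1)
      then have "lookup_chains n b (g * e) w n (c + e * j)" by (rule nc_roots_sound[OF e(6) j])
      then have "std_good p (c + e * j) (g * e) n"
      proof (rule lookup_chains_sound[OF _ sh(1)])
        show "0 < g * e" using e0 assms(3) by simp
        show "std_good p c d n" if "0 < d" "d < b" "(c, d, n) \<in> CS_triples" for c d p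
          using low[OF e(5) that(1) _ that(3)] that(2) by simp
      qed (rule kn)
      then show ?thesis using std_good_similar[OF sh(2)] by simp
    qed
    then show ?thesis unfolding nc_ok_def using e st by blast
  next
    case False
    then show ?thesis using Cons by (auto simp: q split: if_splits)
  qed
qed simp

lemma nc_loop_sound:
  assumes "nc_loop n t s tb g0" "0 < s" "0 < g0" "g0 \<le> g" "even (g - g0)" "norm_bound n (g * g * s)"
    and low: "\<And>b c d p. norm_bound n b \<Longrightarrow> 0 < d \<Longrightarrow> d \<le> b \<Longrightarrow> (c, d, n) \<in> CS_triples \<Longrightarrow> std_good p c d n"
    and kn: "\<And>m. known_trace n m \<Longrightarrow> all_good m"
  shows "nc_ok n t s g"
  using assms
proof (induction n t s tb g0 rule: nc_loop.induct)
  case (1 n t s tb g0)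
  \<comment> \<open>The loop stops only once the bound fails; as it holds for the larger g, it has
    not failed at \<open>g0\<close>.\<close>
  have "g0 * g0 \<le> g * g" using 1(5,6) by (intro mult_mono) auto
  then have "g0 * g0 * s \<le> g * g * s" using 1(4) by (intro mult_right_mono) auto
  then have b0: "norm_bound n (g0 * g0 * s)" by (rule norm_bound_mono[OF 1(8)])
  have g99: "\<not> 99 < g0" and or: "nc_search n t s g0 1 t \<or> \<not> nc_search n t s g0 1 t \<and> nc_lookup n t s g0 tb"
    and rest: "nc_loop n t s tb (g0 + 2)"
    using 1(3) b0 by (subst (asm) nc_loop.simps, auto split: if_splits)+
  show ?case
  proof (cases "g = g0")
    case True
    show ?thesis
    proof (cases "nc_search n t s g0 1 t")
      case tr: True
      obtain x k e where e: "norm_bound n (g * e)" "coprime e g" "coprime k x" "e * s = \<bar>gval n k x\<bar>" "s dvd x * t - k"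
        using nc_search_sound[OF tr] True by auto
      have "e * s \<noteq> 0" unfolding e using gval_odd[OF e(3), of n] by auto
      moreover have "0 \<le> e * s" unfolding e by simp
      ultimately have "0 < e" using 1(4) by (simp add: zero_le_mult_iff)
      then have "0 < g * e" using 1(5,6) by simp
      then show ?thesis unfolding nc_ok_def using e 1(9)[OF e(1)] by blast
    next
      case False
      then have "nc_lookup n t s g tb" using or True by simp
      then show ?thesis by (rule nc_lookup_sound[OF _ _ _ 1(9,10)]) (use 1(4-6) in auto)
    qed
  next
    case False
    then have g2: "g0 + 2 \<le> g" "even (g - (g0 + 2))" using 1(6,7) by presburger+
    show ?thesis
      using or 1(1)[OF b0 g99 _ rest 1(4) _ g2 1(8-10)] 1(2)[OF b0 g99 _ _ rest 1(4) _ g2 1(8-10)] 1(5) by auto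
  qed
qed

section \<open>From checked tables to all odd norms\<close>

definition scanned :: "int \<Rightarrow> bool" where
  "scanned d \<longleftrightarrow> (\<exists>tbl tb. \<forall>c n. admissible n \<longrightarrow> norm_bound n d \<longrightarrow> 0 \<le> c \<longrightarrow> c < d \<longrightarrow> d dvd fpoly n c \<longrightarrow>
     nc_loop n c d tb 3 \<and> (descends d (d * d) n c 1 c \<or> lookup_chains n d d tbl n c))"

lemma check_nodes_sound:
  "check_nodes d tbl tb qs \<Longrightarrow> (c, n) \<in> set qs \<Longrightarrow> admissible n \<Longrightarrow>
    nc_loop n c d tb 3 \<and> (descends d (d * d) n c 1 c \<or> lookup_chains n d d tbl n c)"
  by (induction qs) (auto split: if_splits)

lemma check_norm_sound:
  assumes "check_norm d p lo tbl tb" "0 < d"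
  shows "scanned d"
proof -
  have p: "0 < p" "p dvd d" "lo \<le> 3 \<or> \<not> norm_bound (lo - 1) d" "check_nodes d tbl tb (root_candidates p d lo)"
    using assms by (auto simp: check_norm_def mod_eq_0_iff_dvd split: if_splits)
  have "(c, n) \<in> set (root_candidates p d lo)"
    if "admissible n" "norm_bound n d" "0 \<le> c" "c < d" "d dvd fpoly n c" for c n
  proof (rule root_candidates_mem[OF assms(2) p(1,2)])
    show "lo \<le> n"
    proof (rule ccontr)
      assume "\<not> lo \<le> n"
      then have "norm_bound (lo - 1) d" "3 < lo"
        using norm_bound_mono_trace[OF that(2)] admissible_bounds[OF that(1)] by auto
      then show False using p(3) by simp
    qed
  qed (use that admissible_bounds in \<open>auto simp: gval_1\<close>)
  then show ?thesis unfolding scanned_def using check_nodes_sound[OF p(4)] by blast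
qed

lemma check_norms_sound:
  assumes "check_norms a b ts" "0 < a" "odd a" "odd d" "a \<le> d" "d < b"
  shows "scanned d"
  using assms
proof (induction ts arbitrary: a)
  case (Cons t ts)
  obtain p lo tbl tb where t: "t = (p, lo, tbl, tb)" by (metis surj_pair)
  have s: "check_norm a p lo tbl tb" "check_norms (a + 2) b ts" using Cons.prems(1) by (auto simp: t split: if_splits)
  show ?case
  proof (cases "d = a")
    case True
    then show ?thesis using check_norm_sound[OF s(1)] Cons.prems(2) by simp
  next
    case False
    then have "a + 2 \<le> d" using Cons.prems by presburger
    then show ?thesis using Cons.IH[OF s(2)] Cons.prems by simp
  qed
qed simp

text \<open>The difference of x^3 f_n(c) and x^3 f_n(k/x) is divisible by x c - k.\<close>

lemma dvd_gval:
  assumes "d dvd x * c - k" "d dvd fpoly n c" shows "d dvd gval n k x"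
proof -
  have "gval n k x = x * (x * x) * fpoly n c - (x * c - k) *
    (k*k + k*(x*c) + (x*c)*(x*c) - n*x*(k + x*c) + (n - 1)*x*x)"
    unfolding gval_def fpoly_eq by (simp add: algebra_simps)
  then show ?thesis using assms by simp
qed


definition scanned_below :: "int \<Rightarrow> bool" where
  "scanned_below b \<longleftrightarrow> (\<forall>d. 3 \<le> d \<longrightarrow> odd d \<longrightarrow> d < b \<longrightarrow> scanned d)"

lemma scanned_below_extend:
  assumes "scanned_below a" "check_norms a b ts" "0 < a" "odd a"
  shows "scanned_below b"
  unfolding scanned_below_def
proof (intro allI impI)
  fix d assume d: "3 \<le> d" "odd d" "d < b"
  show "scanned d"
  proof (cases "d < a")
    case False
    then show ?thesis using check_norms_sound[OF assms(2-4) d(2)] d(3) by simp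
  qed (use assms(1) d in \<open>simp add: scanned_below_def\<close>)
qed

section \<open>The certificates for all norms\<close>

text \<open>
  One entry for each odd norm: the modulus \<open>p\<close> used to find the roots (the least prime factor of \<open>d\<close>,
  or 1 if \<open>d\<close> is prime), the least trace for which the norm bound admits \<open>d\<close>, the chains
  \<open>(n, c, standard, transposed)\<close> for the triples that \<open>descends\<close> does not settle, and the entries
  for the columns of content at least 3 that \<open>nc_search\<close> does not settle.
\<close>

lemma check_norms_3:
  "check_norms 3 29 [
  (1, 3, [(10, 2, [Shift 7], [Turn 1 2 2, Shift 7]), (13, 2, [Shift 10], [Turn 1 2 3, Shift 8]), (16, 2,
  [Shift 13], [Turn 1 2 4, Shift 9]), (19, 2, [Shift 16], [Turn 1 2 5, Shift 10]), (22, 2, [Shift 19], [Turn 1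
  2 6, Shift 11]), (25, 2, [Shift 22], [Turn 1 2 7, Shift 12]), (28, 2, [Shift 25], [Turn 1 2 8, Shift 13]),
  (31, 2, [Shift 28], [Turn 1 2 9, Shift 14]), (34, 2, [Shift 31], [Turn 1 2 10, Shift 15]), (37, 2, [Shift
  34], [Turn 1 2 11, Shift 16]), (40, 2, [Shift 37], [Turn 1 2 12, Shift 17]), (43, 2, [Shift 40], [Turn 1 2
  13, Shift 18]), (46, 2, [Shift 43], [Turn 1 2 14, Shift 19]), (49, 2, [Shift 46], [Turn 1 2 15, Shift 20]),
  (52, 2, [Shift 49], [Turn 1 2 16, Shift 21]), (55, 2, [Shift 52], [Turn 1 2 17, Shift 22]), (58, 2, [Shift
  55], [Turn 1 2 18, Shift 23]), (61, 2, [Shift 58], [Turn 1 2 19, Shift 24]), (64, 2, [Shift 61], [Turn 1 2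
  20, Shift 25]), (67, 2, [Shift 64], [Turn 1 2 21, Shift 26])], []), (1, 9, [(12, 4, [Shift 7], [Turn (-1) 1
  4, Shift 7]), (15, 2, [Shift 10], [Turn 2 1 2, Shift 10]), (17, 4, [Shift 12], [Turn (-1) 1 6, Shift 10]),
  (18, 3, [Shift 13], [Turn 1 2 3, Shift 13]), (20, 2, [Shift 15], [Turn 2 1 2, Shift 13]), (22, 4, [Shift
  17], [Turn (-1) 1 8, Shift 13]), (23, 3, [Shift 18], [Turn 1 2 4, Shift 16]), (25, 2, [Shift 20], [Turn 2 1
  2, Shift 16]), (27, 4, [Shift 22], [Turn (-1) 1 10, Shift 16]), (28, 3, [Shift 23], [Turn 1 2 5, Shift 19]),
  (30, 2, [Shift 25], [Turn 2 1 2, Shift 19]), (32, 4, [Shift 27], [Turn (-1) 1 12, Shift 19]), (33, 3, [Shift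
  28], [Turn 1 2 6, Shift 22]), (35, 2, [Shift 30], [Turn 2 1 2, Shift 22]), (37, 4, [Shift 32], [Turn (-1) 1
  14, Shift 22]), (38, 3, [Shift 33], [Turn 1 2 7, Shift 25]), (40, 2, [Shift 35], [Turn 2 1 2, Shift 25]),
  (42, 4, [Shift 37], [Turn (-1) 1 16, Shift 25]), (43, 3, [Shift 38], [Turn 1 2 8, Shift 28]), (45, 2, [Shift
  40], [Turn 2 1 2, Shift 28]), (47, 4, [Shift 42], [Turn (-1) 1 18, Shift 28]), (48, 3, [Shift 43], [Turn 1 2
  9, Shift 31]), (50, 2, [Shift 45], [Turn 2 1 2, Shift 31]), (52, 4, [Shift 47], [Turn (-1) 1 20, Shift 31]),
  (53, 3, [Shift 48], [Turn 1 2 10, Shift 34]), (55, 2, [Shift 50], [Turn 2 1 2, Shift 34]), (57, 4, [Shift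
  52], [Turn (-1) 1 22, Shift 34]), (58, 3, [Shift 53], [Turn 1 2 11, Shift 37]), (60, 2, [Shift 55], [Turn 2
  1 2, Shift 37]), (62, 4, [Shift 57], [Turn (-1) 1 24, Shift 37]), (63, 3, [Shift 58], [Turn 1 2 12, Shift
  40]), (65, 2, [Shift 60], [Turn 2 1 2, Shift 40]), (67, 4, [Shift 62], [Turn (-1) 1 26, Shift 40]), (68, 3,
  [Shift 63], [Turn 1 2 13, Shift 43]), (72, 4, [Shift 67], [Turn (-1) 1 28, Shift 43]), (78, 3, [Shift 68],
  [Turn 1 2 15, Shift 49])], [(22, 4, 3, 2, 3, 7, 56, [(22, 26, [Turn 1 11 14], [Turn 1 11 14])]), (37, 4, 5,
  2, 3, 13, 176, [(37, 124, [Turn 2 3 0], [Turn 2 3 0])]), (52, 4, 7, 2, 3, 19, 363, [(52, 349, [Turn 3 32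
  62], [Turn 3 32 62])]), (55, 2, 7, 1, 3, 20, 408, [(55, 79, [Turn (-18) 5 112], [Turn (-18) 5 112])]), (55,
  2, 9, 1, 3, 20, 408, [(55, 374, [Turn 23 10 266], [Turn 23 10 266])]), (58, 3, 9, 3, 1, 3, 456, [(58, 458,
  [Turn 31 32 29], [Turn 31 32 29])]), (67, 4, 9, 2, 3, 25, 616, [(67, 98, [Turn 29 7 365], [Turn 29 7
  365])])]), (1, 10, [(14, 5, [Shift 7], [Turn 1 3 5, Shift 7]), (19, 3, [Shift 12], [Turn 2 3 8, Shift 8]),
  (21, 5, [Shift 14], [Turn 1 3 9, Shift 8]), (24, 6, [Shift 17], [Turn (-1) 1 6, Shift 17]), (26, 3, [Shift
  19], [Turn 2 3 12, Shift 9]), (27, 2, [Shift 20], [Turn 2 1 2, Shift 20]), (28, 5, [Shift 21], [Turn 1 3 13,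
  Shift 9]), (30, 4, [Shift 23], [Turn 1 2 4, Shift 23]), (31, 6, [Shift 24], [Turn (-1) 1 8, Shift 22]), (33,
  3, [Shift 26], [Turn 2 3 16, Shift 10]), (34, 2, [Shift 27], [Turn 2 1 2, Shift 25]), (35, 5, [Shift 28],
  [Turn 1 3 17, Shift 10]), (37, 4, [Shift 30], [Turn 1 2 5, Shift 28]), (38, 6, [Shift 31], [Turn (-1) 1 10,
  Shift 27]), (40, 3, [Shift 33], [Turn 2 3 20, Shift 11]), (41, 2, [Shift 34], [Turn 2 1 2, Shift 30]), (42,
  5, [Shift 35], [Turn 1 3 21, Shift 11]), (44, 4, [Shift 37], [Turn 1 2 6, Shift 33]), (45, 6, [Shift 38],
  [Turn (-1) 1 12, Shift 32]), (47, 3, [Shift 40], [Turn 2 3 24, Shift 12]), (48, 2, [Shift 41], [Turn 2 1 2,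
  Shift 35]), (49, 5, [Shift 42], [Turn 1 3 25, Shift 12]), (51, 4, [Shift 44], [Turn 1 2 7, Shift 38]), (52,
  6, [Shift 45], [Turn (-1) 1 14, Shift 37]), (54, 3, [Shift 47], [Turn 2 3 28, Shift 13]), (55, 2, [Shift
  48], [Turn 2 1 2, Shift 40]), (56, 5, [Shift 49], [Turn 1 3 29, Shift 13]), (58, 4, [Shift 51], [Turn 1 2 8,
  Shift 43]), (59, 6, [Shift 52], [Turn (-1) 1 16, Shift 42]), (61, 3, [Shift 54], [Turn 2 3 32, Shift 14]),
  (62, 2, [Shift 55], [Turn 2 1 2, Shift 45]), (63, 5, [Shift 56], [Turn 1 3 33, Shift 14]), (65, 4, [Shift
  58], [Turn 1 2 9, Shift 48]), (66, 6, [Shift 59], [Turn (-1) 1 18, Shift 47]), (68, 3, [Shift 61], [Turn 2 3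
  36, Shift 15]), (69, 2, [Shift 62], [Turn 2 1 2, Shift 50]), (72, 4, [Shift 65], [Turn 1 2 10, Shift 53])],
  [(31, 6, 3, 3, 4, 11, 120, [(31, 11, [Turn 11 1 11], [Turn 11 1 11])]), (52, 6, 5, 3, 4, 20, 363, [(52, 174,
  [Turn 4 31 59, Turn 59 1 59], [Turn 4 31 59, Turn 59 1 59])]), (55, 2, 5, 1, 4, 21, 408, [(55, 187, [Turn 28
  29 32], [Turn 28 29 32])])]), (3, 11, [(40, 8, [Shift 31], [Turn (-1) 1 8, Shift 31]), (43, 2, [Shift 34],
  [Turn 2 1 2, Shift 34]), (46, 5, [Shift 37], [Turn 1 2 5, Shift 37]), (49, 8, [Shift 40], [Turn (-1) 1 10,
  Shift 38]), (52, 2, [Shift 43], [Turn 2 1 2, Shift 41]), (55, 5, [Shift 46], [Turn 1 2 6, Shift 44]), (58,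
  8, [Shift 49], [Turn (-1) 1 12, Shift 45]), (61, 2, [Shift 52], [Turn 2 1 2, Shift 48]), (64, 5, [Shift 55],
  [Turn 1 2 7, Shift 51]), (67, 8, [Shift 58], [Turn (-1) 1 14, Shift 52])], [(40, 8, 3, 4, 5, 15, 208, [(40,
  86, [Turn 4 5 2], [Turn 4 5 2])]), (67, 8, 5, 4, 5, 27, 616, [(67, 289, [Turn 1 34 39], [Turn 1 34 39])])]),
  (1, 12, [(19, 9, [Shift 8], [Turn (-2) 1 9, Shift 8]), (23, 5, [Shift 12], [Turn (-1) 2 6, Shift 10]), (24,
  3, [Shift 13], [Turn 3 1 3, Shift 13]), (25, 7, [Shift 14], [Turn 3 2 8, Shift 12]), (26, 4, [Shift 15],
  [Turn 1 3 4, Shift 15]), (30, 8, [Shift 19], [Turn 2 3 5, Shift 17]), (30, 9, [Shift 19], [Turn (-2) 1 15,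
  Shift 13]), (34, 5, [Shift 23], [Turn (-1) 2 9, Shift 15]), (35, 3, [Shift 24], [Turn 3 1 3, Shift 18]),
  (36, 7, [Shift 25], [Turn 3 2 11, Shift 17]), (37, 4, [Shift 26], [Turn 1 3 6, Shift 20]), (41, 8, [Shift
  30], [Turn 2 3 7, Shift 22]), (41, 9, [Shift 30], [Turn (-2) 1 21, Shift 18]), (45, 5, [Shift 34], [Turn
  (-1) 2 12, Shift 20]), (46, 3, [Shift 35], [Turn 3 1 3, Shift 23]), (47, 7, [Shift 36], [Turn 3 2 14, Shift
  22]), (48, 4, [Shift 37], [Turn 1 3 8, Shift 25]), (52, 8, [Shift 41], [Turn 2 3 9, Shift 27]), (52, 9,
  [Shift 41], [Turn (-2) 1 27, Shift 23]), (56, 5, [Shift 45], [Turn (-1) 2 15, Shift 25]), (57, 3, [Shift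
  46], [Turn 3 1 3, Shift 28]), (58, 7, [Shift 47], [Turn 3 2 17, Shift 27]), (59, 4, [Shift 48], [Turn 1 3
  10, Shift 30]), (60, 10, [Shift 49], [Turn (-1) 1 10, Shift 49]), (63, 2, [Shift 52], [Turn 2 1 2, Shift
  52]), (63, 8, [Shift 52], [Turn 2 3 11, Shift 32]), (63, 9, [Shift 52], [Turn (-2) 1 33, Shift 28]), (66, 6,
  [Shift 55], [Turn 1 2 6, Shift 55]), (67, 5, [Shift 56], [Turn (-1) 2 18, Shift 30]), (68, 3, [Shift 57],
  [Turn 3 1 3, Shift 33]), (69, 7, [Shift 58], [Turn 3 2 20, Shift 32]), (71, 10, [Shift 60], [Turn (-1) 1 12,
  Shift 58]), (74, 2, [Shift 63], [Turn 2 1 2, Shift 61]), (74, 8, [Shift 63], [Turn 2 3 13, Shift 37]), (74,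
  9, [Shift 63], [Turn (-2) 1 39, Shift 33]), (78, 5, [Shift 67], [Turn (-1) 2 21, Shift 35])], [(49, 10, 3,
  5, 6, 19, 320, [(49, 128, [Turn 1 23 29], [Turn 1 23 29])])]), (1, 13, [(25, 10, [Shift 12], [Turn 1 4 13,
  Shift 8]), (27, 11, [Shift 14], [Turn (-2) 1 11, Shift 14]), (32, 3, [Shift 19], [Turn 3 1 3, Shift 19]),
  (32, 4, [Shift 19], [Turn 3 4 18, Shift 9]), (34, 9, [Shift 21], [Turn 1 3 9, Shift 21]), (36, 6, [Shift
  23], [Turn (-1) 2 8, Shift 19]), (38, 8, [Shift 25], [Turn 3 2 10, Shift 21]), (38, 10, [Shift 25], [Turn 1
  4 22, Shift 9]), (40, 11, [Shift 27], [Turn (-2) 1 17, Shift 21]), (43, 5, [Shift 30], [Turn 2 3 12, Shift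
  26]), (45, 3, [Shift 32], [Turn 3 1 3, Shift 26]), (45, 4, [Shift 32], [Turn 3 4 27, Shift 10]), (47, 9,
  [Shift 34], [Turn 1 3 13, Shift 28]), (49, 6, [Shift 36], [Turn (-1) 2 11, Shift 26]), (51, 8, [Shift 38],
  [Turn 3 2 13, Shift 28]), (51, 10, [Shift 38], [Turn 1 4 31, Shift 10]), (53, 11, [Shift 40], [Turn (-2) 1
  23, Shift 28]), (56, 5, [Shift 43], [Turn 2 3 16, Shift 33]), (58, 3, [Shift 45], [Turn 3 1 3, Shift 33]),
  (58, 4, [Shift 45], [Turn 3 4 36, Shift 11]), (60, 9, [Shift 47], [Turn 1 3 17, Shift 35]), (62, 6, [Shift
  49], [Turn (-1) 2 14, Shift 33]), (64, 8, [Shift 51], [Turn 3 2 16, Shift 35]), (64, 10, [Shift 51], [Turn 1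
  4 40, Shift 11]), (66, 11, [Shift 53], [Turn (-2) 1 29, Shift 35]), (69, 5, [Shift 56], [Turn 2 3 20, Shift
  40]), (71, 3, [Shift 58], [Turn 3 1 3, Shift 40]), (71, 4, [Shift 58], [Turn 3 4 45, Shift 12])], [(53, 11,
  5, 5, 4, 22, 378, [(53, 188, [Turn (-7) 11 97], [Turn (-7) 11 97])]), (58, 3, 5, (-1), 4, 23, 456, [(58, 23,
  [Turn 23 1 23], [Turn 23 1 23])]), (58, 12, 3, 6, 7, 23, 456, [(58, 23, [Turn 23 1 23], [Turn 23 1 23])])]),
  (3, 13, [], [(67, 14, 3, 7, 8, 27, 616, [(67, 236, [Turn 7 8 4], [Turn 7 8 4])])]), (1, 14, [(22, 14, [Shift
  5], [Turn (-3) 1 14, Shift 5]), (27, 7, [Shift 10], [Turn 4 3 14, Shift 8]), (29, 4, [Shift 12], [Turn 4 1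
  4, Shift 12]), (31, 11, [Shift 14], [Turn (-1) 3 15, Shift 8]), (34, 5, [Shift 17], [Turn 3 4 15, Shift
  15]), (39, 14, [Shift 22], [Turn (-3) 1 26, Shift 10]), (42, 13, [Shift 25], [Turn 1 4 19, Shift 17]), (44,
  7, [Shift 27], [Turn 4 3 22, Shift 13]), (46, 4, [Shift 29], [Turn 4 1 4, Shift 17]), (47, 15, [Shift 30],
  [Turn (-2) 1 15, Shift 30]), (48, 11, [Shift 31], [Turn (-1) 3 23, Shift 13]), (51, 5, [Shift 34], [Turn 3 4
  24, Shift 20]), (52, 3, [Shift 35], [Turn 3 1 3, Shift 35]), (53, 8, [Shift 36], [Turn (-1) 2 9, Shift 34]),
  (54, 6, [Shift 37], [Turn 1 3 6, Shift 37]), (55, 10, [Shift 38], [Turn 3 2 11, Shift 36]), (56, 14, [Shift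
  39], [Turn (-3) 1 38, Shift 15]), (59, 13, [Shift 42], [Turn 1 4 28, Shift 22]), (60, 12, [Shift 43], [Turn
  2 3 7, Shift 41]), (61, 7, [Shift 44], [Turn 4 3 30, Shift 18]), (63, 4, [Shift 46], [Turn 4 1 4, Shift
  22]), (64, 15, [Shift 47], [Turn (-2) 1 21, Shift 41]), (65, 11, [Shift 48], [Turn (-1) 3 31, Shift 18]),
  (68, 5, [Shift 51], [Turn 3 4 33, Shift 25]), (69, 3, [Shift 52], [Turn 3 1 3, Shift 46]), (71, 6, [Shift
  54], [Turn 1 3 8, Shift 48]), (72, 10, [Shift 55], [Turn 3 2 14, Shift 47]), (78, 7, [Shift 61], [Turn 4 3
  38, Shift 23])], []), (1, 14, [(28, 16, [Shift 9], [Turn (-3) 1 16, Shift 9]), (29, 8, [Shift 10], [Turn 27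
  1 27, Shift (-8)]), (33, 12, [Shift 14], [Turn 3 5 35, Shift (-10)]), (35, 4, [Shift 16], [Turn 4 1 4, Shift
  16]), (38, 6, [Shift 19], [Turn (-1) 3 8, Shift 13]), (43, 5, [Shift 24], [Turn 1 4 6, Shift 20]), (46, 14,
  [Shift 27], [Turn 4 3 11, Shift 17]), (47, 16, [Shift 28], [Turn (-3) 1 28, Shift 16]), (48, 8, [Shift 29],
  [Turn 2 5 54, Shift (-19)]), (52, 12, [Shift 33], [Turn 3 5 59, Shift (-21)]), (53, 15, [Shift 34], [Turn 3
  4 8, Shift 24]), (54, 4, [Shift 35], [Turn 4 1 4, Shift 23]), (57, 6, [Shift 38], [Turn (-1) 3 12, Shift
  20]), (59, 17, [Shift 40], [Turn (-2) 1 17, Shift 40]), (62, 5, [Shift 43], [Turn 1 4 9, Shift 27]), (64, 3,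
  [Shift 45], [Turn 3 1 3, Shift 45]), (65, 14, [Shift 46], [Turn 4 3 15, Shift 24]), (66, 13, [Shift 47],
  [Turn 1 3 13, Shift 47]), (66, 16, [Shift 47], [Turn (-3) 1 40, Shift 23]), (67, 8, [Shift 48], [Turn 2 5
  78, Shift (-30)]), (71, 12, [Shift 52], [Turn 3 5 83, Shift (-32)]), (72, 9, [Shift 53], [Turn (-1) 2 11,
  Shift 49]), (72, 15, [Shift 53], [Turn 3 4 11, Shift 31]), (74, 11, [Shift 55], [Turn 3 2 13, Shift 51]),
  (78, 17, [Shift 59], [Turn (-2) 1 23, Shift 53])], [(78, 17, 5, 7, 6, 31, 844, [(78, 568, [Turn 1 52 56],
  [Turn 1 52 56])])]), (3, 15, [(40, 17, [Shift 19], [Turn 1 5 25, Shift 9]), (49, 5, [Shift 28], [Turn 4 5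
  32, Shift 10]), (61, 17, [Shift 40], [Turn 1 5 41, Shift 10])], []), (1, 16, [(24, 17, [Shift 1], [Turn (-1)
  4 17, Shift 1]), (28, 19, [Shift 5], [Turn (-4) 1 23, Shift 1]), (37, 5, [Shift 14], [Turn 5 1 5, Shift
  10]), (37, 7, [Shift 14], [Turn 5 4 26, Shift 4]), (42, 20, [Shift 19], [Turn (-3) 1 20, Shift 19]), (46,
  10, [Shift 23], [Turn 4 5 14, Shift 13]), (47, 17, [Shift 24], [Turn (-1) 4 32, Shift 4]), (48, 9, [Shift
  25], [Turn 4 3 18, Shift 23]), (49, 4, [Shift 26], [Turn 4 1 4, Shift 26]), (50, 14, [Shift 27], [Turn 1 5
  15, Shift 13]), (51, 19, [Shift 28], [Turn (-4) 1 43, Shift 4]), (54, 15, [Shift 31], [Turn (-1) 3 19, Shift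
  25]), (55, 18, [Shift 32], [Turn 3 4 7, Shift 30]), (60, 5, [Shift 37], [Turn 5 1 5, Shift 13]), (60, 7,
  [Shift 37], [Turn 5 4 41, Shift 7]), (65, 20, [Shift 42], [Turn (-3) 1 32, Shift 30]), (66, 6, [Shift 43],
  [Turn 1 4 8, Shift 35]), (69, 10, [Shift 46], [Turn 4 5 22, Shift 16]), (71, 9, [Shift 48], [Turn 4 3 26,
  Shift 34]), (72, 4, [Shift 49], [Turn 4 1 4, Shift 37]), (74, 19, [Shift 51], [Turn (-4) 1 63, Shift 7]),
  (78, 18, [Shift 55], [Turn 3 4 10, Shift 41])], [(40, 12, 3, 12, 1, 12, 208, [(40, 167, [Turn 13 14 8],
  [Turn 13 14 8])])]), (5, 16, [(50, 22, [Shift 25], [Turn (-3) 1 22, Shift 25]), (57, 4, [Shift 32], [Turn 4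
  1 4, Shift 32]), (63, 8, [Shift 38], [Turn (-1) 3 10, Shift 32]), (67, 19, [Shift 42], [Turn 1 4 22, Shift
  38])], [(43, 13, 3, 13, 1, 13, 243, [(43, 194, [Turn 1 14 2], [Turn 1 14 2])]), (68, 13, 5, 13, 1, 13, 636,
  [(68, 13, [Turn 13 1 3], [Turn 13 1 3])])]), (3, 17, [(34, 20, [Shift 7], [Turn (-1) 4 20, Shift 7]), (49,
  8, [Shift 22], [Turn 5 4 29, Shift 12]), (52, 11, [Shift 25], [Turn 1 5 20, Shift 19]), (55, 23, [Shift 28],
  [Turn (-4) 1 39, Shift 12]), (58, 17, [Shift 31], [Turn 4 5 23, Shift 21]), (61, 20, [Shift 34], [Turn (-1)
  4 35, Shift 14]), (64, 5, [Shift 37], [Turn 5 1 5, Shift 21])], [(46, 14, 3, 14, 1, 14, 280, [(46, 14, [Turn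
  14 1 5], [Turn 14 1 5])])])]"
  by code_simp

lemma check_norms_29:
  "check_norms 29 71 [
  (1, 17, [(35, 13, [Shift 6], [Turn (-3) 2 17, Shift (-2)]), (39, 17, [Shift 10], [Turn 5 2 21, Shift 2]),
  (39, 25, [Shift 10], [Turn (-4) 1 25, Shift 10]), (41, 9, [Shift 12], [Turn (-2) 3 28, Shift (-2)]), (44,
  23, [Shift 15], [Turn 5 4 9, Shift 13]), (48, 5, [Shift 19], [Turn 5 1 5, Shift 19]), (51, 12, [Shift 22],
  [Turn 2 5 38, Shift 4]), (53, 21, [Shift 24], [Turn 5 3 37, Shift 0]), (53, 24, [Shift 24], [Turn 4 5 7,
  Shift 22]), (57, 7, [Shift 28], [Turn (-1) 4 10, Shift 16]), (57, 18, [Shift 28], [Turn 3 5 43, Shift 4]),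
  (64, 6, [Shift 35], [Turn 1 5 8, Shift 25]), (64, 13, [Shift 35], [Turn (-3) 2 32, Shift (-3)]), (68, 17,
  [Shift 39], [Turn 5 2 36, Shift 1]), (68, 25, [Shift 39], [Turn (-4) 1 45, Shift 19]), (68, 26, [Shift 39],
  [Turn (-3) 1 26, Shift 39])], [(46, 2, 3, 1, 15, 14, 280, [(46, 14, [Turn 14 1 5], [Turn 14 1 5])]), (49,
  15, 3, 15, 1, 15, 320, [(49, 254, [Turn 16 17 10], [Turn 16 17 10])]), (78, 15, 5, 15, 1, 15, 844, [(78,
  913, [Turn 31 32 17], [Turn 31 32 17])])]), (1, 18, [(40, 12, [Shift 9], [Turn 5 3 14, Shift 3]), (44, 13,
  [Shift 13], [Turn 3 5 8, Shift 7]), (45, 27, [Shift 14], [Turn (-4) 1 27, Shift 14]), (48, 20, [Shift 17],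
  [Turn (-2) 3 15, Shift 1]), (50, 19, [Shift 19], [Turn 2 5 9, Shift 7]), (54, 5, [Shift 23], [Turn 5 1 5,
  Shift 23]), (54, 14, [Shift 23], [Turn (-3) 2 25, Shift 1]), (58, 18, [Shift 27], [Turn 5 2 29, Shift 5]),
  (58, 23, [Shift 27], [Turn (-1) 4 29, Shift 19]), (59, 26, [Shift 28], [Turn 1 6 41, Shift 10]), (71, 12,
  [Shift 40], [Turn 5 3 24, Shift 4]), (71, 25, [Shift 40], [Turn 1 5 33, Shift 30]), (78, 28, [Shift 47],
  [Turn (-3) 1 28, Shift 47])], [(46, 30, 3, 15, 16, 14, 280, [(46, 14, [Turn 14 1 5], [Turn 14 1 5])]), (49,
  2, 3, 1, 16, 15, 320, [(49, 254, [Turn 16 17 10], [Turn 16 17 10])]), (52, 16, 3, 16, 1, 16, 363, [(52, 287,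
  [Turn 1 17 2], [Turn 1 17 2])])]), (3, 18, [(52, 8, [Shift 19], [Turn (-1) 4 8, Shift 19]), (58, 29, [Shift
  25], [Turn (-4) 1 33, Shift 21]), (67, 5, [Shift 34], [Turn 5 1 5, Shift 30])], [(49, 32, 3, 16, 17, 15,
  320, [(49, 254, [Turn 16 17 10], [Turn 16 17 10])]), (52, 2, 3, 1, 17, 16, 363, [(52, 287, [Turn 1 17 2],
  [Turn 1 17 2])]), (55, 17, 3, 17, 1, 17, 408, [(55, 17, [Turn 17 1 6], [Turn 17 1 6])])]), (5, 18, [], [(52,
  34, 3, 17, 18, 16, 363, [(52, 287, [Turn 1 17 2], [Turn 1 17 2])]), (55, 2, 3, 1, 18, 17, 408, [(55, 17,
  [Turn 17 1 6], [Turn 17 1 6])]), (58, 18, 3, 18, 1, 18, 456, [(58, 359, [Turn 19 20 12], [Turn 19 20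
  12])])]), (1, 19, [(49, 32, [Shift 12], [Turn (-5) 1 38, Shift 6]), (50, 11, [Shift 13], [Turn 48 1 48,
  Shift (-11)]), (50, 24, [Shift 13], [Turn (-2) 3 13, Shift 9]), (54, 31, [Shift 17], [Turn 1 6 31, Shift
  17]), (56, 16, [Shift 19], [Turn 6 5 20, Shift 9]), (60, 6, [Shift 23], [Turn 6 1 6, Shift 17]), (62, 22,
  [Shift 25], [Turn (-1) 5 21, Shift 9]), (66, 9, [Shift 29], [Turn (-1) 4 9, Shift 29]), (66, 27, [Shift 29],
  [Turn 64 1 64, Shift (-43)]), (66, 30, [Shift 29], [Turn 2 5 20, Shift 17]), (67, 7, [Shift 30], [Turn 5 6
  40, Shift 20]), (72, 17, [Shift 35], [Turn (-3) 2 28, Shift 13])], [(55, 36, 3, 18, 19, 17, 408, [(55, 17,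
  [Turn 17 1 6], [Turn 17 1 6])]), (58, 2, 3, 1, 19, 18, 456, [(58, 359, [Turn 19 20 12], [Turn 19 20 12])]),
  (58, 33, 3, 1, 9, 81, 456, [(58, 263, [], [])]), (61, 19, 3, 19, 1, 19, 507, [(61, 398, [Turn 1 20 2], [Turn
  1 20 2])])]), (3, 19, [(58, 17, [Shift 19], [Turn 56 1 56, Shift (-21)]), (64, 23, [Shift 25], [Turn 62 1
  62, Shift (-33)])], [(58, 38, 3, 19, 20, 18, 456, [(58, 359, [Turn 19 20 12], [Turn 19 20 12])]), (61, 2, 3,
  1, 20, 19, 507, [(61, 398, [Turn 1 20 2], [Turn 1 20 2])]), (64, 20, 3, 20, 1, 20, 560, [(64, 20, [Turn 20 1
  7], [Turn 20 1 7])])]), (1, 20, [(24, 16, [Shift (-17)], [Turn 1 18 21]), (34, 26, [Shift (-7)], [Turn 1 30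
  26, Shift (-7)]), (40, 30, [Shift (-1)], [Turn 5 7 17, Shift (-17)]), (47, 18, [Shift 6], [Turn (-5) 2 39,
  Shift (-36)]), (52, 36, [Shift 11], [Turn (-5) 1 36, Shift 11]), (53, 24, [Shift 12], [Turn 7 2 45, Shift
  (-30)]), (58, 19, [Shift 17], [Turn (-3) 2 20, Shift 15]), (62, 23, [Shift 21], [Turn 5 2 24, Shift 19]),
  (63, 6, [Shift 22], [Turn 6 1 6, Shift 22]), (63, 12, [Shift 22], [Turn 2 7 28, Shift (-34)]), (65, 16,
  [Shift 24], [Turn (-2) 5 90, Shift (-48)]), (65, 34, [Shift 24], [Turn 6 5 11, Shift 16]), (66, 29, [Shift
  25], [Turn 5 3 33, Shift 19]), (78, 25, [Shift 37], [Turn 2 5 11, Shift 25])], [(61, 40, 3, 20, 21, 19, 507,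
  [(61, 398, [Turn 1 20 2], [Turn 1 20 2])]), (64, 2, 3, 1, 21, 20, 560, [(64, 20, [Turn 20 1 7], [Turn 20 1
  7])]), (67, 21, 3, 21, 1, 21, 616, [(67, 482, [Turn 22 23 14], [Turn 22 23 14])])]), (1, 20, [(42, 19,
  [Shift (-1)], [Turn 4 7 31, Shift (-29)]), (43, 10, [Shift 0], [Turn 10 1 10, Shift (-24)]), (48, 25, [Shift
  5], [Turn 7 2 39, Shift (-23)]), (49, 13, [Shift 6], [Turn 5 7 50, Shift (-20)]), (64, 17, [Shift 21], [Turn
  (-1) 5 28, Shift 17]), (67, 31, [Shift 24], [Turn 2 7 71, Shift (-32)]), (67, 34, [Shift 24], [Turn (-2) 5
  44, Shift (-44)]), (72, 16, [Shift 29], [Turn 5 3 18, Shift 23]), (74, 27, [Shift 31], [Turn 6 5 33, Shift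
  21])], [(55, 39, 3, 7, 9, 78, 408, [(55, 356, [Turn 1 41 39], [Turn 1 41 39])]), (64, 5, 3, 2, 9, 93, 560,
  [(64, 260, [], [])]), (64, 42, 3, 21, 22, 20, 560, [(64, 20, [Turn 20 1 7], [Turn 20 1 7])]), (67, 2, 3, 1,
  22, 21, 616, [(67, 482, [Turn 22 23 14], [Turn 22 23 14])])]), (3, 21, [(37, 14, [Shift (-8)], [Turn 8 7 23,
  Shift (-14)]), (43, 38, [Shift (-2)], [Turn (-7) 1 54, Shift (-18)]), (52, 29, [Shift 7], [Turn 7 8 20,
  Shift 1]), (55, 32, [Shift 10], [Turn (-1) 7 32, Shift (-20)]), (58, 8, [Shift 13], [Turn 8 1 8, Shift
  (-3)])], [(55, 32, 3, 109, 2, 184, 408, [(55, 443, [Turn 109 2 2], [Turn 109 2 2])]), (67, 44, 3, 22, 23,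
  21, 616, [(67, 482, [Turn 22 23 14], [Turn 22 23 14])])]), (1, 21, [(35, 37, [Shift (-12)], [Turn 29 30
  17]), (43, 34, [Shift (-4)], [Turn 3 7 10, Shift (-24)]), (55, 39, [Shift 8], [Turn (-1) 6 44, Shift 2]),
  (56, 11, [Shift 9], [Turn (-3) 4 75, Shift (-45)]), (61, 41, [Shift 14], [Turn (-6) 1 53, Shift 2]), (64,
  18, [Shift 17], [Turn 7 3 75, Shift (-45)]), (72, 9, [Shift 25], [Turn 7 6 57, Shift 5]), (74, 7, [Shift
  27], [Turn 7 1 7, Shift 15])], [(61, 35, 3, 9, 11, 41, 507, [(61, 41, [Turn 41 1 41], [Turn 41 1 41])])]),
  (7, 21, [], []), (3, 22, [(43, 29, [Shift (-8)], [Turn (-1) 7 15, Shift (-10)]), (55, 44, [Shift 4], [Turn 2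
  7 29, Shift (-12)]), (64, 32, [Shift 13], [Turn 1 8 37, Shift 5])], []), (1, 22, [(45, 42, [Shift (-8)],
  [Turn (-2) 5 24, Shift (-16)]), (66, 23, [Shift 13], [Turn 2 7 68, Shift (-13)]), (67, 39, [Shift 14], [Turn
  8 7 44, Shift (-8)]), (68, 12, [Shift 15], [Turn 7 5 37, Shift (-21)]), (68, 20, [Shift 15], [Turn 1 8 23,
  Shift 7]), (74, 10, [Shift 21], [Turn 7 6 52, Shift 13]), (74, 31, [Shift 21], [Turn 5 7 77, Shift (-15)])],
  []), (5, 22, [(38, 43, [Shift (-17)], [Turn 7 4 43, Shift (-17)]), (52, 24, [Shift (-3)], [Turn 3 7 41,
  Shift (-19)]), (55, 17, [Shift 0], [Turn (-4) 3 27, Shift (-30)]), (60, 32, [Shift 5], [Turn 4 7 48, Shift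
  (-23)]), (63, 13, [Shift 8], [Turn (-3) 4 72, Shift (-34)]), (67, 49, [Shift 12], [Turn (-6) 1 49, Shift
  12])], []), (3, 23, [(55, 11, [Shift (-2)], [Turn (-2) 5 41, Shift (-14)]), (64, 41, [Shift 7], [Turn 2 7
  51, Shift (-7)])], []), (1, 23, [(45, 38, [Shift (-14)], [Turn 9 8 24, Shift (-16)]), (59, 42, [Shift 0],
  [Turn (-1) 7 26, Shift (-2)]), (61, 51, [Shift 2], [Turn 3 7 23, Shift (-18)]), (62, 14, [Shift 3], [Turn 8
  9 28, Shift 1]), (78, 9, [Shift 19], [Turn 9 1 9, Shift (-5)])], []), (1, 23, [(48, 19, [Shift (-13)], [Turn
  43 44 20]), (55, 17, [Shift (-6)], [Turn 7 4 20, Shift (-18)]), (59, 38, [Shift (-2)], [Turn 7 5 55, Shift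
  (-8)]), (62, 28, [Shift 1], [Turn 8 9 14]), (65, 53, [Shift 4], [Turn 5 7 39, Shift (-2)]), (68, 34, [Shift
  7], [Turn 1 9 15, Shift 1]), (69, 36, [Shift 8], [Turn 8 7 49, Shift 2]), (72, 43, [Shift 11], [Turn 7 3 34,
  Shift (-23)])], []), (3, 24, [(52, 20, [Shift (-11)], [Turn 11 10 32, Shift (-51), Turn 11 10 34, Turn 3 7
  87, Shift 50]), (55, 23, [Shift (-8)], [Turn 1 11 20, Shift (-18)]), (58, 53, [Shift (-5)], [Turn (-10) 1
  107, Shift (-59), Turn (-10) 1 37, Turn 7 4 29, Shift 50])], []), (5, 24, [(62, 19, [Shift (-3)], [Turn 3 7
  63, Shift (-11)])], []), (1, 24, [(39, 53, [Shift (-28)], [Turn 8 9 17]), (65, 52, [Shift (-2)], [Turn 7 4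
  61, Shift (-14)]), (68, 15, [Shift 1], [Turn 1 9 34]), (71, 25, [Shift 4], [Turn (-1) 8 31, Shift (-12)]),
  (74, 31, [Shift 7], [Turn (-5) 2 37, Shift (-5)]), (74, 47, [Shift 7], [Turn 1 10 25, Shift (-9)])], []),
  (3, 25, [], [])]"
  by code_simp

lemma check_norms_71:
  "check_norms 71 115 [
  (1, 25, [(38, 16, [Turn 2 9 43], [Turn 2 9 43]), (38, 20, [Turn 1 32 43], [Turn 1 32 43]), (55, 45, [Shift
  (-16)], [Turn 49 50 41]), (62, 55, [Shift (-9)], [Turn 7 4 55, Shift (-9)]), (69, 32, [Shift (-2)], [Turn
  (-7) 2 60, Shift (-58)]), (78, 56, [Shift 7], [Turn 7 9 98, Shift (-47)])], []), (1, 25, [(49, 33, [Shift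
  (-24)], [Turn (-7) 2 41, Shift (-40)]), (57, 41, [Shift (-16)], [Turn 1 57 25, Shift (-32)]), (61, 46,
  [Shift (-12)], [Turn 3 8 80, Shift (-30)]), (63, 60, [Shift (-10)], [Turn 60 1 60, Shift (-34)]), (68, 23,
  [Shift (-5)], [Turn (-4) 3 25, Shift (-11)]), (69, 57, [Shift (-4)], [Turn 2 9 24, Shift (-38)])], []), (3,
  26, [(52, 59, [Shift (-23)], [Turn 1 14 56, Shift (-35)]), (58, 53, [Shift (-17)], [Turn 14 13 128, Shift
  (-107), Turn 14 13 34, Turn (-5) 3 38, Shift 12])], []), (7, 26, [(58, 18, [Shift (-19)], [Turn 8 9 20]),
  (63, 68, [Shift (-14)], [Turn (-9) 1 74, Shift (-20)])], []), (1, 26, [(54, 31, [Shift (-25)], [Turn 49 50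
  14]), (56, 22, [Shift (-23)], [Turn 14 15 75, Shift (-45)]), (57, 15, [Shift (-22)], [Turn (-4) 5 104, Shift
  (-74), Turn 15 14 66, Turn (-4) 3 19, Shift (-13)]), (57, 36, [Shift (-22)], [Turn 8 9 10]), (65, 44, [Shift
  (-14)], [Turn 1 9 11]), (71, 62, [Shift (-8)], [Turn 5 9 133, Shift (-78), Turn 5 9 23, Turn (-78) 1 44,
  Shift (-17)]), (72, 49, [Shift (-7)], [Turn 8 5 23, Shift (-35)])], []), (3, 26, [(67, 26, [Shift (-14)],
  [Turn 133 2 174, Shift (-148), Turn (-1) 21 211, Turn 13 4 196, Shift 109, Turn 13 4 51, Turn 1 15 27, Shift
  8])], []), (1, 27, [(41, 65, [Turn 34 35 28], [Turn 34 35 28]), (47, 49, [Shift (-36)], [Turn 49 1 49, Shift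
  (-38)]), (55, 23, [Shift (-28)], [Turn 48 49 27, Shift (-30)]), (65, 58, [Shift (-18)], [Turn 8 3 62, Shift
  (-24)]), (74, 25, [Shift (-9)], [Turn 1 10 47]), (78, 19, [Shift (-5)], [Turn 5 9 18, Shift (-79), Turn 18 1
  18, Turn 7 11 38, Shift 58])], []), (5, 27, [(62, 19, [Shift (-23)], [Turn 1 9 24]), (63, 38, [Shift (-22)],
  [Turn 2 9 74]), (65, 62, [Shift (-20)], [Turn 62 1 62, Shift (-24)])], []), (3, 27, [(52, 56, [Shift (-35)],
  [Turn 1 14 59]), (64, 74, [Shift (-23)], [Turn (-13) 1 146, Shift (-95), Turn (-13) 1 82, Turn 4 7 26, Shift
  (-6)])], []), (1, 28, [(45, 70, [Turn 7 9 42], [Turn 7 9 42]), (56, 73, [Shift (-33)], [Turn 2 11 78, Shift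
  (-51), Turn 2 11 20, Turn (-1) 49 69, Shift 38]), (57, 25, [Shift (-32)], [Turn 1 57 41])], []), (7, 28,
  [(58, 25, [Shift (-33)], [Turn 2 11 20, Shift (-51)])], []), (3, 28, [(40, 65, [Turn (-1) 10 17], [Turn (-1)
  10 17]), (58, 17, [Shift (-35)], [Turn 1 11 29])], []), (5, 28, [(45, 22, [Turn 8 9 12], [Turn 8 9 12]),
  (72, 29, [Shift (-23)], [Turn (-8) 3 134, Shift (-133), Turn (-1) 26 43, Turn 14 9 52, Shift 94, Turn 14 9
  230, Turn 1 19 46, Shift (-3)])], []), (1, 29, [(34, 71, [Turn 17 18 26], [Turn 17 18 26]), (61, 22, [Shift
  (-36)], [Turn 4 9 92, Shift (-42)]), (65, 43, [Shift (-32)], [Turn (-1) 9 52]), (68, 80, [Shift (-29)],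
  [Turn (-17) 1 248, Shift (-197), Turn (-17) 1 192, Turn 5 12 170, Shift 210, Turn 5 12 18, Turn 18 1 18,
  Shift (-67), Turn 18 1 18, Turn 8 11 38, Shift 138, Turn 8 11 139, Turn 139 1 139, Shift (-89), Turn (-88) 1
  50, Turn 5 7 70, Shift 8])], []), (3, 29, [], []), (1, 29, [(42, 74, [Turn 6 11 33, Turn 25 26 31], [Turn 6
  11 33, Turn 25 26 31]), (50, 65, [Turn 1 14 48], [Turn 1 14 48]), (56, 31, [Shift (-45)], [Turn 7 10 11,
  Shift (-47)]), (64, 19, [Shift (-37)], [Turn 1 16 75, Shift (-45)])], []), (1, 29, [(42, 80, [Turn (-1) 9
  19], [Turn (-1) 9 19]), (47, 23, [Turn 1 9 14], [Turn 1 9 14]), (47, 66, [Turn 18 19 49], [Turn 18 19 49]),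
  (52, 32, [Turn 11 10 20], [Turn 11 10 20]), (61, 85, [Shift (-42)], [Turn 8 11 26, Shift (-78), Turn (-1) 16
  39, Turn (-8) 3 51, Shift 83, Turn (-8) 3 90, Turn 1 17 103, Shift (-42)]), (66, 31, [Shift (-37)], [Turn 1
  10 33])], []), (3, 30, [(37, 74, [Turn 22 23 24], [Turn 22 23 24])], []), (1, 30, [(37, 48, [Turn 1 29 14],
  [Turn 1 29 14]), (49, 60, [Turn 5 9 33], [Turn 5 9 33]), (56, 78, [Turn 2 11 73], [Turn 2 11 73]), (56, 83,
  [Turn (-2) 9 24, Turn 1 50 73], [Turn (-2) 9 24, Turn 1 50 73]), (57, 33, [Shift (-50)], [Turn 9 10 12]),
  (63, 79, [Shift (-44)], [Turn (-5) 4 79, Shift (-44)]), (68, 91, [Shift (-39)], [Turn 11 6 171, Turn 1 19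
  25]), (69, 24, [Shift (-38)], [Turn 2 9 57])], []), (1, 30, [(56, 24, [Turn 1 50 73], [Turn 1 50 73]), (57,
  40, [Turn 11 3 46, Turn 1 58 15], [Turn 11 3 46, Turn 1 58 15]), (58, 20, [Shift (-51)], [Turn 2 11 25]),
  (62, 77, [Shift (-47)], [Turn 1 17 63])], []), (3, 30, [(67, 92, [Shift (-44)], [Turn (-19) 1 272, Shift
  (-224), Turn (-19) 1 250, Turn 3 14 142, Shift 173, Turn 3 14 14, Turn 14 1 14, Shift 24])], []), (1, 31,
  [(34, 93, [Turn 6 11 76], [Turn 6 11 76]), (48, 89, [Turn 10 9 25], [Turn 10 9 25]), (67, 80, [Shift (-46)],
  [Turn 9 10 31]), (68, 35, [Shift (-45)], [Turn 11 10 23])], [])]"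
  by code_simp

lemma check_norms_115:
  "check_norms 115 157 [
  (5, 31, [(43, 98, [Turn 31 32 29], [Turn 31 32 29]), (78, 18, [Shift (-37)], [Turn 18 1 18, Turn 5 9 19])],
  []), (3, 31, [(64, 86, [Shift (-53)], [Turn 10 11 18])], []), (7, 31, [(55, 44, [Turn 8 11 98], [Turn 8 11
  98]), (69, 37, [Shift (-50)], [Turn (-8) 3 102, Turn 15 14 24])], []), (11, 32, [(45, 71, [Turn 18 19 42],
  [Turn 18 19 42])], []), (3, 32, [(49, 104, [Turn (-1) 13 41], [Turn (-1) 13 41]), (58, 101, [Shift (-65),
  Turn 17 16 37, Turn (-4) 3 30, Shift (-18)], [Turn 17 16 109, Shift (-99), Turn 17 16 29, Turn (-4) 5 23,
  Shift 20])], []), (5, 32, [(40, 77, [Turn 1 13 12], [Turn 1 13 12]), (53, 73, [Turn 1 12 24], [Turn 1 12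
  24]), (78, 98, [Shift (-47)], [Turn 7 9 56])], []), (1, 32, [(43, 57, [Turn 33 34 15], [Turn 33 34 15]),
  (53, 38, [Turn (-1) 10 37], [Turn (-1) 10 37]), (57, 71, [Turn 4 9 41], [Turn 4 9 41]), (63, 29, [Turn 7 9
  13], [Turn 7 9 13]), (63, 35, [Turn 55 56 72], [Turn 55 56 72]), (66, 75, [Turn 11 12 23], [Turn 11 12 23]),
  (69, 72, [Shift (-58)], [Turn 72 1 72, Turn 4 9 32])], []), (3, 33, [], []), (1, 33, [(42, 96, [Turn 8 11
  33], [Turn 8 11 33]), (52, 40, [Turn 46 47 8], [Turn 46 47 8]), (58, 48, [Turn 4 11 101], [Turn 4 11 101]),
  (58, 107, [Turn 20 21 84], [Turn 20 21 84]), (64, 102, [Turn 1 9 13], [Turn 1 9 13]), (78, 93, [Shift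
  (-53)], [Turn (-4) 7 158, Shift (-107), Turn (-27) 1 304, Turn 7 12 84, Shift 36]), (78, 111, [Shift (-53)],
  [Turn 2 13 35, Shift (-73), Turn 13 9 205, Turn (-24) 1 107, Shift 58])], []), (7, 33, [(47, 94, [Turn 9 10
  17], [Turn 9 10 17]), (55, 30, [Turn 54 55 29], [Turn 54 55 29]), (65, 109, [Turn 15 16 58], [Turn 15 16
  58])], []), (3, 33, [(43, 83, [Turn (-1) 13 28], [Turn (-1) 13 28])], []), (1, 33, [(53, 106, [Turn 1 53
  24], [Turn 1 53 24]), (55, 61, [Turn 1 9 18], [Turn 1 9 18]), (58, 38, [Turn 7 11 107], [Turn 7 11 107]),
  (64, 97, [Turn 11 10 41], [Turn 11 10 41]), (68, 57, [Turn (-1) 12 37], [Turn (-1) 12 37]), (71, 77, [Turn 8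
  9 25], [Turn 8 9 25]), (74, 26, [Shift (-63)], [Turn 12 11 37]), (74, 116, [Shift (-63)], [Turn 1 13 31])],
  []), (1, 34, [(39, 62, [Turn 2 9 26], [Turn 2 9 26]), (48, 86, [Turn 19 18 113, Turn 3 11 39], [Turn 19 18
  113, Turn 3 11 39]), (54, 63, [Turn 11 9 10], [Turn 11 9 10]), (55, 78, [Turn 7 9 39], [Turn 7 9 39]), (59,
  121, [Turn 1 54 26], [Turn 1 54 26]), (61, 26, [Turn 8 11 85], [Turn 8 11 85]), (61, 42, [Turn 3 10 75],
  [Turn 3 10 75]), (65, 38, [Turn 1 11 15], [Turn 1 11 15]), (68, 77, [Turn (-2) 9 11], [Turn (-2) 9 11]),
  (68, 109, [Turn 8 9 17], [Turn 8 9 17])], []), (3, 34, [(58, 83, [Turn 1 17 53], [Turn 1 17 53]), (61, 32,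
  [Turn 49 50 26], [Turn 49 50 26])], []), (11, 34, [(36, 84, [Turn 30 31 6], [Turn 30 31 6]), (71, 43, [Turn
  1 10 26], [Turn 1 10 26])], []), (5, 34, [(52, 114, [Turn 1 14 29], [Turn 1 14 29]), (57, 119, [Turn 4 11
  40], [Turn 4 11 40]), (68, 113, [Turn 2 9 12], [Turn 2 9 12])], []), (3, 35, [(40, 122, [Turn 16 17 14],
  [Turn 16 17 14]), (52, 62, [Turn 52 53 59], [Turn 52 53 59]), (61, 101, [Turn (-1) 16 26], [Turn (-1) 16
  26])], []), (1, 35, [(43, 58, [Turn 1 18 34], [Turn 1 18 34]), (43, 66, [Turn (-2) 9 54], [Turn (-2) 9 54]),
  (50, 63, [Turn 11 12 19], [Turn 11 12 19]), (54, 105, [Turn 52 53 31], [Turn 52 53 31]), (55, 88, [Turn 13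
  12 29], [Turn 13 12 29]), (61, 84, [Turn 1 55 23], [Turn 1 55 23]), (71, 32, [Turn 1 14 24], [Turn 1 14
  24]), (71, 55, [Turn 9 11 31], [Turn 9 11 31]), (71, 133, [Turn 5 9 62], [Turn 5 9 62]), (74, 87, [Turn 1 12
  31], [Turn 1 12 31])], []), (1, 35, [(40, 118, [Turn 39 40 25], [Turn 39 40 25]), (59, 110, [Turn 2 11 55],
  [Turn 2 11 55]), (78, 35, [Turn 2 13 111], [Turn 2 13 111]), (78, 41, [Turn 13 4 175, Turn 24 25 111], [Turn
  13 4 175, Turn 24 25 111])], []), (3, 35, [(55, 95, [Turn 11 13 27], [Turn 11 13 27])], []), (5, 35, [(35,
  122, [Turn 3 14 18], [Turn 3 14 18]), (40, 127, [Turn 2 11 30], [Turn 2 11 30]), (48, 113, [Turn 3 11 39],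
  [Turn 3 11 39]), (52, 109, [Turn 32 33 34], [Turn 32 33 34]), (78, 28, [Turn (-2) 11 41], [Turn (-2) 11
  41])], [])]"
  by code_simp

lemma check_norms_157:
  "check_norms 157 195 [
  (1, 36, [(36, 123, [Turn 8 9 7], [Turn 8 9 7]), (56, 114, [Turn 24 25 78], [Turn 24 25 78]), (66, 100, [Turn
  1 11 27], [Turn 1 11 27]), (66, 129, [Turn 6 11 116], [Turn 6 11 116]), (78, 61, [Turn 8 13 19, Turn 19 1
  19], [Turn 8 13 19, Turn 19 1 19])], []), (3, 36, [(43, 104, [Turn 1 26 54], [Turn 1 26 54]), (49, 62, [Turn
  11 13 50], [Turn 11 13 50])], []), (7, 36, [(49, 103, [Turn 6 11 41], [Turn 6 11 41])], []), (1, 36, [(37,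
  63, [Turn 4 13 14], [Turn 4 13 14]), (52, 134, [Turn 7 11 56], [Turn 7 11 56])], []), (3, 36, [(37, 59,
  [Turn 1 14 5], [Turn 1 14 5]), (52, 74, [Turn 1 29 32], [Turn 1 29 32]), (58, 128, [Turn 14 13 53], [Turn 14
  13 53])], []), (1, 37, [(41, 142, [Turn 1 20 28], [Turn 1 20 28]), (46, 75, [Turn 7 9 4], [Turn 7 9 4]),
  (64, 93, [Turn 2 9 5], [Turn 2 9 5]), (74, 61, [Turn 3 11 10], [Turn 3 11 10])], []), (13, 37, [(51, 75,
  [Turn (-1) 9 24], [Turn (-1) 9 24]), (51, 99, [Turn 49 50 12], [Turn 49 50 12]), (58, 133, [Turn 31 32 98],
  [Turn 31 32 98]), (61, 132, [Turn 5 9 53], [Turn 5 9 53]), (66, 76, [Turn 8 9 6], [Turn 8 9 6]), (71, 95,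
  [Turn 10 9 33], [Turn 10 9 33])], []), (3, 37, [(43, 119, [Turn 1 23 30], [Turn 1 23 30])], []), (1, 37,
  [(42, 107, [Turn 30 31 19], [Turn 30 31 19]), (49, 142, [Turn 5 11 8], [Turn 5 11 8]), (50, 121, [Turn (-1)
  10 11], [Turn (-1) 10 11]), (52, 102, [Turn 13 12 24], [Turn 13 12 24]), (67, 41, [Turn 14 13 26], [Turn 14
  13 26])], []), (5, 37, [(37, 74, [Turn 13 12 25], [Turn 13 12 25]), (40, 52, [Turn 23 24 30], [Turn 23 24
  30]), (55, 107, [Turn 1 18 17], [Turn 1 18 17]), (63, 33, [Turn 13 11 79], [Turn 13 11 79]), (65, 102, [Turn
  (-1) 12 39], [Turn (-1) 12 39]), (68, 38, [Turn 51 52 126, Turn 7 11 80], [Turn 51 52 126, Turn 7 11 80]),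
  (72, 39, [Turn 1 9 14], [Turn 1 9 14])], []), (3, 38, [(61, 110, [Turn 14 13 46], [Turn 14 13 46]), (64, 80,
  [Turn 55 56 74], [Turn 55 56 74])], []), (1, 38, [(59, 152, [Turn 1 53 38], [Turn 1 53 38]), (67, 50, [Turn
  13 11 92], [Turn 13 11 92])], []), (1, 38, [(59, 161, [Turn 1 9 17], [Turn 1 9 17]), (62, 40, [Turn (-2) 9
  55], [Turn (-2) 9 55]), (69, 80, [Turn 13 16 40, Turn (-9) 5 167, Shift (-142), Turn (-1) 24 71, Turn 14 5
  218, Shift 127, Turn 14 5 234, Turn 1 21 36, Shift (-24)], [Turn (-4) 9 80, Turn 13 16 40, Turn (-9) 5 167,
  Shift (-142), Turn (-1) 24 71, Turn 14 5 218, Shift 127, Turn 14 5 234, Turn 1 21 36, Shift (-24)]), (71,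
  54, [Turn (-3) 10 141], [Turn (-3) 10 141]), (78, 55, [Turn 7 10 9], [Turn 7 10 9])], []), (3, 38, [(64,
  119, [Turn 1 20 74], [Turn 1 20 74])], []), (5, 38, [(38, 108, [Turn 1 12 10], [Turn 1 12 10]), (42, 109,
  [Turn 13 12 19], [Turn 13 12 19]), (45, 152, [Turn 1 28 24], [Turn 1 28 24]), (47, 114, [Turn 17 18 32],
  [Turn 17 18 32]), (58, 113, [Turn (-1) 18 38], [Turn (-1) 18 38]), (67, 129, [Turn 12 13 34], [Turn 12 13
  34])], []), (11, 39, [(48, 147, [Turn 1 14 20], [Turn 1 14 20]), (60, 131, [Turn 1 10 7], [Turn 1 10 7])],
  []), (3, 39, [(40, 80, [Turn 1 26 30], [Turn 1 26 30])], []), (1, 39, [(49, 149, [Turn 1 50 32], [Turn 1 50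
  32]), (57, 122, [Turn 5 11 49], [Turn 5 11 49]), (67, 134, [Turn 3 10 7], [Turn 3 10 7]), (68, 112, [Turn 7
  12 12], [Turn 7 12 12]), (72, 59, [Turn 3 13 123], [Turn 3 13 123]), (74, 121, [Turn 1 30 121, Turn 13 8
  174, Shift (-123), Turn (-23) 1 260, Turn 7 12 112, Shift 68], [Turn 13 8 174, Shift (-123), Turn (-23) 1
  260, Turn 7 12 112, Shift 68])], []), (1, 39, [(42, 81, [Turn 40 41 13], [Turn 40 41 13]), (58, 87, [Turn 11
  9 8], [Turn 11 9 8]), (63, 152, [Turn 22 23 60], [Turn 22 23 60]), (65, 140, [Turn (-4) 11 206, Turn 1 54
  90], [Turn (-4) 11 206, Turn 1 54 90]), (74, 113, [Turn 5 12 137], [Turn 5 12 137]), (78, 107, [Turn (-2) 9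
  9], [Turn (-2) 9 9])], [])]"
  by code_simp

lemma check_norms_195:
  "check_norms 195 235 [
  (3, 39, [(58, 68, [Turn 31 32 107], [Turn 31 32 107]), (58, 173, [Turn 16 17 29], [Turn 16 17 29])], []),
  (1, 40, [(49, 73, [Turn 1 27 50], [Turn 1 27 50]), (52, 143, [Turn 42 43 24], [Turn 42 43 24]), (63, 111,
  [Turn 3 16 33], [Turn 3 16 33]), (64, 176, [Turn 8 9 3], [Turn 8 9 3]), (68, 126, [Turn 7 11 80], [Turn 7 11
  80]), (74, 161, [Turn 15 16 47], [Turn 15 16 47])], []), (1, 40, [(51, 140, [Turn 7 10 43], [Turn 7 10 43]),
  (53, 88, [Turn 15 16 24], [Turn 15 16 24]), (53, 154, [Turn 12 13 21], [Turn 12 13 21]), (57, 73, [Turn 7 11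
  15], [Turn 7 11 15]), (60, 116, [Turn (-1) 12 32], [Turn (-1) 12 32]), (66, 45, [Turn 7 9 9], [Turn 7 9 9]),
  (66, 139, [Turn (-3) 10 13], [Turn (-3) 10 13])], []), (3, 40, [(55, 167, [Turn 22 23 20], [Turn 22 23 20]),
  (67, 74, [Turn 10 11 22], [Turn 10 11 22])], []), (7, 40, [(72, 144, [Turn 12 17 291, Turn (-1) 26 134, Turn
  (-8) 3 29], [Turn 12 17 291, Turn (-1) 26 134, Turn (-8) 3 29])], []), (5, 40, [(52, 159, [Turn 47 48 9],
  [Turn 47 48 9]), (57, 174, [Turn 7 13 127], [Turn 7 13 127]), (63, 168, [Turn 3 11 60], [Turn 3 11 60]),
  (67, 144, [Turn 42 43 44], [Turn 42 43 44])], []), (3, 40, [(49, 80, [Turn 1 44 8], [Turn 1 44 8])], []),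
  (11, 41, [(41, 64, [Turn 13 10 9], [Turn 13 10 9]), (55, 182, [Turn 13 15 23], [Turn 13 15 23]), (66, 94,
  [Turn 10 9 8], [Turn 10 9 8]), (69, 40, [Turn 13 16 80], [Turn 13 16 80]), (71, 164, [Turn 13 9 141], [Turn
  13 9 141]), (74, 163, [Turn 4 9 7], [Turn 4 9 7]), (78, 93, [Turn 1 9 18], [Turn 1 9 18])], []), (1, 41,
  [(48, 123, [Turn (-1) 12 25], [Turn (-1) 12 25]), (51, 78, [Turn 1 46 12], [Turn 1 46 12]), (71, 174, [Turn
  1 57 54], [Turn 1 57 54])], []), (3, 41, [(58, 140, [Turn 1 35 107], [Turn 1 35 107])], []), (5, 41, [(78,
  193, [Turn (-22) 1 211, Turn 13 10 93], [Turn (-22) 1 211, Turn 13 10 93])], []), (7, 41, [(51, 179, [Turn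
  16 11 186], [Turn 16 11 186]), (54, 66, [Turn 9 10 6], [Turn 9 10 6]), (66, 153, [Turn 11 10 27], [Turn 11
  10 27])], []), (3, 41, [(49, 179, [Turn (-2) 11 50], [Turn (-2) 11 50]), (67, 98, [Turn 1 38 41], [Turn 1 38
  41])], []), (13, 42, [(45, 172, [Turn 1 9 5], [Turn 1 9 5]), (47, 100, [Turn 1 42 17], [Turn 1 42 17]), (51,
  192, [Turn 7 15 12], [Turn 7 15 12]), (69, 122, [Turn 41 42 139], [Turn 41 42 139]), (71, 142, [Turn (-1) 14
  62], [Turn (-1) 14 62])], []), (1, 42, [(43, 194, [Turn 11 15 15], [Turn 11 15 15]), (48, 138, [Turn 10 13
  39], [Turn 10 13 39]), (58, 158, [Turn 1 24 56], [Turn 1 24 56]), (64, 131, [Turn 11 12 13], [Turn 11 12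
  13]), (64, 162, [Turn 17 18 37], [Turn 17 18 37])], []), (3, 42, [], []), (1, 42, [(50, 187, [Turn 1 17 24],
  [Turn 1 17 24]), (52, 100, [Turn 11 16 56], [Turn 11 16 56])], []), (1, 42, [(47, 179, [Turn 8 9 7], [Turn 8
  9 7]), (60, 189, [Turn 7 17 67, Turn 29 30 48], [Turn 7 17 67, Turn 29 30 48])], []), (3, 43, [(49, 131,
  [Turn 17 16 33], [Turn 17 16 33]), (55, 149, [Turn (-1) 31 163, Turn 11 20 258, Turn (-13) 1 32], [Turn (-1)
  31 163, Turn 11 20 258, Turn (-13) 1 32])], []), (1, 43, [(43, 170, [Turn 6 11 15], [Turn 6 11 15]), (68,
  206, [Turn 24 25 71], [Turn 24 25 71]), (69, 97, [Turn (-1) 12 22], [Turn (-1) 12 22]), (69, 198, [Turn 11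
  13 57], [Turn 11 13 57]), (72, 91, [Turn 43 44 144], [Turn 43 44 144]), (74, 148, [Turn (-3) 11 137], [Turn
  (-3) 11 137])], [])]"
  by code_simp

lemma check_norms_235:
  "check_norms 235 273 [
  (5, 43, [(48, 98, [Turn 1 12 8], [Turn 1 12 8]), (65, 172, [Turn 12 11 16], [Turn 12 11 16])], []), (3, 43,
  [(46, 74, [Turn 14 13 11], [Turn 14 13 11]), (55, 86, [Turn (-2) 11 45], [Turn (-2) 11 45])], []), (1, 43,
  [(49, 106, [Turn (-2) 9 38], [Turn (-2) 9 38]), (55, 72, [Turn 3 10 39], [Turn 3 10 39]), (59, 88, [Turn 12
  11 28], [Turn 12 11 28]), (69, 189, [Turn 1 43 80], [Turn 1 43 80]), (72, 108, [Turn 16 9 264, Turn 1 19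
  28], [Turn 16 9 264, Turn 1 19 28]), (74, 197, [Turn 3 17 174], [Turn 3 17 174])], []), (1, 43, [(60, 169,
  [Turn 3 10 5], [Turn 3 10 5]), (62, 140, [Turn 25 26 66], [Turn 25 26 66]), (65, 148, [Turn 1 57 61], [Turn
  1 57 61]), (66, 87, [Turn 13 14 30], [Turn 13 14 30])], []), (3, 44, [], []), (5, 44, [(52, 209, [Turn 52 53
  29], [Turn 52 53 29]), (65, 207, [Turn 1 58 52], [Turn 1 58 52]), (68, 143, [Turn 1 12 17], [Turn 1 12
  17])], []), (13, 44, [(53, 180, [Turn 4 11 54], [Turn 4 11 54]), (53, 219, [Turn 18 17 45], [Turn 18 17
  45])], []), (3, 44, [(52, 110, [Turn 17 16 41], [Turn 17 16 41]), (55, 104, [Turn 28 29 32], [Turn 28 29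
  32]), (61, 158, [Turn (-5) 11 119], [Turn (-5) 11 119])], []), (1, 44, [(44, 195, [Turn (-2) 9 8], [Turn
  (-2) 9 8]), (51, 160, [Turn 3 11 43], [Turn 3 11 43]), (69, 113, [Turn 1 20 32], [Turn 1 20 32])], []), (11,
  44, [(60, 76, [Turn 1 10 12], [Turn 1 10 12]), (63, 196, [Turn 47 48 79], [Turn 47 48 79]), (78, 225, [Turn
  1 9 17], [Turn 1 9 17])], []), (3, 45, [(55, 197, [Turn 11 13 44], [Turn 11 13 44])], []), (1, 45, [(52,
  108, [Turn 11 12 12], [Turn 11 12 12]), (67, 229, [Turn 5 9 34], [Turn 5 9 34]), (71, 203, [Turn 15 14 25],
  [Turn 15 14 25])], []), (7, 45, [(56, 201, [Turn (-4) 9 11], [Turn (-4) 9 11]), (72, 165, [Turn 2 11 18],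
  [Turn 2 11 18])], []), (3, 45, [(67, 80, [Turn (-4) 13 161], [Turn (-4) 13 161])], []), (1, 45, [(48, 80,
  [Turn 11 10 8], [Turn 11 10 8]), (51, 185, [Turn 9 10 10], [Turn 9 10 10]), (55, 110, [Turn 1 55 18], [Turn
  1 55 18]), (60, 155, [Turn 1 56 7], [Turn 1 56 7]), (63, 216, [Turn 9 11 12], [Turn 9 11 12]), (68, 229,
  [Turn 16 15 40], [Turn 16 15 40])], []), (5, 45, [(47, 194, [Turn 14 11 39], [Turn 14 11 39]), (55, 97,
  [Turn 7 11 11], [Turn 7 11 11]), (57, 149, [Turn (-1) 16 41], [Turn (-1) 16 41]), (62, 74, [Turn 7 18 279,
  Turn (-16) 1 55], [Turn 7 18 279, Turn (-16) 1 55]), (68, 118, [Turn 2 9 26], [Turn 2 9 26])], []), (3, 45,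
  [(52, 209, [Turn 1 23 20], [Turn 1 23 20])], []), (1, 46, [(52, 195, [Turn 13 18 143], [Turn 13 18 143]),
  (54, 220, [Turn (-1) 11 14], [Turn (-1) 11 14]), (57, 197, [Turn 15 11 14], [Turn 15 11 14])], []), (1, 46,
  [(49, 83, [Turn 17 10 188], [Turn 17 10 188]), (53, 210, [Turn (-7) 9 154], [Turn (-7) 9 154]), (60, 74,
  [Turn 1 11 7], [Turn 1 11 7]), (63, 236, [Turn 17 15 35], [Turn 17 15 35]), (69, 100, [Turn 51 52 109],
  [Turn 51 52 109])], [])]"
  by code_simp

lemma check_norms_273:
  "check_norms 273 309 [
  (3, 46, [(58, 95, [Turn 1 23 8], [Turn 1 23 8]), (58, 116, [Turn 20 19 39], [Turn 20 19 39]), (61, 80, [Turn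
  37 38 85], [Turn 37 38 85])], []), (5, 46, [(63, 108, [Turn 19 18 28], [Turn 19 18 28]), (63, 233, [Turn 4
  13 60], [Turn 4 13 60]), (68, 113, [Turn 26 27 80], [Turn 26 27 80])], []), (1, 46, [(51, 218, [Turn 5 14
  96], [Turn 5 14 96]), (56, 126, [Turn 1 11 14], [Turn 1 11 14]), (61, 195, [Turn 11 10 20], [Turn 11 10
  20]), (62, 176, [Turn 20 19 63], [Turn 20 19 63])], []), (3, 46, [(58, 116, [Turn 19 17 53], [Turn 19 17
  53])], []), (1, 47, [(55, 178, [Turn 1 30 45], [Turn 1 30 45]), (55, 239, [Turn 16 13 107], [Turn 16 13
  107]), (58, 231, [Turn 12 11 18], [Turn 12 11 18]), (64, 85, [Turn 7 10 5], [Turn 7 10 5]), (71, 173, [Turn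
  1 13 12], [Turn 1 13 12])], []), (1, 47, [(52, 125, [Turn 19 16 34], [Turn 19 16 34]), (53, 180, [Turn (-1)
  11 21], [Turn (-1) 11 21]), (53, 250, [Turn 24 25 37], [Turn 24 25 37]), (59, 124, [Turn 22 23 42], [Turn 22
  23 42]), (60, 127, [Turn 11 9 6], [Turn 11 9 6])], []), (3, 47, [(55, 182, [Turn 7 11 44], [Turn 7 11 44])],
  []), (7, 47, [(47, 255, [Turn (-1) 9 15], [Turn (-1) 9 15]), (56, 243, [Turn 2 13 11], [Turn 2 13 11]), (61,
  122, [Turn 1 40 85], [Turn 1 40 85]), (65, 221, [Turn 3 13 61], [Turn 3 13 61]), (66, 111, [Turn 8 13 9],
  [Turn 8 13 9])], []), (17, 47, [(51, 107, [Turn (-1) 27 140], [Turn (-1) 27 140]), (59, 237, [Turn 1 50 13],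
  [Turn 1 50 13]), (78, 245, [Turn 6 13 11], [Turn 6 13 11])], []), (3, 47, [(49, 128, [Turn 11 16 41], [Turn
  11 16 41]), (49, 200, [Turn (-1) 16 11], [Turn (-1) 16 11]), (49, 206, [Turn 43 44 6], [Turn 43 44 6]), (64,
  179, [Turn (-1) 13 18], [Turn (-1) 13 18])], []), (1, 48, [(56, 228, [Turn 1 9 5], [Turn 1 9 5]), (60, 87,
  [Turn 14 17 67], [Turn 14 17 67]), (78, 113, [Turn 4 13 18], [Turn 4 13 18])], []), (5, 48, [(50, 82, [Turn
  1 18 19], [Turn 1 18 19]), (52, 174, [Turn 1 39 24], [Turn 1 39 24]), (53, 173, [Turn 11 12 8], [Turn 11 12
  8]), (68, 88, [Turn 1 57 80], [Turn 1 57 80]), (72, 264, [Turn 1 19 28], [Turn 1 19 28])], []), (3, 48,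
  [(52, 173, [Turn 20 19 56], [Turn 20 19 56])], []), (13, 48, [(60, 191, [Turn 8 11 5], [Turn 8 11 5]), (66,
  167, [Turn 8 9 11], [Turn 8 9 11])], []), (7, 48, [(58, 235, [Turn 8 9 7], [Turn 8 9 7]), (66, 83, [Turn 10
  11 13], [Turn 10 11 13]), (68, 248, [Turn 2 17 80], [Turn 2 17 80])], []), (3, 48, [(49, 248, [Turn 1 11 6],
  [Turn 1 11 6]), (64, 221, [Turn 7 11 6], [Turn 7 11 6])], []), (5, 48, [], []), (1, 49, [(52, 274, [Turn 10
  9 3], [Turn 10 9 3]), (53, 223, [Turn (-3) 11 45], [Turn (-3) 11 45]), (56, 92, [Turn (-1) 10 16], [Turn
  (-1) 10 16]), (61, 91, [Turn 1 27 46], [Turn 1 27 46]), (71, 93, [Turn 9 10 6], [Turn 9 10 6])], [])]"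
  by code_simp

lemma check_norms_309:
  "check_norms 309 349 [
  (3, 49, [(58, 203, [Turn 25 26 8], [Turn 25 26 8]), (61, 92, [Turn 19 17 42], [Turn 19 17 42]), (67, 242,
  [Turn 49 50 92], [Turn 49 50 92])], []), (1, 49, [(63, 254, [Turn 58 59 9], [Turn 58 59 9]), (66, 183, [Turn
  1 17 29], [Turn 1 17 29]), (78, 113, [Turn (-1) 11 10], [Turn (-1) 11 10])], []), (1, 49, [(51, 257, [Turn
  10 11 8], [Turn 10 11 8]), (57, 201, [Turn (-3) 14 127], [Turn (-3) 14 127]), (60, 120, [Turn (-5) 13 211],
  [Turn (-5) 13 211]), (68, 247, [Turn 15 14 20], [Turn 15 14 20]), (74, 175, [Turn 10 9 19], [Turn 10 9
  19])], []), (3, 49, [], []), (1, 49, [(54, 186, [Turn 13 12 14], [Turn 13 12 14]), (55, 185, [Turn 1 12 10],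
  [Turn 1 12 10]), (56, 116, [Turn 8 11 38], [Turn 8 11 38]), (58, 134, [Turn 10 19 75], [Turn 10 19 75]),
  (58, 222, [Turn 1 10 4], [Turn 1 10 4]), (63, 145, [Turn 10 11 4], [Turn 10 11 4]), (69, 281, [Turn 1 44
  109], [Turn 1 44 109]), (71, 250, [Turn 13 14 12], [Turn 13 14 12]), (78, 276, [Turn 19 15 39], [Turn 19 15
  39])], []), (11, 49, [(78, 247, [Turn 1 31 93], [Turn 1 31 93])], []), (3, 50, [(55, 98, [Turn 17 10 179],
  [Turn 17 10 179]), (67, 203, [Turn 5 19 172], [Turn 5 19 172]), (67, 266, [Turn 1 35 92], [Turn 1 35 92])],
  []), (17, 50, [(52, 88, [Turn (-1) 11 9], [Turn (-1) 11 9]), (64, 117, [Turn (-5) 11 80], [Turn (-5) 11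
  80]), (65, 147, [Turn 2 11 32], [Turn 2 11 32]), (72, 180, [Turn 5 9 17], [Turn 5 9 17])], []), (5, 50,
  [(62, 149, [Turn 1 24 28], [Turn 1 24 28])], []), (3, 50, [(52, 191, [Turn 356 7 323, Turn 8 13 20], [Turn
  356 7 323, Turn 8 13 20]), (64, 293, [Turn 29 28 151], [Turn 29 28 151])], []), (7, 50, [(51, 137, [Turn
  (-1) 12 12], [Turn (-1) 12 12])], []), (1, 50, [(55, 99, [Turn (-3) 10 60], [Turn (-3) 10 60]), (65, 101,
  [Turn 1 59 16], [Turn 1 59 16]), (71, 184, [Turn 1 9 3], [Turn 1 9 3]), (78, 139, [Turn 13 12 25], [Turn 13
  12 25])], []), (3, 50, [(58, 107, [Turn 23 22 17], [Turn 23 22 17]), (67, 116, [Turn 4 23 242], [Turn 4 23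
  242])], []), (5, 51, [(55, 297, [Turn (-7) 9 92], [Turn (-7) 9 92]), (68, 103, [Turn (-1) 13 33], [Turn (-1)
  13 33]), (68, 283, [Turn 17 19 91], [Turn 17 19 91]), (72, 124, [Turn 11 19 18], [Turn 11 19 18])], []), (1,
  51, [(56, 149, [Turn (-7) 9 18], [Turn (-7) 9 18]), (64, 103, [Turn 1 36 62], [Turn 1 36 62]), (74, 215,
  [Turn 6 11 31], [Turn 6 11 31])], []), (3, 51, [(52, 230, [Turn (-1) 28 20], [Turn (-1) 28 20])], []), (11,
  51, [], []), (7, 51, [(58, 200, [Turn (-1) 12 18], [Turn (-1) 12 18]), (66, 265, [Turn 15 13 68], [Turn 15
  13 68])], []), (3, 51, [], []), (1, 51, [(53, 135, [Turn 1 18 21], [Turn 1 18 21]), (53, 254, [Turn 47 48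
  11], [Turn 47 48 11]), (57, 103, [Turn 16 17 18], [Turn 16 17 18]), (57, 128, [Turn 3 19 67], [Turn 3 19
  67]), (59, 286, [Turn 27 28 38], [Turn 27 28 38]), (65, 294, [Turn 5 13 62], [Turn 5 13 62])], [])]"
  by code_simp

lemma check_norms_349:
  "check_norms 349 381 [
  (1, 52, [(64, 287, [Turn 16 11 146], [Turn 16 11 146])], []), (3, 52, [], []), (1, 52, [(57, 274, [Turn (-5)
  9 91], [Turn (-5) 9 91]), (58, 160, [Turn (-5) 11 53], [Turn (-5) 11 53]), (60, 105, [Turn 20 17 97], [Turn
  20 17 97]), (60, 130, [Turn (-1) 19 48], [Turn (-1) 19 48]), (64, 248, [Turn 9 10 10], [Turn 9 10 10]), (65,
  259, [Turn 2 15 53], [Turn 2 15 53]), (78, 94, [Turn (-2) 15 16], [Turn (-2) 15 16])], []), (5, 52, [(57,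
  149, [Turn 13 12 18], [Turn 13 12 18]), (78, 198, [Turn 7 9 23], [Turn 7 9 23])], []), (3, 52, [], []), (1,
  52, [(56, 280, [Turn 7 9 14], [Turn 7 9 14]), (60, 99, [Turn 12 11 17], [Turn 12 11 17]), (62, 81, [Turn 11
  9 9], [Turn 11 9 9]), (72, 164, [Turn 9 11 4], [Turn 9 11 4])], []), (19, 52, [(53, 262, [Turn (-6) 11 45],
  [Turn (-6) 11 45]), (55, 163, [Turn (-1) 31 149], [Turn (-1) 31 149]), (57, 101, [Turn 13 18 46], [Turn 13
  18 46]), (60, 159, [Turn 17 16 32], [Turn 17 16 32]), (65, 166, [Turn 34 35 62], [Turn 34 35 62]), (66, 265,
  [Turn 4 15 102], [Turn 4 15 102]), (66, 282, [Turn 11 9 30], [Turn 11 9 30])], []), (3, 53, [(67, 236, [Turn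
  1 20 40], [Turn 1 20 40])], []), (5, 53, [(63, 133, [Turn 3 11 4], [Turn 3 11 4]), (65, 232, [Turn (-3) 11
  77], [Turn (-3) 11 77]), (67, 284, [Turn 1 9 5], [Turn 1 9 5]), (68, 113, [Turn 9 13 25], [Turn 9 13 25])],
  []), (1, 53, [(61, 99, [Turn 17 15 80], [Turn 17 15 80]), (61, 324, [Turn 3 17 85], [Turn 3 17 85]), (66,
  289, [Turn 9 14 8], [Turn 9 14 8]), (67, 153, [Turn 1 12 8], [Turn 1 12 8]), (68, 302, [Turn (-4) 17 113],
  [Turn (-4) 17 113])], []), (3, 53, [], []), (7, 53, [(54, 290, [Turn 13 9 61], [Turn 13 9 61]), (68, 171,
  [Turn 23 24 34], [Turn 23 24 34])], []), (1, 53, [(69, 291, [Turn 8 9 7], [Turn 8 9 7]), (71, 113, [Turn 11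
  10 8], [Turn 11 10 8])], []), (3, 53, [], []), (13, 53, [(64, 267, [Turn 15 17 51], [Turn 15 17 51]), (64,
  296, [Turn 22 23 32], [Turn 22 23 32]), (64, 335, [Turn (-1) 9 15], [Turn (-1) 9 15])], []), (1, 54, [(62,
  174, [Turn 45 46 55], [Turn 45 46 55]), (64, 335, [Turn 10 17 119], [Turn 10 17 119]), (72, 309, [Turn 17 16
  43], [Turn 17 16 43])], [])]"
  by code_simp

lemma check_norms_381:
  "check_norms 381 421 [
  (3, 54, [(67, 224, [Turn 40 41 71], [Turn 40 41 71])], []), (1, 54, [(57, 106, [Turn 17 11 46], [Turn 17 11
  46]), (57, 267, [Turn 2 33 174], [Turn 2 33 174]), (63, 216, [Turn 56 57 8], [Turn 56 57 8]), (67, 279,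
  [Turn 5 11 39], [Turn 5 11 39])], []), (5, 54, [(63, 173, [Turn 46 47 60], [Turn 46 47 60])], []), (3, 54,
  [(61, 245, [Turn 11 19 227], [Turn 11 19 227])], []), (1, 54, [(57, 345, [Turn (-7) 9 82], [Turn (-7) 9
  82]), (59, 115, [Turn 57 58 13], [Turn 57 58 13]), (63, 86, [Turn (-4) 9 68], [Turn (-4) 9 68]), (67, 161,
  [Turn 1 29 44], [Turn 1 29 44]), (68, 151, [Turn 18 13 17], [Turn 18 13 17]), (71, 163, [Turn 11 12 12],
  [Turn 11 12 12]), (74, 302, [Turn (-5) 9 107], [Turn (-5) 9 107]), (78, 329, [Turn (-2) 13 19], [Turn (-2)
  13 19])], []), (17, 54, [(54, 176, [Turn 1 20 14], [Turn 1 20 14]), (60, 301, [Turn 3 13 41], [Turn 3 13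
  41]), (63, 242, [Turn (-1) 21 60], [Turn (-1) 21 60]), (69, 309, [Turn 6 19 189], [Turn 6 19 189]), (72,
  333, [Turn 13 20 16], [Turn 13 20 16])], []), (3, 55, [(55, 137, [Turn 25 26 39], [Turn 25 26 39]), (58,
  107, [Turn (-2) 11 8], [Turn (-2) 11 8]), (58, 179, [Turn 4 11 19], [Turn 4 11 19]), (61, 269, [Turn 2 19
  47], [Turn 2 19 47])], []), (5, 55, [(57, 164, [Turn (-7) 12 213], [Turn (-7) 12 213]), (72, 154, [Turn 1 59
  29], [Turn 1 59 29])], []), (1, 55, [(58, 344, [Turn (-1) 15 20], [Turn (-1) 15 20]), (65, 91, [Turn 1 48
  62], [Turn 1 48 62]), (67, 287, [Turn 5 18 50], [Turn 5 18 50]), (69, 168, [Turn 1 26 49], [Turn 1 26 49]),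
  (69, 354, [Turn 10 9 3], [Turn 10 9 3]), (74, 253, [Turn 4 11 10], [Turn 4 11 10])], []), (3, 55, [], []),
  (1, 55, [(56, 182, [Turn (-3) 11 18], [Turn (-3) 11 18])], []), (13, 55, [(56, 356, [Turn 41 42 20], [Turn
  41 42 20]), (58, 147, [Turn 5 11 20], [Turn 5 11 20]), (58, 328, [Turn 9 16 107], [Turn 9 16 107]), (66,
  349, [Turn 21 22 33], [Turn 21 22 33])], []), (3, 55, [], []), (11, 55, [(58, 150, [Turn 1 19 18], [Turn 1
  19 18]), (71, 285, [Turn 1 10 4], [Turn 1 10 4])], []), (1, 56, [(57, 88, [Turn 46 47 12], [Turn 46 47 12]),
  (57, 151, [Turn 6 19 49], [Turn 6 19 49]), (65, 241, [Turn 7 17 92], [Turn 7 17 92]), (72, 346, [Turn (-1)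
  13 17], [Turn (-1) 13 17])], []), (3, 56, [], []), (7, 56, [(59, 160, [Turn 15 13 42], [Turn 15 13 42]),
  (59, 181, [Turn 38 39 26], [Turn 38 39 26]), (61, 171, [Turn 16 17 20], [Turn 16 17 20]), (62, 338, [Turn 1
  11 6], [Turn 1 11 6]), (62, 359, [Turn 16 15 24], [Turn 16 15 24])], []), (5, 56, [(63, 323, [Turn 2 9 4],
  [Turn 2 9 4]), (78, 268, [Turn 17 14 11], [Turn 17 14 11])], []), (3, 56, [], []), (1, 56, [(57, 176, [Turn
  1 50 18], [Turn 1 50 18]), (57, 308, [Turn 11 15 6], [Turn 11 15 6]), (60, 128, [Turn 34 33 169], [Turn 34
  33 169]), (61, 323, [Turn 1 48 16], [Turn 1 48 16])], [])]"
  by code_simp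

lemma check_norms_421:
  "check_norms 421 453 [
  (1, 56, [(62, 192, [Turn 7 11 23], [Turn 7 11 23]), (65, 332, [Turn 17 14 90], [Turn 17 14 90]), (67, 365,
  [Turn 2 15 39], [Turn 2 15 39]), (68, 247, [Turn 17 12 15], [Turn 17 12 15]), (78, 186, [Turn (-10) 9 247],
  [Turn (-10) 9 247])], []), (3, 56, [(64, 347, [Turn 10 11 8], [Turn 10 11 8]), (67, 134, [Turn 8 19 26],
  [Turn 8 19 26])], []), (5, 57, [], []), (7, 57, [(58, 130, [Turn 1 23 17], [Turn 1 23 17]), (59, 300, [Turn
  11 10 13], [Turn 11 10 13]), (72, 165, [Turn 10 13 28], [Turn 10 13 28])], []), (3, 57, [(58, 95, [Turn 95 1
  95, Turn 2 25 53], [Turn 95 1 95, Turn 2 25 53]), (58, 194, [Turn 19 20 18], [Turn 19 20 18])], []), (1, 57,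
  [(72, 96, [Turn 2 9 15], [Turn 2 9 15]), (78, 267, [Turn 4 21 211], [Turn 4 21 211]), (78, 385, [Turn 17 9
  193], [Turn 17 9 193])], []), (1, 57, [(59, 101, [Turn 14 13 10], [Turn 14 13 10]), (60, 191, [Turn (-1) 34
  186], [Turn (-1) 34 186]), (62, 158, [Turn 6 11 24], [Turn 6 11 24]), (68, 195, [Turn 3 20 21], [Turn 3 20
  21])], []), (3, 57, [(67, 254, [Turn 73 2 388, Turn 4 29 41], [Turn 73 2 388, Turn 4 29 41])], []), (19, 57,
  [(72, 257, [Turn (-1) 17 43], [Turn (-1) 17 43]), (72, 395, [Turn 1 52 65], [Turn 1 52 65]), (78, 340, [Turn
  1 9 5], [Turn 1 9 5])], []), (1, 57, [(63, 323, [Turn 16 15 12], [Turn 16 15 12]), (74, 199, [Turn (-6) 11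
  121], [Turn (-6) 11 121]), (74, 371, [Turn (-6) 13 19], [Turn (-6) 13 19]), (74, 382, [Turn 52 53 82], [Turn
  52 53 82])], []), (3, 58, [(61, 101, [Turn 17 22 73], [Turn 17 22 73])], []), (1, 58, [(58, 198, [Turn 10 9
  4], [Turn 10 9 4]), (60, 323, [Turn 9 11 5], [Turn 9 11 5]), (62, 391, [Turn 2 17 14], [Turn 2 17 14]), (67,
  365, [Turn 3 17 84], [Turn 3 17 84])], []), (5, 58, [(63, 123, [Turn 18 11 19], [Turn 18 11 19]), (68, 393,
  [Turn 41 42 37], [Turn 41 42 37])], []), (3, 58, [(58, 350, [Turn 4 23 68], [Turn 4 23 68]), (64, 347, [Turn
  29 31 119], [Turn 29 31 119]), (67, 302, [Turn (-1) 37 26], [Turn (-1) 37 26])], []), (1, 58, [(64, 98,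
  [Turn 9 23 361], [Turn 9 23 361]), (72, 262, [Turn 1 12 10], [Turn 1 12 10])], []), (11, 58, [(71, 197,
  [Turn 21 23 43], [Turn 21 23 43]), (74, 162, [Turn 13 14 19], [Turn 13 14 19])], [])]"
  by code_simp

lemma check_norms_453:
  "check_norms 453 493 [
  (3, 58, [(58, 143, [Turn (-1) 19 53], [Turn (-1) 19 53])], []), (5, 58, [(58, 263, [Turn 34 33 172], [Turn
  34 33 172]), (58, 368, [Turn 33 31 134], [Turn 33 31 134])], []), (1, 59, [(63, 268, [Turn 17 12 13], [Turn
  17 12 13]), (64, 356, [Turn 5 9 21], [Turn 5 9 21]), (74, 335, [Turn (-2) 15 77], [Turn (-2) 15 77])], []),
  (3, 59, [(61, 398, [Turn 38 37 119], [Turn 38 37 119])], []), (1, 59, [(61, 100, [Turn 17 14 22], [Turn 17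
  14 22]), (72, 284, [Turn 4 13 57], [Turn 4 13 57]), (78, 99, [Turn 3 14 56], [Turn 3 14 56]), (78, 208,
  [Turn 11 20 296], [Turn 11 20 296])], []), (1, 59, [(61, 323, [Turn 21 23 22], [Turn 21 23 22]), (69, 126,
  [Turn (-3) 11 32], [Turn (-3) 11 32]), (74, 204, [Turn 23 16 383], [Turn 23 16 383])], []), (3, 59, [], []),
  (1, 59, [(64, 194, [Turn (-7) 12 202], [Turn (-7) 12 202])], []), (7, 59, [], []), (3, 59, [(61, 371, [Turn
  13 14 7], [Turn 13 14 7]), (64, 143, [Turn 1 56 23], [Turn 1 56 23]), (64, 152, [Turn 2 31 80], [Turn 2 31
  80])], []), (11, 60, [(67, 335, [Turn 19 17 71], [Turn 19 17 71]), (67, 346, [Turn 9 26 139, Turn (-16) 11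
  169, Turn 3 37 180], [Turn 9 26 139, Turn (-16) 11 169, Turn 3 37 180]), (74, 328, [Turn 7 13 37], [Turn 7
  13 37]), (74, 371, [Turn 1 51 82], [Turn 1 51 82])], []), (5, 60, [(67, 369, [Turn (-4) 9 7], [Turn (-4) 9
  7])], []), (3, 60, [], []), (1, 60, [(63, 210, [Turn 54 55 10], [Turn 54 55 10]), (68, 212, [Turn (-8) 9
  38], [Turn (-8) 9 38]), (78, 269, [Turn 19 25 186], [Turn 19 25 186])], []), (13, 60, [(71, 211, [Turn 9 16
  129], [Turn 9 16 129]), (71, 433, [Turn 1 10 10], [Turn 1 10 10])], []), (3, 60, [], []), (5, 60, [(65, 187,
  [Turn 6 13 52], [Turn 6 13 52])], []), (1, 60, [], []), (3, 60, [], []), (1, 61, [(62, 380, [Turn 56 57 6],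
  [Turn 56 57 6]), (74, 433, [Turn 23 25 116], [Turn 23 25 116])], [])]"
  by code_simp

lemma check_norms_493:
  "check_norms 493 535 [
  (17, 61, [(64, 151, [Turn 22 23 23], [Turn 22 23 23]), (64, 219, [Turn (-1) 9 10], [Turn (-1) 9 10]), (68,
  345, [Turn (-1) 10 5], [Turn (-1) 10 5])], []), (3, 61, [], []), (7, 61, [(69, 387, [Turn 4 9 3], [Turn 4 9
  3])], []), (1, 61, [(67, 386, [Turn 9 22 303], [Turn 9 22 303]), (74, 450, [Turn 9 10 2], [Turn 9 10 2]),
  (78, 449, [Turn (-1) 10 17], [Turn (-1) 10 17])], []), (3, 61, [(67, 368, [Turn (-31) 4 152, Turn 53 55
  116], [Turn (-31) 4 152, Turn 53 55 116])], []), (1, 61, [(68, 295, [Turn 19 12 195], [Turn 19 12 195]),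
  (68, 446, [Turn 27 26 45], [Turn 27 26 45]), (69, 116, [Turn (-1) 13 20], [Turn (-1) 13 20]), (69, 424,
  [Turn 8 19 167], [Turn 8 19 167])], []), (5, 61, [(68, 213, [Turn 7 19 187], [Turn 7 19 187])], []), (3, 62,
  [], []), (1, 62, [(62, 456, [Turn 1 48 21], [Turn 1 48 21]), (63, 109, [Turn (-1) 14 11], [Turn (-1) 14
  11]), (78, 375, [Turn (-1) 19 56], [Turn (-1) 19 56])], []), (7, 62, [(68, 297, [Turn 22 19 38], [Turn 22 19
  38]), (69, 422, [Turn 20 17 18], [Turn 20 17 18])], []), (3, 62, [(67, 350, [Turn 5 22 50], [Turn 5 22
  50])], []), (5, 62, [(65, 107, [Turn 33 34 53], [Turn 33 34 53]), (67, 139, [Turn 9 26 346], [Turn 9 26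
  346])], []), (11, 62, [], []), (3, 62, [], []), (1, 62, [(63, 402, [Turn 16 13 19], [Turn 16 13 19]), (64,
  114, [Turn 1 32 41], [Turn 1 32 41]), (64, 427, [Turn 8 11 6], [Turn 8 11 6]), (67, 380, [Turn 12 11 8],
  [Turn 12 11 8])], []), (1, 62, [(62, 431, [Turn 44 45 21], [Turn 44 45 21]), (62, 443, [Turn 6 13 5], [Turn
  6 13 5]), (68, 304, [Turn 23 19 38], [Turn 23 19 38]), (78, 243, [Turn 21 13 247], [Turn 21 13 247])], []),
  (3, 63, [], []), (17, 63, [], []), (23, 63, [(64, 159, [Turn 3 10 21], [Turn 3 10 21]), (65, 388, [Turn 1 15
  14], [Turn 1 15 14]), (66, 98, [Turn 1 27 20], [Turn 1 27 20]), (78, 156, [Turn 7 17 10], [Turn 7 17 10])],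
  []), (3, 63, [(64, 419, [Turn 46 47 41], [Turn 46 47 41])], []), (13, 63, [(64, 125, [Turn (-7) 17 287],
  [Turn (-7) 17 287]), (64, 166, [Turn 43 42 242], [Turn 43 42 242]), (64, 371, [Turn 5 23 202], [Turn 5 23
  202]), (66, 193, [Turn 1 58 30], [Turn 1 58 30]), (71, 238, [Turn 10 9 4], [Turn 10 9 4]), (71, 484, [Turn
  31 32 24], [Turn 31 32 24])], [])]"
  by code_simp

lemma check_norms_535:
  "check_norms 535 577 [
  (5, 63, [(67, 159, [Turn (-2) 37 390], [Turn (-2) 37 390]), (67, 454, [Turn 17 13 44], [Turn 17 13 44]),
  (68, 198, [Turn 17 19 15], [Turn 17 19 15]), (78, 423, [Turn 12 19 193], [Turn 12 19 193])], []), (3, 63,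
  [(64, 236, [Turn 17 16 23], [Turn 17 16 23])], []), (7, 63, [(63, 229, [Turn 25 26 12], [Turn 25 26 12]),
  (63, 376, [Turn 24 23 38], [Turn 24 23 38]), (66, 314, [Turn (-5) 12 116], [Turn (-5) 12 116]), (68, 388,
  [Turn (-2) 25 126], [Turn (-2) 25 126])], []), (1, 63, [(63, 207, [Turn 19 21 60], [Turn 19 21 60]), (64,
  347, [Turn 19 25 228], [Turn 19 25 228])], []), (3, 64, [(64, 188, [Turn 1 26 5], [Turn 1 26 5])], []), (5,
  64, [(65, 122, [Turn 8 9 4], [Turn 8 9 4])], []), (1, 64, [(64, 487, [Turn 7 9 8], [Turn 7 9 8]), (71, 129,
  [Turn 46 47 31], [Turn 46 47 31])], []), (3, 64, [], []), (19, 64, [], []), (7, 64, [(65, 123, [Turn 1 9 4],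
  [Turn 1 9 4]), (72, 312, [Turn 15 16 11], [Turn 15 16 11]), (72, 501, [Turn (-52) 1 561, Turn (-11) 12 29],
  [Turn (-52) 1 561, Turn (-11) 12 29])], []), (3, 64, [(67, 449, [Turn 19 26 44], [Turn 19 26 44])], []), (1,
  64, [(66, 130, [Turn 1 30 23], [Turn 1 30 23]), (71, 405, [Turn (-1) 11 12], [Turn (-1) 11 12]), (78, 121,
  [Turn (-2) 23 55], [Turn (-2) 23 55])], []), (13, 64, [(64, 257, [Turn 19 24 163], [Turn 19 24 163]), (74,
  457, [Turn 37 38 25], [Turn 37 38 25])], []), (3, 65, [], []), (1, 65, [(66, 444, [Turn 23 14 309], [Turn 23
  14 309]), (67, 216, [Turn (-7) 13 50], [Turn (-7) 13 50])], []), (5, 65, [], []), (3, 65, [], []), (1, 65,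
  [(69, 173, [Turn 42 43 57], [Turn 42 43 57]), (69, 493, [Turn (-2) 15 49], [Turn (-2) 15 49]), (72, 125,
  [Turn (-13) 9 291], [Turn (-13) 9 291])], []), (1, 65, [(69, 172, [Turn 7 10 3], [Turn 7 10 3]), (71, 133,
  [Turn 16 13 62], [Turn 16 13 62])], []), (3, 65, [(67, 134, [Turn 55 56 34], [Turn 55 56 34])], []), (5, 65,
  [(65, 227, [Turn 1 38 53], [Turn 1 38 53]), (72, 464, [Turn 9 31 91, Turn 91 1 91], [Turn 9 31 91, Turn 91 1
  91])], [])]"
  by code_simp

lemma check_norms_577:
  "check_norms 577 619 [
  (1, 65, [(72, 208, [Turn 7 25 29], [Turn 7 25 29])], []), (3, 66, [], []), (7, 66, [], []), (11, 66, [(68,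
  179, [Turn (-5) 13 21], [Turn (-5) 13 21]), (69, 128, [Turn 1 41 57], [Turn 1 41 57]), (74, 328, [Turn 1 16
  13], [Turn 1 16 13]), (74, 404, [Turn 5 13 52], [Turn 5 13 52])], []), (3, 66, [], []), (1, 66, [(72, 178,
  [Turn 19 10 144], [Turn 19 10 144])], []), (19, 66, [(66, 132, [Turn 10 9 6], [Turn 10 9 6]), (66, 225,
  [Turn 13 21 213], [Turn 13 21 213]), (66, 246, [Turn 7 12 40], [Turn 7 12 40]), (78, 245, [Turn (-5) 12 11],
  [Turn (-5) 12 11])], []), (3, 66, [], []), (1, 66, [(72, 129, [Turn 2 23 29], [Turn 2 23 29])], []), (5, 66,
  [], []), (3, 67, [], []), (1, 67, [(68, 184, [Turn 35 36 23], [Turn 35 36 23]), (69, 162, [Turn 19 26 125],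
  [Turn 19 26 125])], []), (1, 67, [], []), (3, 67, [(67, 476, [Turn (-1) 19 39], [Turn (-1) 19 39])], []),
  (5, 67, [(68, 443, [Turn 23 26 33], [Turn 23 26 33])], []), (1, 67, [], []), (3, 67, [], []), (13, 67, [],
  []), (1, 67, [], []), (3, 67, [(67, 554, [Turn (-61) 1 720, Turn (-12) 13 25], [Turn (-61) 1 720, Turn (-12)
  13 25])], []), (1, 68, [(69, 504, [Turn (-9) 11 60], [Turn (-9) 11 60]), (72, 138, [Turn 8 9 4], [Turn 8 9
  4]), (74, 193, [Turn 3 16 63], [Turn 3 16 63]), (78, 140, [Turn (-5) 22 265], [Turn (-5) 22 265])], [])]"
  by code_simp

lemma check_norms_619:
  "check_norms 619 663 [
  (1, 68, [(69, 550, [Turn (-2) 9 10], [Turn (-2) 9 10]), (72, 260, [Turn 1 50 49], [Turn 1 50 49])], []), (3,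
  68, [], []), (7, 68, [], []), (5, 68, [(72, 139, [Turn 1 9 4], [Turn 1 9 4])], []), (3, 68, [], []), (17,
  68, [], []), (1, 68, [], []), (3, 68, [], []), (5, 68, [(72, 124, [Turn 34 31 154], [Turn 34 31 154])], []),
  (7, 69, [], []), (3, 69, [], []), (1, 69, [(74, 115, [Turn (-2) 39 164], [Turn (-2) 39 164])], []), (1, 69,
  [(69, 194, [Turn 11 10 5], [Turn 11 10 5])], []), (3, 69, [], []), (1, 69, [(74, 574, [Turn 33 35 121],
  [Turn 33 35 121])], []), (11, 69, [], []), (3, 69, [], []), (1, 69, [(78, 142, [Turn 1 23 25], [Turn 1 23
  25])], []), (5, 70, [], []), (3, 70, [], []), (1, 70, [(78, 481, [Turn 19 11 107], [Turn 19 11 107])], []),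
  (1, 70, [(74, 521, [Turn 23 14 296], [Turn 23 14 296])], [])]"
  by code_simp

lemma check_norms_663:
  "check_norms 663 721 [
  (3, 70, [], []), (5, 70, [(72, 599, [Turn (-66) 1 845, Turn (-13) 14 27], [Turn (-66) 1 845, Turn (-13) 14
  27])], []), (23, 70, [(72, 579, [Turn 14 15 10], [Turn 14 15 10])], []), (3, 70, [], []), (11, 70, [], []),
  (1, 70, [(74, 158, [Turn 29 30 31], [Turn 29 30 31])], []), (3, 71, [], []), (1, 71, [(71, 489, [Turn 1 18
  9], [Turn 1 18 9]), (78, 120, [Turn 9 17 93], [Turn 9 17 93])], []), (7, 71, [], []), (3, 71, [], []), (1,
  71, [(72, 151, [Turn (-7) 9 23], [Turn (-7) 9 23])], []), (5, 71, [(72, 314, [Turn 1 24 17], [Turn 1 24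
  17]), (78, 148, [Turn 17 14 19], [Turn 17 14 19])], []), (3, 71, [], []), (13, 71, [(74, 561, [Turn 19 16
  58], [Turn 19 16 58])], []), (1, 71, [], []), (3, 71, [], []), (5, 72, [], []), (17, 72, [], []), (3, 72,
  [], []), (1, 72, [], []), (19, 72, [(72, 313, [Turn 5 9 10], [Turn 5 9 10]), (78, 454, [Turn 43 45 245],
  [Turn 43 45 245])], []), (3, 72, [], []), (7, 72, [], []), (1, 72, [(72, 260, [Turn 1 30 18], [Turn 1 30
  18])], []), (3, 72, [], []), (23, 72, [(78, 524, [Turn 17 15 9], [Turn 17 15 9])], []), (5, 72, [], []), (3,
  73, [], []), (1, 73, [], [])]"
  by code_simp

lemma check_norms_721:
  "check_norms 721 777 [
  (7, 73, [], []), (3, 73, [], []), (5, 73, [], []), (1, 73, [], []), (3, 73, [], []), (17, 73, [(78, 279,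
  [Turn 11 21 175], [Turn 11 21 175])], []), (1, 73, [], []), (3, 73, [], []), (11, 74, [(74, 130, [Turn (-1)
  17 13], [Turn (-1) 17 13])], []), (1, 74, [], []), (3, 74, [], []), (1, 74, [], []), (5, 74, [], []), (3,
  74, [], []), (7, 74, [], []), (1, 74, [], []), (3, 74, [], []), (5, 74, [(78, 153, [Turn 153 1 153, Turn 15
  46 645], [Turn 153 1 153, Turn 15 46 645]), (78, 343, [Turn (-2) 11 28], [Turn (-2) 11 28]), (78, 488, [Turn
  28 31 116], [Turn 28 31 116])], []), (1, 75, [(78, 482, [Turn 3 11 23], [Turn 3 11 23])], []), (3, 75, [],
  []), (1, 75, [], []), (7, 75, [], []), (3, 75, [], []), (13, 75, [], []), (1, 75, [(78, 174, [Turn 39 40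
  56], [Turn 39 40 56])], []), (3, 75, [], []), (1, 75, [], []), (5, 75, [], [])]"
  by code_simp

lemma check_norms_777:
  "check_norms 777 845 [
  (3, 75, [], []), (19, 76, [], []), (11, 76, [], []), (3, 76, [], []), (5, 76, [(78, 218, [Turn (-1) 18 25],
  [Turn (-1) 18 25]), (78, 313, [Turn 154 3 1572, Turn 29 45 645], [Turn 154 3 1572, Turn 29 45 645])], []),
  (1, 76, [], []), (3, 76, [], []), (7, 76, [], []), (13, 76, [], []), (3, 76, [], []), (1, 76, [], []), (17,
  76, [], []), (3, 77, [], []), (11, 77, [], []), (5, 77, [], []), (3, 77, [], []), (1, 77, [(78, 295, [Turn 9
  11 7], [Turn 9 11 7]), (78, 337, [Turn (-1) 12 7], [Turn (-1) 12 7])], []), (1, 77, [], []), (3, 77, [],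
  []), (5, 77, [(78, 173, [Turn 4 33 125], [Turn 4 33 125])], []), (19, 77, [(78, 150, [Turn 16 11 9], [Turn
  16 11 9])], []), (3, 77, [], []), (1, 77, [], []), (1, 78, [(78, 529, [Turn (-1) 14 18], [Turn (-1) 14
  18])], []), (3, 78, [], []), (1, 78, [], []), (1, 78, [], []), (3, 78, [], []), (7, 78, [], []), (5, 78, [],
  []), (3, 78, [], []), (1, 78, [], []), (29, 78, [], []), (3, 78, [], [])]"
  by code_simp

text \<open>The blocks abut; each ends at the odd number that starts the next, and the last at 845,
  just past the greatest norm.\<close>

lemma scanned_le_843:
  assumes "3 \<le> d" "d \<le> 843" "odd d"
  shows "scanned d"
proof -
  have "scanned_below 3" by (simp add: scanned_below_def)
  then have "scanned_below 29" by (rule scanned_below_extend[OF _ check_norms_3]) simp_all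
  then have "scanned_below 71" by (rule scanned_below_extend[OF _ check_norms_29]) simp_all
  then have "scanned_below 115" by (rule scanned_below_extend[OF _ check_norms_71]) simp_all
  then have "scanned_below 157" by (rule scanned_below_extend[OF _ check_norms_115]) simp_all
  then have "scanned_below 195" by (rule scanned_below_extend[OF _ check_norms_157]) simp_all
  then have "scanned_below 235" by (rule scanned_below_extend[OF _ check_norms_195]) simp_all
  then have "scanned_below 273" by (rule scanned_below_extend[OF _ check_norms_235]) simp_all
  then have "scanned_below 309" by (rule scanned_below_extend[OF _ check_norms_273]) simp_all
  then have "scanned_below 349" by (rule scanned_below_extend[OF _ check_norms_309]) simp_all
  then have "scanned_below 381" by (rule scanned_below_extend[OF _ check_norms_349]) simp_all
  then have "scanned_below 421" by (rule scanned_below_extend[OF _ check_norms_381]) simp_all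
  then have "scanned_below 453" by (rule scanned_below_extend[OF _ check_norms_421]) simp_all
  then have "scanned_below 493" by (rule scanned_below_extend[OF _ check_norms_453]) simp_all
  then have "scanned_below 535" by (rule scanned_below_extend[OF _ check_norms_493]) simp_all
  then have "scanned_below 577" by (rule scanned_below_extend[OF _ check_norms_535]) simp_all
  then have "scanned_below 619" by (rule scanned_below_extend[OF _ check_norms_577]) simp_all
  then have "scanned_below 663" by (rule scanned_below_extend[OF _ check_norms_619]) simp_all
  then have "scanned_below 721" by (rule scanned_below_extend[OF _ check_norms_663]) simp_all
  then have "scanned_below 777" by (rule scanned_below_extend[OF _ check_norms_721]) simp_all
  then have "scanned_below 845" by (rule scanned_below_extend[OF _ check_norms_777]) simp_all
  then show ?thesis using assms by (simp add: scanned_below_def)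
qed

section \<open>Conclusion\<close>

text \<open>Induction on d for both flags at once, since the turn that lowers d also transposes.
  Where no single turn does so, the tabulated chain may pass through larger d or through other
  traces before it ends at something known.\<close>

lemma node_good:
  assumes n: "admissible n" and kn: "\<And>m. known_trace n m \<Longrightarrow> all_good m"
    and "0 < d" "norm_bound n d" "(c, d, n) \<in> CS_triples"
  shows "std_good p c d n"
  using assms(3-5)
proof (induction "nat d" arbitrary: c d p rule: less_induct)
  case less
  have d: "d dvd fpoly n c" using less.prems by (simp add: CS_triples_def)
  then have odd: "odd d" using fpoly_odd[of n c] dvd_trans by blast
  show ?case
  proof (cases "d = 1")
    case True
    have t: "(x, 1, n) \<in> CS_triples" for x by (simp add: CS_triples_def)
    have Turn: "std_good True x 1 n" for x
      using gompf_equiv_unit[OF t] good_Xmat[OF t] by (simp add: std_good_def)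
    \<comment> \<open>With k = 0 and x = 1 the norm is -1, so this turn keeps d = 1 and removes the
      transposition.\<close>
    have "std_good False c 1 n \<longleftrightarrow> std_good (\<not> False) 0 1 n"
      by (rule turn[OF t, of 0 1]) (auto simp: gval_def)
    then show ?thesis using Turn True by (cases p) simp_all
  next
    case False
    then have d3: "3 \<le> d" using odd less.prems(1) by presburger
    have "d \<le> 843" using norm_bound_le_843[OF less.prems(2)] admissible_bounds[OF n] by simp
    then obtain tbl tb where sc: "\<And>c. 0 \<le> c \<Longrightarrow> c < d \<Longrightarrow> d dvd fpoly n c \<Longrightarrow>
        descends d (d * d) n c 1 c \<or> lookup_chains n d d tbl n c"
      using scanned_le_843[OF d3 _ odd] n less.prems(2) unfolding scanned_def by blast
    \<comment> \<open>The tables list roots in the range from 0 to d - 1.\<close>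
    define c0 where "c0 = c mod d"
    have "d dvd c0 - c" unfolding c0_def by (metis dvd_minus_mod minus_diff_eq dvd_minus_iff)
    note sh = Xmat_shift[OF less.prems(3) this]
    have c0: "0 \<le> c0" "c0 < d" "d dvd fpoly n c0"
      using less.prems(1) sh(1) by (auto simp: c0_def CS_triples_def)
    have low: "std_good p c e n" if "0 < e" "e < d" "(c, e, n) \<in> CS_triples" for c e p
      by (rule less.hyps) (use that less.prems norm_bound_mono in auto)
    have "std_good p c0 d n"
    proof (cases "lookup_chains n d d tbl n c0")
      case True
      then show ?thesis by (rule lookup_chains_sound[OF _ sh(1) less.prems(1) low kn])
    next
      case False
      then have "descends d (d * d) n c0 1 c0" using sc[OF c0] by simp
      then obtain k x where kx: "coprime k x" "d dvd x * c0 - k" "\<bar>gval n k x\<bar> < d * d"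
        using descends_sound by fastforce
      obtain e where e: "\<bar>gval n k x\<bar> = e * d"
        using dvd_gval[OF kx(2) c0(3)] by (metis dvd_abs_iff dvd_def mult.commute)
      have "e * d \<noteq> 0" unfolding e[symmetric] using gval_odd[OF kx(1), of n] by auto
      moreover have "0 \<le> e * d" unfolding e[symmetric] by simp
      ultimately have e0: "0 < e" using less.prems(1) by (simp add: zero_le_mult_iff)
      have ed: "e < d" using kx(3) less.prems(1) unfolding e by (simp add: mult_less_cancel_right)
      have "\<bar>gval n k x\<bar> = \<bar>e * d\<bar>" using e by simp
      from turn_exists[OF sh(1) kx(1,2) this] obtain c'
        where c': "(c', e, n) \<in> CS_triples" "\<And>p. std_good p c0 d n \<longleftrightarrow> std_good (\<not> p) c' e n" by blast
      then show ?thesis using low[OF e0 ed c'(1)] by blast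
    qed
    then show ?thesis using std_good_similar[OF sh(2)] by simp
  qed
qed

text \<open>By now every triple within the norm bound is good for this trace, so it is enough that
  \<open>nc_loop\<close> finds an index within the bound or supplies chains for all lifts.\<close>

lemma nc_ok_all:
  assumes n: "admissible n" and kn: "\<And>m. known_trace n m \<Longrightarrow> all_good m"
    and g: "3 \<le> g" "odd g" and s: "0 < s" "odd s" "s dvd fpoly n t" and b: "norm_bound n (g * g * s)"
  shows "nc_ok n t s g"
proof -
  have low: "std_good p c d n" if "norm_bound n b" "0 < d" "d \<le> b" "(c, d, n) \<in> CS_triples" for b c d p
    using node_good[OF n kn that(2) norm_bound_mono[OF that(1,3)] that(4)] by blast
  show ?thesis
  proof (cases "s = 1")
    case True
    have "g * 1 \<le> g * g" using g by (intro mult_left_mono) auto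
    then have "norm_bound n g" using norm_bound_mono[OF b] True by simp
    then have "std_good p c g n" if "(c, g, n) \<in> CS_triples" for c p using low[of g g c p] that g by simp
    then show ?thesis unfolding nc_ok_def True
      \<comment> \<open>The norm of - \<theta> is -1, so x = 1, k = 0 give e = 1 and index g, which
        is below the bound for g^2.\<close>
      by (intro exI[of _ 1] exI[of _ 0]) (simp add: gval_def)
  next
    case False
    then have s3: "3 \<le> s" using s(1,2) by presburger
    have "1 * s \<le> g * g * s" using g s(1) by (intro mult_right_mono) (auto simp: mult_le_cancel_left1 intro: order_trans[of 1 g])
    then have bs: "norm_bound n s" using norm_bound_mono[OF b] by simp
    have "s \<le> 843" using norm_bound_le_843[OF bs] admissible_bounds[OF n] by simp
    then obtain tb where sc: "\<And>c. 0 \<le> c \<Longrightarrow> c < s \<Longrightarrow> s dvd fpoly n c \<Longrightarrow> nc_loop n c s tb 3"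
      using scanned_le_843[OF s3 _ s(2)] n bs unfolding scanned_def by blast
    define t0 where "t0 = t mod s"
    have dv: "s dvd t - t0" unfolding t0_def by simp
    then have dv': "s dvd t0 - t" by (simp add: dvd_diff_commute)
    have "(t, s, n) \<in> CS_triples" using s by (simp add: CS_triples_def)
    then have "s dvd fpoly n t0" using Xmat_shift(1)[OF _ dv'] by (simp add: CS_triples_def)
    then have "nc_loop n t0 s tb 3" using sc[of t0] s(1) by (simp add: t0_def)
    then have "nc_ok n t0 s g"
      by (rule nc_loop_sound[OF _ s(1) _ g(1) _ b low kn]) (use g in auto)
    moreover have "s dvd x * t - k" if "s dvd x * t0 - k" for x k
    proof -
      have "x * t - k = x * (t - t0) + (x * t0 - k)" by (simp add: algebra_simps)
      moreover have "s dvd x * (t - t0) + (x * t0 - k)" using dv that by simp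
      ultimately show ?thesis by (simp only:)
    qed
    ultimately show ?thesis unfolding nc_ok_def by blast
  qed
qed

text \<open>With |g| = 1 the first basis vector and its image (l, g, 0) span a primitive plane, so
  they extend to a standard basis directly.\<close>

lemma hess_unit_std:
  assumes CS: "CS_matrix M" and tr: "trace M = n" and M: "M = mk3 l al mu g be nu 0 s ta" and g: "\<bar>g\<bar> = 1"
  obtains c where "(c, - s, n) \<in> CS_triples" "similar_SL3 M (Xmat c (- s) n)"
proof -
  have gg: "g * g = 1" using g by (auto simp: abs_if split: if_splits)
  define Q where "Q = mk3 1 0 l 0 0 g 0 (- g) 0"
  have Q: "det Q = 1" using gg by (simp add: Q_def)
  have col: "(M ** Q) $ i $ 1 = Q $ i $ 3" for i
    using exhaust_3[of i] by (auto simp: M Q_def)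
  define N where "N = adj3 Q ** M ** Q"
  note std = std_of_basis[OF CS tr Q col, folded N_def]
  have "adj3 Q = mk3 1 (- l * g) 0 0 0 (- g) 0 g 0" using gg by (simp add: adj3_def Q_def)
  then have "N $ 2 $ 3 = - (g * g) * s" by (simp add: N_def M Q_def)
  then have "N $ 2 $ 3 = - s" by (simp add: gg)
  then show ?thesis using std(1,2) that by metis
qed

text \<open>The index bound yields a Hessenberg form of A or of its transpose, without saying which.
  Showing that both M and its transpose are good makes the distinction harmless.\<close>

lemma all_good_admissible:
  assumes "admissible n" shows "all_good n"
  using assms
proof (induction "nat n" arbitrary: n rule: less_induct)
  case less
  note n = less.prems
  have n3: "3 \<le> n" using admissible_bounds[OF n] by simp
  have kn: "all_good m" if k: "known_trace n m" for m
  proof (cases "m < 3")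
    case True
    then have "admissible (5 - m)" "5 - m < n" using k by (auto simp: known_trace_def split: if_splits)
    then have "all_good (5 - m)" using less.hyps[of "5 - m"] n3 by (simp add: True)
    then show ?thesis using all_good_Phi[of "5 - m"] by simp
  next
    case False
    then show ?thesis using k less.hyps[of m] n3 by (auto simp: known_trace_def split: if_splits)
  qed
  note node = node_good[OF n kn]
  show ?case unfolding all_good_def
  proof (intro allI impI)
    fix A :: mat3 assume A: "CS_matrix A" "trace A = n"
    obtain M where M: "similar_SL3 A M \<or> similar_SL3 (transpose A) M" "hess M" and b: "norm_bound n \<bar>hw M\<bar>"
    proof (cases "6 \<le> n")
      case True
      then show ?thesis using hess_bound_disc[OF A True] that
        by (metis norm_bound_def disc_def abs_mult_self_eq power2_eq_square)
    next
      case False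
      then have "n = 3 \<or> n = 4 \<or> n = 5" using n3 by auto
      then show ?thesis using hess_bound_small[OF A] that by (metis norm_bound_def)
    qed
    obtain l al mu g be nu z s ta where Mz: "M = mk3 l al mu g be nu z s ta" by (rule mk3_cases)
    have Me: "M = mk3 l al mu g be nu 0 s ta" using M(2) Mz by (simp add: hess_def)
    have CSM: "CS_matrix M" "trace M = n"
      using M(1) similar_CS A CS_transpose trace_transpose3 by metis+
    note odd = hess_nonzero[OF CSM Me]
    have s0: "0 < \<bar>s\<bar>" "s \<noteq> 0" "g \<noteq> 0" using odd by auto
    have b': "norm_bound n (\<bar>g\<bar> * \<bar>g\<bar> * \<bar>s\<bar>)" using b by (simp add: hw_def Me abs_mult)
    have both: "gompf_equiv_A0 M \<and> gompf_equiv_A0 (transpose M)"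
    proof (cases "\<bar>g\<bar> = 1")
      case True
      obtain c where c: "(c, - s, n) \<in> CS_triples" "similar_SL3 M (Xmat c (- s) n)"
        using hess_unit_std[OF CSM Me True] .
      have "std_good p c \<bar>- s\<bar> n" for p
        by (rule node) (use b' True s0 std_good_abs[OF c(1)] in auto)
      then have std_good: "std_good p c (- s) n" for p using std_good_abs[OF c(1)] by blast
      show ?thesis
        using std_good[of True] std_good[of False] good_similar[OF c(2)] good_similar[OF similar_transpose[OF c(2)]]
        by (simp add: std_good_def)
    next
      case False
      have g3: "3 \<le> \<bar>g\<bar>" using False odd(1) by presburger
      have "nc_ok n ta \<bar>s\<bar> \<bar>g\<bar>"
        by (rule nc_ok_all[OF n kn g3]) (use odd s0 b' in auto)
      then obtain x k e where e: "coprime e g" "coprime k x" "e * \<bar>s\<bar> = \<bar>gval n k x\<bar>" "s dvd x * ta - k"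
        and gd: "\<And>c p. (c, \<bar>g\<bar> * e, n) \<in> CS_triples \<Longrightarrow> e dvd x * c - k \<Longrightarrow> std_good p c (\<bar>g\<bar> * e) n"
        unfolding nc_ok_def by auto
      have "0 \<le> e * \<bar>s\<bar>" unfolding e(3) by simp
      then have epos: "0 \<le> e" using s0 by (simp add: zero_le_mult_iff)
      \<comment> \<open>The search works with |s| and absolute norms; the covector construction
        needs the signed cofactor of s.\<close>
      obtain e0 where e0: "s * e0 = gval n k x" "\<bar>e0\<bar> = e"
      proof -
        have "\<bar>gval n k x\<bar> = \<bar>s * e\<bar>" using e(3) epos by (simp add: abs_mult mult.commute)
        then have "gval n k x = s * e \<or> gval n k x = - (s * e)" by (simp add: abs_eq_iff)
        then show ?thesis using that[of e] that[of "- e"] epos by auto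
      qed
      obtain Y where Y: "x * ta - k = s * Y" using e(4) by blast
      then have kY: "k = ta * x - s * Y" by (simp add: algebra_simps)
      have "coprime e0 g" using e(1) e0(2) by auto
      from hessenberg_transpose_std[OF CSM Me s0(3,2) kY e0(1) e(2) this]
      obtain c d where c: "(c, d, n) \<in> CS_triples" "similar_SL3 (transpose M) (Xmat c d n)"
        "d = - (g * e0)" "e0 dvd x * c - k" .
      have d: "\<bar>d\<bar> = \<bar>g\<bar> * e" using c(3) e0(2) by (simp add: abs_mult)
      have edv: "e dvd x * c - k" using c(4) e0(2) by auto
      have std_good: "std_good p c d n" for p using gd[OF _ edv] std_good_abs[OF c(1), of p] unfolding d by blast
      have "similar_SL3 M (transpose (Xmat c d n))" using similar_transpose[OF c(2)] by simp
      then show ?thesis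
        using std_good[of True] std_good[of False] good_similar[OF c(2)] good_similar by (simp add: std_good_def)
    qed
    from M(1) show "gompf_equiv_A0 A"
    proof
      assume "similar_SL3 A M"
      then show ?thesis using both good_similar by blast
    next
      assume "similar_SL3 (transpose A) M"
      then have "similar_SL3 A (transpose M)" using similar_transpose by fastforce
      then show ?thesis using both good_similar by blast
    qed
  qed
qed

theorem theorem5:
  fixes A :: mat3 and n :: int
  assumes "CS_matrix A"
    and "trace A = n"
    and "(-64 \<le> n \<and> n \<le> 69) \<or> n \<in> {-73, -69, -67, -66, 71, 72, 74, 78}"
  shows "gompf_equiv_A0 A"
proof -
  have "all_good n"
  proof (cases "3 \<le> n")
    case True
    then have "admissible n" using assms(3) by (auto simp: admissible_def)
    then show ?thesis by (rule all_good_admissible)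
  next
    case False
    then have "admissible (5 - n)" using assms(3) by (auto simp: admissible_def)
    then show ?thesis using all_good_Phi[OF all_good_admissible, of "5 - n"] by simp
  qed
  then show ?thesis using assms(1,2) by (simp add: all_good_def)
qed

end
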